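(* Let $K$ be a finite field of characteristic $p$ and order $q=p^n$, and let $s$ be a positive integer with $\gcd(s,q-1)=1$. For $u\in K$ put $W_u=\sum_{x\in K}\psi(x^s-ux)$, and let $\mathcal{W}_{K,s}=\{W_u : u\in K^\times\}$ (a set of distinct values). If $|\mathcal{W}_{K,s}|=4$, then $\mathcal{W}_{K,s}\subseteq\mathbb{Z}$, unless $K=\mathbb{F}_5$ and $s\equiv 3\pmod 4$, in which case $\mathcal{W}_{K,s}=\{(5+\sqrt5)/2,\,(5-\sqrt5)/2,\,\sqrt5,\,-\sqrt5\}$.
   Context: $\zeta=\exp(2\pi i/p)$, $\mathrm{Tr}\colon K\to\mathbb{F}_p$ is the absolute trace $\mathrm{Tr}(x)=x+x^p+\cdots+x^{q/p}$, and $\psi(x)=\zeta^{\mathrm{Tr}(x)}$ is the canonical additive character of $K$. *)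

theory Defs
  imports "HOL-Analysis.Analysis" "HOL-Computational_Algebra.Primes"
begin

definition field_degree :: "'a::{field,finite} itself \<Rightarrow> nat" where
  "field_degree _ = (THE n. CARD('a) = CHAR('a) ^ n)"

definition abs_trace :: "'a::{field,finite} \<Rightarrow> 'a" where
  "abs_trace x = (\<Sum>i<field_degree TYPE('a). x ^ (CHAR('a) ^ i))"

text \<open>Identify the prime-field element Tr(x) with the residue k in {0..p-1}, of_nat k = Tr(x).\<close>
definition trace_residue :: "'a::{field,finite} \<Rightarrow> nat" where
  "trace_residue x = (THE k. k < CHAR('a) \<and> of_nat k = abs_trace x)"

definition add_char :: "'a::{field,finite} \<Rightarrow> complex" where
  "add_char x = cis (2 * pi * real (trace_residue x) / real CHAR('a))"

definition walsh_value :: "nat \<Rightarrow> 'a::{field,finite} \<Rightarrow> complex" where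
  "walsh_value s u = (\<Sum>x\<in>(UNIV::'a set). add_char (x ^ s - u * x))"

definition walsh_spectrum :: "nat \<Rightarrow> 'a::{field,finite} itself \<Rightarrow> complex set" where
  "walsh_spectrum s _ = (walsh_value s :: 'a \<Rightarrow> complex) ` (UNIV - {0})"

end

theory Submission
  imports Defs "HOL-Computational_Algebra.Computational_Algebra" "HOL-Number_Theory.Number_Theory"
begin

text \<open>
  An automorphism of the p-th cyclotomic field sends W u to W (c u) for some c in the prime field,
  so a generator of the Galois group induces one permutation of the spectrum, and a value is an
  integer if it is fixed. The Weil sums are orthogonal to their dilates and translates, and their
  third moments count solutions of x^s + y^s = z^s on a line. If the permutation of
  the four values is not the identity, its cycle type is one of four. A 4-cycle, a 3-cycle and two
  2-cycles contradict the first moments (up to the third) as soon as q > 5.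

  For a single transposition, with M the multiplicity of a moved value, q^2 / M is the square of
  the difference of the moved values, so M is an odd power of p. The autocorrelation of
  W u - W (-u) shows that the values are, up to symmetrization, integer multiples of q / M. Correlating
  a quadratic relation between the even and odd parts of W with the sums T c gives for
  every c outside {0, 1, -1} a linear relation between the numbers of solutions of
  x^s + (1-x)^s = c and x^s - (1-x)^s = c. Since the latter equation cannot be solvable exactly once
  for each c, some c has no solution, and this forces one fixed value to be 0 and yields an equation
  between powers of p that Vieta jumping excludes.
\<close>

section \<open>The canonical additive character\<close>

text \<open>The element c of the Galois action satisfies c^s = g^(s-1) for a primitive root g mod p,
  so c = 1 whenever p - 1 divides s - 1. As s is odd for odd p, a moved value forces p >= 5. This is
  the source of the factor 5 between distinct powers of p on which the size estimates rest, and for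
  q = 5 it leaves only s = 3 mod 4. The Galois action is used twice: it makes symmetric functions of
  an orbit integers, and, since c is not 1, the correlation of W u with W (c u) vanishes, which is
  one equation more than the moments supply. For a transposition c = -1. Away from u = 0 the even
  part W u + W (-u) has at most three values, and the odd part vanishes exactly where W takes a
  fixed value; this is the origin of the quadratic relation. It may fail at u = 0, but T kappa 0 = 0
  for kappa not 0. Excluding kappa = 1 and kappa = -1 removes the correlations of T kappa with W u
  and W (-u). The exclusions cost nothing: for these three parameters x^s - (1-x)^s = kappa always
  has a solution.\<close>

lemma prime_CHAR_finite: "prime CHAR('a::{field,finite})"
  by (intro prime_CHAR_semidom finite_imp_CHAR_pos) auto

lemma card_gt_1: "CARD('a::{field,finite}) > 1"
proof -
  have "card {0, 1 :: 'a} \<le> CARD('a)" by (intro card_mono) auto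
  thus ?thesis by simp
qed

lemma power_card_minus_1:
  fixes x :: "'a::{field,finite}"
  assumes "x \<noteq> 0"
  shows "x ^ (CARD('a) - 1) = 1"
proof -
  have "(\<Prod>y\<in>UNIV-{0}. x * y) = (\<Prod>y\<in>UNIV-{0::'a}. y)"
    by (rule prod.reindex_bij_witness[of _ "\<lambda>y. y / x" "\<lambda>y. x * y"]) (use assms in auto)
  hence "x ^ (CARD('a) - 1) * (\<Prod>y\<in>UNIV-{0::'a}. y) = 1 * (\<Prod>y\<in>UNIV-{0::'a}. y)"
    by (simp add: prod.distrib)
  moreover have "(\<Prod>y\<in>UNIV-{0::'a}. y) \<noteq> 0" by simp
  ultimately show ?thesis by (metis mult_right_cancel)
qed

lemma power_card_same:
  fixes x :: "'a::{field,finite}"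
  shows "x ^ CARD('a) = x"
proof (cases "x = 0")
  case False
  have "x ^ CARD('a) = x ^ Suc (CARD('a) - 1)" using card_gt_1[where ?'a='a] by simp
  also have "\<dots> = x" using power_card_minus_1[OF False] by (simp only: power_Suc mult_1_right)
  finally show ?thesis .
qed (use card_gt_1[where ?'a='a] in simp)

lemma of_nat_CHAR_inj:
  assumes "of_nat i = (of_nat j :: 'a::{field,finite})" "i < CHAR('a)" "j < CHAR('a)"
  shows "i = j"
  using assms of_nat_eq_iff_cong_CHAR[of i j, where ?'a='a] by (simp add: cong_def)

text \<open>A subset closed under addition, of p-power order and as large as possible, is
  everything: adjoining the multiples of a missing element v multiplies the order by p. The orders
  are bounded by that of the field, so a maximum exists.\<close>

lemma card_eq_CHAR_power: "\<exists>n. CARD('a::{field,finite}) = CHAR('a) ^ n"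
proof -
  let ?p = "CHAR('a)"
  let ?sub = "\<lambda>H::'a set. 0 \<in> H \<and> (\<forall>x\<in>H. \<forall>y\<in>H. x + y \<in> H) \<and> (\<exists>n. card H = ?p ^ n)"
  have p1: "?p > 1" using prime_CHAR_finite prime_gt_1_nat by blast
  have "?sub {0}" by (auto intro!: exI[of _ 0])
  hence "\<exists>H. ?sub H \<and> (\<forall>H'. ?sub H' \<longrightarrow> card H' \<le> card H)"
    by (intro ex_has_greatest_nat[where b = "Suc CARD('a)" and f = card]) (auto intro!: le_imp_less_Suc card_mono)
  then obtain H n where H: "?sub H" and max: "\<And>H'. ?sub H' \<Longrightarrow> card H' \<le> card H" and n: "card H = ?p ^ n"
    by blast
  have mult: "of_nat k * x \<in> H" if "x \<in> H" for k x using H that by (induction k) (auto simp: algebra_simps)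
  have neg: "- x \<in> H" if "x \<in> H" for x
  proof -
    have "of_nat (?p - 1) * x = - x" using p1 by (simp add: of_nat_diff)
    thus ?thesis using mult[OF that] by metis
  qed
  have "H = UNIV"
  proof (rule ccontr)
    assume "H \<noteq> UNIV"
    then obtain v where v: "v \<notin> H" by blast
    \<comment> \<open>By Bezout some multiple of k is 1 mod p, so k v in H would put v itself into
      H.\<close>
    have v': "of_nat k * v \<notin> H" if k: "0 < k" "k < ?p" for k
    proof
      assume A: "of_nat k * v \<in> H"
      have "coprime k ?p" using prime_nat_iff'' prime_CHAR_finite[where ?'a='a] k
        by (metis coprime_commute nat_dvd_not_less prime_imp_coprime)
      then obtain a b where ab: "a * k = b * ?p + 1" using coprime_bezout_strong[of k ?p] p1 by (metis less_irrefl mult.commute)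
      have "of_nat a * (of_nat k * v) = of_nat (a * k) * v" by simp
      also have "\<dots> = v" unfolding ab by simp
      finally show False using mult[OF A, of a] v by metis
    qed
    define H' where "H' = (\<lambda>(h, k). h + of_nat k * v) ` (H \<times> {..<?p})"
    have inj: "inj_on (\<lambda>(h, k). h + of_nat k * v) (H \<times> {..<?p})"
    proof (rule inj_onI, clarsimp)
      fix h k h' k' assume *: "h \<in> H" "h' \<in> H" "k < ?p" "k' < ?p" "h + of_nat k * v = h' + of_nat k' * v"
      have kk: "k = k'" if "h \<in> H" "h' \<in> H" "k < ?p" "k' < ?p" "h + of_nat k * v = h' + of_nat k' * v" "k \<le> k'"
        for h h' k k'
      proof (rule ccontr)
        assume "k \<noteq> k'"
        have "of_nat (k' - k) * v = h + - h'" using that by (simp add: of_nat_diff algebra_simps)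
        moreover have "h + - h' \<in> H" using H neg that by blast
        ultimately have "of_nat (k' - k) * v \<in> H" by metis
        moreover have "0 < k' - k" "k' - k < ?p" using that \<open>k \<noteq> k'\<close> by linarith+
        ultimately show False using v' by blast
      qed
      have "k = k'" using kk[of h h' k k'] kk[of h' h k' k] * by (metis nat_le_linear)
      thus "h = h' \<and> k = k'" using * by simp
    qed
    have "card H' = ?p ^ Suc n" unfolding H'_def using inj by (simp add: card_image card_cartesian_product n)
    moreover have "0 \<in> H'" unfolding H'_def using H p1 by (auto intro!: image_eqI[of _ _ "(0, 0)"])
    moreover have "x + y \<in> H'" if "x \<in> H'" "y \<in> H'" for x y
    proof -
      obtain h k h' k' where *: "x = h + of_nat k * v" "y = h' + of_nat k' * v" "h \<in> H" "h' \<in> H"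
        using \<open>x \<in> H'\<close> \<open>y \<in> H'\<close> by (auto simp: H'_def)
      have "(of_nat ((k + k') mod ?p) :: 'a) = of_nat (k + k')"
        by (simp only: of_nat_eq_iff_cong_CHAR cong_def mod_mod_trivial)
      hence "x + y = (h + h') + of_nat ((k + k') mod ?p) * v" using * by (simp add: algebra_simps)
      moreover have "h + h' \<in> H" using H * by blast
      ultimately show ?thesis unfolding H'_def using p1
        by (auto intro!: image_eqI[of _ _ "(h + h', (k + k') mod ?p)"])
    qed
    ultimately have "card H' \<le> card H" by (intro max) blast
    thus False using \<open>card H' = ?p ^ Suc n\<close> n p1 by simp
  qed
  thus ?thesis using n by auto
qed

lemma CARD_eq: "CARD('a::{field,finite}) = CHAR('a) ^ field_degree TYPE('a)"
  unfolding field_degree_def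
proof (rule theI')
  obtain n where n: "CARD('a) = CHAR('a) ^ n" using card_eq_CHAR_power by blast
  have "CHAR('a) > 1" using prime_CHAR_finite prime_gt_1_nat by blast
  thus "\<exists>!n. CARD('a) = CHAR('a) ^ n" using n by (intro ex1I[of _ n]) auto
qed

lemma field_degree_pos: "field_degree TYPE('a::{field,finite}) > 0"
  using CARD_eq[where ?'a='a] card_gt_1[where ?'a='a] by (cases "field_degree TYPE('a)") auto

section \<open>The absolute trace\<close>

lemma abs_trace_add: "abs_trace (x + y) = abs_trace x + abs_trace (y :: 'a::{field,finite})"
  by (simp add: abs_trace_def freshmans_dream'[OF prime_CHAR_finite refl] sum.distrib)

text \<open>Frobenius permutes the summands cyclically: the last one, x^(q/p), becomes x^q = x.
  Being fixed by Frobenius is what places the trace in the prime field.\<close>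

lemma abs_trace_power: "abs_trace (x :: 'a::{field,finite}) ^ CHAR('a) = abs_trace x"
proof -
  define n where "n = field_degree TYPE('a)"
  obtain m where m: "n = Suc m" using field_degree_pos[where ?'a='a] by (cases n) (auto simp: n_def)
  have "abs_trace x ^ CHAR('a) = (\<Sum>i<n. (x ^ (CHAR('a) ^ i)) ^ CHAR('a))"
    unfolding abs_trace_def n_def by (rule freshmans_dream_sum[OF prime_CHAR_finite refl])
  also have "\<dots> = (\<Sum>i<n. x ^ (CHAR('a) ^ Suc i))" by (simp add: mult.commute flip: power_mult)
  also have "\<dots> = (\<Sum>i<m. x ^ (CHAR('a) ^ Suc i)) + x ^ CARD('a)"
    by (simp add: m CARD_eq flip: n_def)
  also have "\<dots> = (\<Sum>i<n. x ^ (CHAR('a) ^ i))"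
    unfolding m by (subst sum.lessThan_Suc_shift) (simp add: power_card_same)
  finally show ?thesis by (simp add: abs_trace_def n_def)
qed

text \<open>X^p - X has at most p roots, and the p residues already are roots.\<close>

lemma prime_field_iff:
  "(y :: 'a::{field,finite}) ^ CHAR('a) = y \<longleftrightarrow> (\<exists>k<CHAR('a). y = of_nat k)"
proof -
  let ?p = "CHAR('a)"
  have p1: "?p > 1" using prime_CHAR_finite prime_gt_1_nat by blast
  define f :: "'a poly" where "f = Polynomial.monom 1 ?p - Polynomial.monom 1 1"
  have pf: "poly f y = y ^ ?p - y" for y by (simp add: f_def poly_monom)
  have deg: "degree f \<le> ?p" unfolding f_def using p1 by (intro degree_diff_le degree_monom_le order.trans[OF degree_monom_le]) auto
  have "poly.coeff f ?p = 1" using p1 by (simp add: f_def Polynomial.coeff_monom)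
  hence f0: "f \<noteq> 0" by auto
  have root: "(of_nat k :: 'a) ^ ?p = of_nat k" for k
    by (induction k) (use p1 in \<open>auto simp: freshmans_dream[OF prime_CHAR_finite refl] power_0_left\<close>)
  have "card (of_nat ` {..<?p} :: 'a set) = ?p" by (subst card_image) (auto intro!: inj_onI of_nat_CHAR_inj)
  moreover have "of_nat ` {..<?p} \<subseteq> {y. poly f y = 0}" using root by (auto simp: pf)
  moreover have "card {y. poly f y = 0} \<le> ?p" using card_poly_roots_bound[OF f0] deg by simp
  ultimately have "of_nat ` {..<?p} = {y. poly f y = 0}"
    by (intro card_seteq) (auto intro: poly_roots_finite f0)
  thus ?thesis by (auto simp: pf set_eq_iff image_iff)
qed

lemma trace_residue:
  fixes x :: "'a::{field,finite}"
  shows "trace_residue x < CHAR('a)" "of_nat (trace_residue x) = abs_trace x"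
proof -
  have "\<exists>k<CHAR('a). abs_trace x = of_nat k" using abs_trace_power prime_field_iff by blast
  hence "\<exists>!k. k < CHAR('a) \<and> of_nat k = abs_trace x" using of_nat_CHAR_inj[where ?'a='a] by metis
  from theI'[OF this] show "trace_residue x < CHAR('a)" "of_nat (trace_residue x) = abs_trace x"
    by (simp_all add: trace_residue_def)
qed

section \<open>The character as a power of a root of unity\<close>

definition char_root :: "'a::{field,finite} itself \<Rightarrow> complex" where
  "char_root _ = cis (2 * pi / real CHAR('a))"

lemma char_root: "char_root TYPE('a::{field,finite}) ^ CHAR('a) = 1" "char_root TYPE('a) \<noteq> 1"
proof -
  have p1: "CHAR('a) > 1" using prime_CHAR_finite prime_gt_1_nat by blast
  thus "char_root TYPE('a) ^ CHAR('a) = 1" by (simp add: char_root_def Complex.DeMoivre)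
  show "char_root TYPE('a) \<noteq> 1"
  proof
    assume "char_root TYPE('a) = 1"
    hence "cos (2 * pi / real CHAR('a)) = 1" by (simp add: char_root_def complex_eq_iff)
    then obtain k :: int where "2 * pi / real CHAR('a) = real_of_int k * 2 * pi" by (auto simp: cos_one_2pi_int)
    hence "1 = real_of_int k * real CHAR('a)" using p1 by (simp add: field_simps)
    hence "1 = k * int CHAR('a)" by (metis of_int_1 of_int_eq_iff of_int_mult of_int_of_nat_eq)
    hence "int CHAR('a) dvd 1" by (metis dvd_triv_right)
    thus False using p1 by simp
  qed
qed

lemma add_char_eq: "add_char (x :: 'a::{field,finite}) = char_root TYPE('a) ^ trace_residue x"
  by (simp add: add_char_def char_root_def Complex.DeMoivre mult.commute)

lemma char_root_power_cong:
  "[i = j] (mod CHAR('a)) \<Longrightarrow> char_root TYPE('a::{field,finite}) ^ i = char_root TYPE('a) ^ j"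
proof -
  have *: "char_root TYPE('a) ^ i = char_root TYPE('a) ^ (i mod CHAR('a))" for i
    by (metis (no_types) char_root(1) mult_1 power_add power_mult power_one mult_div_mod_eq)
  assume "[i = j] (mod CHAR('a))"
  thus ?thesis using *[of i] *[of j] by (simp add: cong_def)
qed

lemma add_char_add: "add_char (x + y) = add_char x * add_char (y :: 'a::{field,finite})"
proof -
  have "(of_nat (trace_residue (x + y)) :: 'a) = of_nat (trace_residue x + trace_residue y)"
    by (simp add: trace_residue abs_trace_add)
  hence "[trace_residue (x + y) = trace_residue x + trace_residue y] (mod CHAR('a))"
    by (simp only: of_nat_eq_iff_cong_CHAR)
  thus ?thesis by (simp add: add_char_eq char_root_power_cong flip: power_add)
qed

lemma add_char_nonzero: "add_char (x :: 'a::{field,finite}) \<noteq> 0"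
  by (simp add: add_char_def)

lemma add_char_0 [simp]: "add_char (0 :: 'a::{field,finite}) = 1"
  using add_char_add[of 0 "0::'a"] add_char_nonzero[of "0::'a"] by simp

lemma cnj_add_char: "cnj (add_char x) = add_char (- x :: 'a::{field,finite})"
proof -
  have "cnj (add_char x) * add_char x = 1" by (simp add: add_char_def cis_cnj cis_mult)
  moreover have "add_char (- x) * add_char x = 1" by (simp flip: add_char_add)
  ultimately show ?thesis by (metis add_char_nonzero mult_right_cancel)
qed

lemma add_char_of_nat_mult: "add_char (of_nat k * x :: 'a::{field,finite}) = add_char x ^ k"
  by (induction k) (simp_all add: algebra_simps add_char_add)

text \<open>The trace is a polynomial of degree at most q/p, which is less than q, and its
  coefficient at X is 1, so it does not vanish everywhere. A nonzero residue is invertible mod p, so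
  the corresponding power of the root of unity is not 1.\<close>

lemma add_char_nontrivial: "\<exists>x :: 'a::{field,finite}. add_char x \<noteq> 1"
proof -
  let ?p = "CHAR('a)" and ?n = "field_degree TYPE('a)"
  have p1: "?p > 1" using prime_CHAR_finite prime_gt_1_nat by blast
  define f :: "'a poly" where "f = (\<Sum>i<?n. Polynomial.monom 1 (?p ^ i))"
  have pf: "poly f x = abs_trace x" for x by (simp add: f_def abs_trace_def poly_sum poly_monom)
  have deg: "degree f \<le> ?p ^ (?n - 1)" unfolding f_def
    using p1 by (intro degree_sum_le order.trans[OF degree_monom_le] power_increasing) auto
  have "poly.coeff f 1 = (\<Sum>i<?n. if i = 0 then 1 else 0)"
    unfolding f_def coeff_sum Polynomial.coeff_monom using p1 by (intro sum.cong) auto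
  also have "\<dots> = 1" using field_degree_pos[where ?'a='a] by simp
  finally have f0: "f \<noteq> 0" by auto
  have "card {x. poly f x = 0} \<le> ?p ^ (?n - 1)" using card_poly_roots_bound[OF f0] deg by simp
  also have "\<dots> < CARD('a)" unfolding CARD_eq using p1 field_degree_pos[where ?'a='a] by simp
  finally have "{x. poly f x = 0} \<noteq> UNIV" by auto
  then obtain x where "poly f x \<noteq> 0" by auto
  hence x: "abs_trace x \<noteq> 0" by (simp only: pf not_False_eq_True)
  let ?t = "trace_residue x"
  have t: "0 < ?t" "?t < ?p" using trace_residue[of x] x by (auto intro!: Nat.gr0I)
  have "coprime ?t ?p" using t prime_CHAR_finite[where ?'a='a]
    by (metis coprime_commute nat_dvd_not_less prime_imp_coprime)
  then obtain a b where ab: "a * ?t = b * ?p + 1" using coprime_bezout_strong[of ?t ?p] p1 by (metis less_irrefl mult.commute)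
  have "add_char x \<noteq> 1"
  proof
    assume "add_char x = 1"
    hence "char_root TYPE('a) ^ (a * ?t) = 1" by (simp add: add_char_eq mult.commute[of a] power_mult)
    moreover have "char_root TYPE('a) ^ (b * ?p + 1) = char_root TYPE('a)"
      by (simp add: mult.commute[of b] power_mult char_root power_add)
    ultimately show False using ab char_root(2)[where ?'a='a] by simp
  qed
  thus ?thesis by blast
qed

text \<open>Translating x by y / u multiplies the sum by the character value at y, which differs
  from 1.\<close>

lemma sum_add_char:
  fixes u :: "'a::{field,finite}"
  shows "(\<Sum>x\<in>UNIV. add_char (u * x)) = (if u = 0 then of_nat CARD('a) else 0)"
proof (cases "u = 0")
  case False
  obtain y :: 'a where y: "add_char y \<noteq> 1" using add_char_nontrivial by blast
  let ?S = "\<Sum>x\<in>UNIV. add_char (u * x)"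
  have "?S = (\<Sum>x\<in>UNIV. add_char (u * (x + y / u)))"
    by (rule sum.reindex_bij_witness[of _ "\<lambda>x. x + y / u" "\<lambda>x. x - y / u"]) auto
  also have "\<dots> = ?S * add_char y" using False by (simp add: algebra_simps add_char_add sum_distrib_left)
  finally have "?S * (add_char y - 1) = 0" by (simp add: algebra_simps)
  thus ?thesis using y False by simp
qed simp

section \<open>Conjugation in the cyclotomic field\<close>

text \<open>Eisenstein's criterion; irreducibility is meant over the rationals, hence a constant
  factor rather than a unit. Since p^2 does not divide the constant coefficient of f, p divides that
  of only one factor g. At the first coefficient of g not divisible by p, the one of f is not
  divisible either, so this index is at least deg f.\<close>

lemma eisenstein_degree:
  fixes f g h :: "int poly"
  assumes p: "prime p" and fgh: "f = g * h"
    and lead: "\<not> p dvd lead_coeff f"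
    and low: "\<And>i. i < degree f \<Longrightarrow> p dvd poly.coeff f i"
    and const: "\<not> p\<^sup>2 dvd poly.coeff f 0"
  shows "degree g = 0 \<or> degree h = 0"
proof -
  have *: "degree h = 0"
    if fgh: "f = g * h" and pg: "p dvd poly.coeff g 0" for g h
  proof -
    have f0: "f \<noteq> 0" using lead by auto
    have g0: "g \<noteq> 0" and h0: "h \<noteq> 0" using f0 fgh by auto
    have nph: "\<not> p dvd poly.coeff h 0"
    proof
      assume "p dvd poly.coeff h 0"
      hence "p * p dvd poly.coeff g 0 * poly.coeff h 0" using pg by (intro mult_dvd_mono)
      thus False using const fgh by (simp add: power2_eq_square coeff_mult)
    qed
    have "\<not> p dvd lead_coeff g" using lead fgh by (auto simp: lead_coeff_mult)
    hence ex: "\<exists>i. \<not> p dvd poly.coeff g i" by blast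
    define i where "i = (LEAST i. \<not> p dvd poly.coeff g i)"
    have i: "\<not> p dvd poly.coeff g i" using LeastI_ex[OF ex] by (simp add: i_def)
    have less: "p dvd poly.coeff g j" if "j < i" for j
      using not_less_Least[of j "\<lambda>i. \<not> p dvd poly.coeff g i"] that by (auto simp: i_def)
    have "i \<le> degree g" using i by (intro le_degree) auto
    have "poly.coeff f i = (\<Sum>j\<le>i. poly.coeff g j * poly.coeff h (i - j))" by (simp add: fgh coeff_mult)
    also have "\<dots> = poly.coeff g i * poly.coeff h 0 + (\<Sum>j<i. poly.coeff g j * poly.coeff h (i - j))"
      by (simp flip: lessThan_Suc_atMost)
    finally have eq: "poly.coeff f i = poly.coeff g i * poly.coeff h 0 + (\<Sum>j<i. poly.coeff g j * poly.coeff h (i - j))" .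
    have "p dvd (\<Sum>j<i. poly.coeff g j * poly.coeff h (i - j))" by (intro dvd_sum dvd_mult2) (auto intro: less)
    moreover have "\<not> p dvd poly.coeff g i * poly.coeff h 0" using i nph p by (simp add: prime_dvd_mult_iff)
    ultimately have "\<not> p dvd poly.coeff f i" unfolding eq by (simp add: dvd_add_left_iff)
    hence "degree f \<le> i" using low not_le by blast
    moreover have "degree f = degree g + degree h" using fgh g0 h0 by (simp add: degree_mult_eq)
    ultimately show ?thesis using \<open>i \<le> degree g\<close> by linarith
  qed
  show ?thesis
  proof (cases "degree f = 0")
    case True
    moreover have "f \<noteq> 0" using lead by auto
    ultimately show ?thesis using fgh by (auto simp: degree_mult_eq)
  next
    case False
    hence "p dvd poly.coeff g 0 * poly.coeff h 0" using low[of 0] fgh by (simp add: coeff_mult)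
    hence "p dvd poly.coeff g 0 \<or> p dvd poly.coeff h 0" using p by (simp add: prime_dvd_mult_iff)
    thus ?thesis using *[of g h] *[of h g] fgh by (auto simp: mult.commute)
  qed
qed

text \<open>Cyclotomic integers are represented as integer polynomials at a root of unity, so an
  automorphism is evaluation at another root of unity and no Galois group has to be
  constructed.\<close>

abbreviation int_poly_at :: "int poly \<Rightarrow> 'b::comm_ring_1 \<Rightarrow> 'b" where
  "int_poly_at P x \<equiv> poly (map_poly of_int P) x"

lemma int_poly_at_pCons: "int_poly_at (pCons a P) x = of_int a + x * int_poly_at P x"
  by (simp add: map_poly_pCons)

lemma int_poly_at_add: "int_poly_at (P + Q) x = int_poly_at P x + int_poly_at Q x"
  by (induction P Q rule: poly_induct2) (simp_all add: int_poly_at_pCons algebra_simps)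

lemma int_poly_at_smult: "int_poly_at (Polynomial.smult a P) x = of_int a * int_poly_at P x"
  by (induction P) (simp_all add: int_poly_at_pCons algebra_simps)

lemma int_poly_at_mult: "int_poly_at (P * Q) x = int_poly_at P x * int_poly_at Q x"
  by (induction P) (simp_all add: int_poly_at_pCons int_poly_at_add int_poly_at_smult algebra_simps)

lemma int_poly_at_uminus: "int_poly_at (- P) x = - int_poly_at P x"
  by (induction P) (simp_all add: int_poly_at_pCons algebra_simps)

lemma int_poly_at_pcompose: "int_poly_at (pcompose P Q) x = int_poly_at P (int_poly_at Q x)"
  by (induction P) (simp_all add: int_poly_at_pCons pcompose_pCons int_poly_at_add int_poly_at_mult)

text \<open>An integer polynomial Q of least degree vanishing at x plays the minimal polynomial.
  Pseudo-division stays in Z[X] at the price of a factor c, which Gauss's lemma removes: the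
  primitive part of Q divides f. Irreducibility makes f a constant multiple of it, so Q vanishes at
  y, and with Q every P that vanishes at x.\<close>

lemma common_root_transfer:
  fixes f P :: "int poly" and x y :: "'b::field_char_0"
  assumes irr: "\<And>g h. f = g * h \<Longrightarrow> degree g = 0 \<or> degree h = 0"
    and f0: "f \<noteq> 0"
    and fx: "int_poly_at f x = 0" and fy: "int_poly_at f y = 0"
    and Px: "int_poly_at P x = 0"
  shows "int_poly_at P y = 0"
proof -
  let ?A = "\<lambda>Q::int poly. Q \<noteq> 0 \<and> int_poly_at Q x = 0"
  define Q where "Q = arg_min degree ?A"
  have Q: "?A Q" unfolding Q_def using f0 fx by (intro arg_min_natI[of ?A f]) auto
  have min: "degree Q \<le> degree R" if "?A R" for R
    unfolding Q_def using that by (rule arg_min_nat_le)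
  have dvd: "\<exists>c A. c \<noteq> 0 \<and> Polynomial.smult c R = Q * A" if R: "int_poly_at R x = 0" for R
  proof -
    obtain A B where AB: "pseudo_divmod R Q = (A, B)" by force
    define c where "c = lead_coeff Q ^ (Suc (degree R) - degree Q)"
    have eq: "Polynomial.smult c R = Q * A + B" and B: "B = 0 \<or> degree B < degree Q"
      using pseudo_divmod[OF _ AB] Q unfolding c_def by auto
    have "int_poly_at (Q * A + B) x = 0"
      unfolding eq[symmetric] using R by (simp add: int_poly_at_smult)
    hence "int_poly_at B x = 0" using Q by (simp add: int_poly_at_add int_poly_at_mult)
    hence "B = 0" using B min[of B] by (meson not_le)
    moreover have "c \<noteq> 0" using Q by (simp add: c_def)
    ultimately show ?thesis using eq by auto
  qed
  define Q' where "Q' = primitive_part Q"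
  obtain c A where cA: "c \<noteq> 0" "Polynomial.smult c f = Q * A" using dvd[OF fx] by blast
  have "Q' dvd primitive_part (Polynomial.smult c f)" unfolding Q'_def cA(2) by (intro primitive_part_dvd_primitive_partI) auto
  also have "primitive_part (Polynomial.smult c f) = [:unit_factor c:] * primitive_part f"
    by (simp add: primitive_part_smult)
  also have "\<dots> dvd f"
  proof (subst mult_unit_dvd_iff')
    show "is_unit [:unit_factor c:]" using cA(1) by (simp add: is_unit_const_poly_iff)
    have "primitive_part f dvd Polynomial.smult (content f) (primitive_part f)" by (rule dvd_smult) simp
    thus "primitive_part f dvd f" by simp
  qed
  finally have "Q' dvd f" .
  then obtain H where H: "f = Q' * H" by (elim dvdE)
  have degQ: "degree Q \<noteq> 0"
  proof
    assume "degree Q = 0"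
    then obtain a where "Q = [:a:]" by (rule degree_eq_zeroE)
    thus False using Q by (auto simp: int_poly_at_pCons)
  qed
  hence "degree H = 0" using irr[OF H] by (simp add: Q'_def)
  then obtain b where b: "H = [:b:]" by (rule degree_eq_zeroE)
  have "b \<noteq> 0" using H b f0 by auto
  have "int_poly_at f y = of_int b * int_poly_at Q' y"
    unfolding H b by (simp add: int_poly_at_mult int_poly_at_smult)
  hence "int_poly_at Q' y = 0" using fy \<open>b \<noteq> 0\<close> by simp
  hence "int_poly_at (Polynomial.smult (content Q) Q') y = 0" by (simp add: int_poly_at_smult)
  hence Qy: "int_poly_at Q y = 0" by (simp add: Q'_def)
  obtain c A where cA: "c \<noteq> 0" "Polynomial.smult c P = Q * A" using dvd[OF Px] by blast
  have "of_int c * int_poly_at P y = int_poly_at (Polynomial.smult c P) y"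
    by (simp add: int_poly_at_smult)
  also have "\<dots> = 0" unfolding cA(2) using Qy by (simp add: int_poly_at_mult)
  finally show ?thesis using cA(1) by simp
qed

text \<open>The p-th cyclotomic polynomial becomes Eisenstein at p after X is replaced by X + 1, so
  everything is evaluated at z - 1 and z^k - 1 instead of z and z^k.\<close>

lemma root_of_unity_conjugate:
  fixes P :: "int poly" and z :: "'b::field_char_0"
  assumes p: "prime p" and z: "z ^ p = 1" "z \<noteq> 1" and k: "\<not> p dvd k"
    and P: "int_poly_at P z = 0"
  shows "int_poly_at P (z ^ k) = 0"
proof -
  have p1: "p > 1" using p prime_gt_1_nat by blast
  \<comment> \<open>This is ((X + 1)^p - 1) / X, the shifted cyclotomic polynomial.\<close>
  define f :: "int poly" where "f = (\<Sum>i<p. Polynomial.monom (int (p choose Suc i)) i)"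
  have cf: "poly.coeff f i = (if i < p then int (p choose Suc i) else 0)" for i
    by (simp add: f_def coeff_sum Polynomial.coeff_monom)
  have deg: "degree f = p - 1"
  proof (rule antisym)
    show "degree f \<le> p - 1" by (rule degree_le) (auto simp: cf)
    show "p - 1 \<le> degree f" by (rule le_degree) (use p1 in \<open>auto simp: cf\<close>)
  qed
  have f0: "f \<noteq> 0" using deg p1 by auto
  have irr: "degree g = 0 \<or> degree h = 0" if "f = g * h" for g h
  proof (rule eisenstein_degree[OF _ that, of "int p"])
    show "prime (int p)" using p by simp
    show "\<not> int p dvd lead_coeff f" using p1 by (simp add: deg cf)
    show "int p dvd poly.coeff f i" if "i < degree f" for i
      using that p by (auto simp: deg cf intro!: dvd_choose_prime)
    show "\<not> (int p)\<^sup>2 dvd poly.coeff f 0"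
    proof
      assume "(int p)\<^sup>2 dvd poly.coeff f 0"
      hence "p * p dvd p" using p1 by (simp add: cf power2_eq_square flip: of_nat_mult)
      thus False using p1 by (auto dest!: dvd_imp_le)
    qed
  qed
  have feval: "int_poly_at f x * x = (x + 1) ^ p - 1" for x :: 'b
  proof -
    have "int_poly_at f x = (\<Sum>i\<le>degree f. poly.coeff (map_poly of_int f) i * x ^ i)"
      by (subst poly_altdef) (simp add: degree_map_poly)
    also have "\<dots> = (\<Sum>i<p. of_nat (p choose Suc i) * x ^ i)"
      using p1 by (intro sum.cong) (auto simp: deg coeff_map_poly cf)
    finally have "int_poly_at f x * x = (\<Sum>i<p. of_nat (p choose Suc i) * x ^ Suc i)"
      by (simp add: sum_distrib_left sum_distrib_right mult_ac)
    also have "\<dots> = (\<Sum>i<Suc p. of_nat (p choose i) * x ^ i) - 1"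
      by (subst sum.lessThan_Suc_shift) simp
    also have "\<dots> = (x + 1) ^ p - 1" by (simp add: binomial_ring lessThan_Suc_atMost)
    finally show ?thesis .
  qed
  have fz: "int_poly_at f (y - 1) = 0" if "y ^ p = 1" "y \<noteq> 1" for y :: 'b
    using feval[of "y - 1"] that by simp
  have z0: "z \<noteq> 0" using z p1 by (auto simp: power_0_left)
  have zk: "z ^ k \<noteq> 1"
  proof
    assume zk: "z ^ k = 1"
    have "coprime k p" using p k by (metis coprime_commute prime_imp_coprime)
    then obtain a b where ab: "a * k = b * p + 1" using coprime_bezout_strong[of k p] p1 by (metis less_irrefl mult.commute)
    have "z ^ (a * k) = 1" by (simp add: mult.commute[of a] power_mult zk)
    moreover have "z ^ (b * p + 1) = z" by (simp add: mult.commute[of b] power_mult z power_add)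
    ultimately show False using ab z by simp
  qed
  have zkp: "(z ^ k) ^ p = 1" by (metis power_mult mult.commute z(1) power_one)
  have shift: "int_poly_at (pcompose P [:1, 1:]) (y - 1) = int_poly_at P y" for y :: 'b
    by (simp add: int_poly_at_pcompose int_poly_at_pCons)
  have "int_poly_at (pcompose P [:1, 1:]) (z ^ k - 1) = 0"
  proof (rule common_root_transfer[OF irr f0])
    show "int_poly_at f (z - 1) = 0" by (rule fz) (use z in auto)
    show "int_poly_at f (z ^ k - 1) = 0" by (rule fz) (use zk zkp in auto)
    show "int_poly_at (P \<circ>\<^sub>p [:1, 1:]) (z - 1) = 0" by (simp add: shift P)
  qed
  thus ?thesis by (simp add: shift)
qed

lemma int_poly_at_monom: "int_poly_at (Polynomial.monom a n) x = of_int a * x ^ n"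
  by (simp add: map_poly_monom poly_monom)

lemma int_poly_at_sum: "int_poly_at (\<Sum>i\<in>A. P i) x = (\<Sum>i\<in>A. int_poly_at (P i) x)"
  by (induction A rule: infinite_finite_induct) (simp_all add: int_poly_at_add)

lemma int_poly_at_diff: "int_poly_at (P - Q) x = int_poly_at P x - int_poly_at Q x"
  using int_poly_at_add[of P "- Q" x] by (simp add: int_poly_at_uminus)

lemma sum_powers_root_of_unity:
  fixes z :: "'b::field"
  assumes "z ^ p = 1" "z ^ j \<noteq> 1"
  shows "(\<Sum>k<p. z ^ (j * k)) = 0"
proof -
  have "(z ^ j - 1) * (\<Sum>k<p. (z ^ j) ^ k) = (z ^ j) ^ p - 1"
    by (simp add: power_diff_1_eq)
  also have "(z ^ j) ^ p = 1" using assms(1) by (metis power_mult mult.commute power_one)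
  finally show ?thesis using assms(2) by (simp add: power_mult)
qed

text \<open>Integrality comes from a discrete Fourier transform: the sum of P(z^k) z^(l k) over all
  k < p lies in pZ. For l = 0 it is P(1) + (p - 1) r and for l = 1 it is P(1) - r, so the difference
  p r lies in pZ.\<close>

lemma int_poly_at_const_imp_Ints:
  fixes P :: "int poly" and z :: complex
  assumes p: "prime p" and z: "z ^ p = 1" "z \<noteq> 1"
    and const: "\<And>k. 0 < k \<Longrightarrow> k < p \<Longrightarrow> int_poly_at P (z ^ k) = r"
  shows "r \<in> \<int>"
proof -
  have p1: "p > 1" using p prime_gt_1_nat by blast
  \<comment> \<open>The free exponent l carries the induction over the coefficients of P: passing to
    the tail of P raises l by 1.\<close>
  have inner: "\<exists>m::int. (\<Sum>k<p. int_poly_at P (z ^ k) * z ^ (l * k)) = of_int (int p * m)" for l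
  proof (induction P arbitrary: l)
    case 0
    show ?case by (auto intro: exI[of _ 0])
  next
    case (pCons a P)
    have "\<exists>m::int. (\<Sum>k<p. z ^ (l * k)) = of_int (int p * m)"
    proof (cases "z ^ l = 1")
      case True
      thus ?thesis by (auto simp: power_mult intro!: exI[of _ 1])
    next
      case False
      thus ?thesis using sum_powers_root_of_unity[OF z(1) False] by (auto intro!: exI[of _ 0])
    qed
    then obtain m1 :: int where m1: "(\<Sum>k<p. z ^ (l * k)) = of_int (int p * m1)" by blast
    obtain m2 :: int where m2: "(\<Sum>k<p. int_poly_at P (z ^ k) * z ^ (Suc l * k)) = of_int (int p * m2)"
      using pCons.IH by blast
    have "(\<Sum>k<p. int_poly_at (pCons a P) (z ^ k) * z ^ (l * k))
       = of_int a * (\<Sum>k<p. z ^ (l * k)) + (\<Sum>k<p. int_poly_at P (z ^ k) * z ^ (Suc l * k))"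
      by (simp add: int_poly_at_pCons algebra_simps power_add sum.distrib sum_distrib_left)
    also have "\<dots> = of_int (int p * (a * m1 + m2))" unfolding m1 m2 by (simp add: algebra_simps)
    finally show ?case by blast
  qed
  have split: "(\<Sum>k<p. int_poly_at P (z ^ k) * z ^ (l * k)) = int_poly_at P 1 + r * (\<Sum>k\<in>{1..<p}. z ^ (l * k))" for l
  proof -
    have "{..<p} = insert 0 {1..<p}" using p1 by auto
    hence "(\<Sum>k<p. int_poly_at P (z ^ k) * z ^ (l * k)) = int_poly_at P 1 + (\<Sum>k\<in>{1..<p}. int_poly_at P (z ^ k) * z ^ (l * k))"
      by simp
    also have "(\<Sum>k\<in>{1..<p}. int_poly_at P (z ^ k) * z ^ (l * k)) = r * (\<Sum>k\<in>{1..<p}. z ^ (l * k))"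
      unfolding sum_distrib_left by (intro sum.cong) (auto simp: const)
    finally show ?thesis .
  qed
  have all: "(\<Sum>k<p. z ^ k) = 1 + (\<Sum>k\<in>{1..<p}. z ^ k)"
  proof -
    have "{..<p} = insert 0 {1..<p}" using p1 by auto
    thus ?thesis by simp
  qed
  have "(\<Sum>k<p. z ^ k) = 0" using sum_powers_root_of_unity[of z p 1] z by simp
  hence s1: "(\<Sum>k\<in>{1..<p}. z ^ k) = - 1" using all by (simp add: eq_neg_iff_add_eq_0 add.commute)
  obtain m0 :: int where m0: "(\<Sum>k<p. int_poly_at P (z ^ k) * z ^ (0 * k)) = of_int (int p * m0)" using inner by blast
  obtain m1 :: int where m1: "(\<Sum>k<p. int_poly_at P (z ^ k) * z ^ (1 * k)) = of_int (int p * m1)" using inner by blast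
  have "of_int (int p * m0) - of_int (int p * m1) = r * (of_nat (p - 1) + 1)"
    unfolding m0[symmetric] m1[symmetric] split using s1 by (simp add: algebra_simps)
  hence "of_nat p * r = of_nat p * of_int (m0 - m1)" using p1 by (simp add: of_nat_diff algebra_simps)
  hence "r = of_int (m0 - m1)" using p1 by (subst (asm) mult_cancel_left) auto
  thus ?thesis by simp
qed


section \<open>Arithmetic of the possible multiplicities\<close>

text \<open>As a quadratic in the larger variable x, the equation has the second root x' = (4 R + 2)
  y - x with x x' = y^2 + 8, so x' is positive. If x' < x, the pair (x', y) is smaller. Otherwise
  x^2 <= y^2 + 8 leaves finitely many pairs. The case x = y gives R x^2 = 2.\<close>

lemma vieta_descent:
  fixes x y R :: int
  assumes "x > 0" "y > 0" "R > 0" "x\<^sup>2 + y\<^sup>2 + 8 = (4 * R + 2) * x * y"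
  shows "R \<le> 2"
  using assms
proof (induction "nat (x + y)" arbitrary: x y rule: less_induct)
  case (less x y)
  have main: "R \<le> 2" if x: "x > 0" and y: "y > 0" and eq: "x\<^sup>2 + y\<^sup>2 + 8 = (4 * R + 2) * x * y"
    and IH: "\<And>x' y'. nat (x' + y') < nat (x + y) \<Longrightarrow> 0 < x' \<Longrightarrow> 0 < y' \<Longrightarrow>
       x'\<^sup>2 + y'\<^sup>2 + 8 = (4 * R + 2) * x' * y' \<Longrightarrow> R \<le> 2" and xy: "x \<ge> y" for x y
  proof (cases "x = y")
    case True
    hence "R * x\<^sup>2 = 2" using eq by (simp add: power2_eq_square algebra_simps)
    hence "R dvd 2" by (metis dvd_triv_left)
    thus ?thesis by (auto dest: zdvd_imp_le)
  next
    case False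
    define x' where "x' = (4 * R + 2) * y - x"
    have xx': "x * x' = y\<^sup>2 + 8" using eq by (simp add: x'_def power2_eq_square algebra_simps)
    have x'0: "x' > 0"
    proof -
      have "0 < x * x'" using xx' zero_le_power2[of y] by linarith
      thus ?thesis using x by (simp add: zero_less_mult_iff)
    qed
    show ?thesis
    proof (cases "x' < x")
      case True
      show ?thesis
      proof (rule IH[of x' y])
        have "x'\<^sup>2 + y\<^sup>2 + 8 = x' * x' + x * x'" using xx' by (simp add: power2_eq_square)
        also have "\<dots> = (4 * R + 2) * x' * y" by (simp add: x'_def algebra_simps)
        finally show "x'\<^sup>2 + y\<^sup>2 + 8 = (4 * R + 2) * x' * y" .
      qed (use True x y x'0 in auto)
    next
      case F: False
      have "x * x \<le> y\<^sup>2 + 8" using F x xx' mult_left_mono[of x x' x] by simp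
      moreover have "(y + 1) * (y + 1) \<le> x * x" using False xy y by (intro mult_mono) auto
      ultimately have "y \<le> 3" "x * x \<le> y * y + 8" by (simp_all add: power2_eq_square algebra_simps)
      moreover have "x \<le> 4"
      proof (rule ccontr)
        assume "\<not> x \<le> 4"
        hence "5 * 5 \<le> x * x" by (intro mult_mono) auto
        moreover have "y * y \<le> 3 * 3" using \<open>y \<le> 3\<close> y by (intro mult_mono) auto
        ultimately show False using \<open>x * x \<le> y * y + 8\<close> by linarith
      qed
      ultimately have "x \<in> {1,2,3,4}" "y \<in> {1,2,3}" using x y by auto
      thus ?thesis using eq by auto
    qed
  qed
  show ?case
  proof (cases "x \<ge> y")
    case True
    show ?thesis by (rule main[of x y]) (use less True in auto)
  next
    case False
    show ?thesis
      by (rule main[of y x]) (use less False in \<open>auto simp: algebra_simps\<close>)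
  qed
qed

text \<open>The number M = p^k and its divisor C turn out to be P^3 Q and P^2 with P = Q R, and
  the equation becomes Q^2 + h^2 + 8 = (4 R + 2) Q h, to which Vieta jumping applies.\<close>
lemma no_level_solution:
  fixes p k :: nat and b C :: int
  assumes p: "prime p" "p \<ge> 5" and b: "b > 0" and Cb: "C > b"
    and CM: "C dvd int p ^ k"
    and nonsq: "\<And>r :: int. int p ^ k \<noteq> r\<^sup>2"
    and eq: "int p ^ k = b\<^sup>2 + 2 * C * (1 + b)"
  shows False
proof -
  have pi: "prime (int p)" using p by simp
  have C0: "C > 0" using b Cb by simp
  have powdvd: "x = 1 \<or> int p dvd x" if "x dvd int p ^ j" "x > 0" for x :: int and j
  proof -
    have "x dvd 1" if "\<not> int p dvd x"
    proof -
      have "coprime x (int p ^ j)" using that pi by (metis coprime_commute coprime_power_right_iff prime_imp_coprime)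
      thus ?thesis using \<open>x dvd int p ^ j\<close> by (metis coprime_absorb_left coprime_commute dvd_refl)
    qed
    thus ?thesis using \<open>x > 0\<close> by auto
  qed
  obtain m where m: "int p ^ k = C * m" using CM by (elim dvdE)
  have m0: "m > 0" using m C0 p by (metis zero_less_mult_pos of_nat_0_less_iff zero_less_power prime_gt_0_nat)
  have mdvd: "m dvd int p ^ k" using m by simp
  \<comment> \<open>With M = C m, the square b^2 is the product of C and m - 2 - 2 b. Both b and m
    turn out divisible by p, so the second factor is prime to p and hence to C, and both factors are
    squares.\<close>
  have b2: "b\<^sup>2 = C * (m - 2 - 2 * b)" using eq m by (simp add: algebra_simps)
  have "C \<noteq> 1" using Cb b by simp
  hence pC: "int p dvd C" using powdvd[OF CM C0] by blast
  hence "int p dvd b\<^sup>2" using b2 by simp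
  hence pb: "int p dvd b" using pi prime_dvd_power by blast
  have bpos: "m - 2 - 2 * b > 0" using b2 C0 b by (metis zero_less_mult_pos zero_less_power)
  have "m \<noteq> 1" using bpos b by simp
  hence pm: "int p dvd m" using powdvd[OF mdvd m0] by blast
  have npd: "\<not> int p dvd m - 2 - 2 * b"
  proof
    assume "int p dvd m - 2 - 2 * b"
    hence "int p dvd m - 2 * b - (m - 2 - 2 * b)" by (rule dvd_diff[OF dvd_diff[OF pm dvd_mult[OF pb]]])
    moreover have "m - 2 * b - (m - 2 - 2 * b) = 2" by simp
    ultimately have "int p dvd 2" by metis
    thus False using p by (auto dest: zdvd_imp_le)
  qed
  have cop: "coprime C (m - 2 - 2 * b)"
  proof -
    have "coprime (int p ^ k) (m - 2 - 2 * b)" using npd pi by (simp add: prime_imp_coprime)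
    thus ?thesis by (rule coprime_divisors[OF CM dvd_refl])
  qed
  define C' d where "C' = nat C" and "d = nat (m - 2 - 2 * b)"
  have C': "C = int C'" and d: "m - 2 - 2 * b = int d" using C0 bpos by (simp_all add: C'_def d_def)
  have "coprime C' d" using cop by (simp add: C' d)
  moreover have "C' * d = nat b ^ 2"
  proof -
    have "int (C' * d) = int (nat b ^ 2)" using b2 b by (simp add: C' d)
    thus ?thesis by (simp only: of_nat_eq_iff)
  qed
  hence "is_nth_power 2 (C' * d)" by simp
  moreover have "C' > 0" "d > 0" using C0 C' bpos d by auto
  ultimately obtain P0 b0 where PB: "C' = P0 ^ 2" "d = b0 ^ 2"
    using is_nth_power_mult_coprime_natD[of C' d 2] by (auto simp: is_nth_power_def)
  define P B where "P = int P0" and "B = int b0"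
  have CP: "C = P\<^sup>2" and mB: "m - 2 - 2 * b = B\<^sup>2" by (simp_all add: C' d PB P_def B_def)
  have P0: "P > 0" "B > 0" using PB \<open>C' > 0\<close> \<open>d > 0\<close> by (auto simp: P_def B_def)
  have bPB: "b = P * B" using b2 P0 b by (simp add: CP mB power_mult_distrib[symmetric])
  have meq: "m = B\<^sup>2 + 2 + 2 * P * B" using mB bPB by simp
  have PB: "P > B" using Cb P0 by (simp add: CP bPB power2_eq_square)
  have Pdvd: "P dvd int p ^ k" using CM CP by (metis dvd_trans dvd_power pos2)
  obtain i where i: "i \<le> k" "P = int p ^ i"
    using Pdvd P0 p divides_primepow_nat[of p P0 k] by (auto simp: P_def simp flip: of_nat_power)
  obtain j where j: "m = int p ^ j"
  proof -
    have "nat m dvd p ^ k" using mdvd m0 by (metis nat_dvd_iff int_dvd_int_iff of_nat_power zero_less_imp_eq_int nat_int)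
    then obtain j where "nat m = p ^ j" using divides_primepow_nat p by blast
    hence "m = int p ^ j" using m0 by (metis int_nat_eq of_nat_power order_less_imp_le)
    thus ?thesis by (rule that)
  qed
  have p1: "int p > 1" using p by simp
  have "i \<le> j"
  proof (rule ccontr)
    assume "\<not> i \<le> j"
    hence "m \<le> P" unfolding i j using p1 by (intro power_increasing) auto
    moreover have "P * 1 \<le> P * B" using P0 by (intro mult_left_mono) auto
    moreover have "m = B\<^sup>2 + 2 + 2 * (P * B)" using meq by simp
    ultimately show False using P0 zero_le_power2[of B] by linarith
  qed
  define Q where "Q = int p ^ (j - i)"
  have mPQ: "m = P * Q" using \<open>i \<le> j\<close> by (simp add: i j Q_def flip: power_add)
  \<comment> \<open>Substituting m = P Q turns m = B^2 + 2 + 2 P B into P (Q - 2 B) = B^2 + 2. As B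
    < P, this makes h at most P and Q less than p P; both are powers of p, so Q divides P.\<close>
  define h where "h = Q - 2 * B"
  have Ph: "P * h = B\<^sup>2 + 2" using meq mPQ by (simp add: h_def algebra_simps)
  have "0 < P * h" using Ph zero_le_power2[of B] by linarith
  hence h0: "h > 0" using P0 by (simp add: zero_less_mult_iff)
  have hP: "h < P + 1"
  proof (rule ccontr)
    assume "\<not> h < P + 1"
    hence "P * (P + 1) \<le> P * h" using P0 by (intro mult_left_mono) auto
    moreover have "B * B \<le> (P - 1) * (P - 1)" using PB P0 by (intro mult_mono) auto
    ultimately show False using Ph P0 PB by (simp add: power2_eq_square algebra_simps)
  qed
  have "Q < int p * P"
  proof -
    have "Q \<le> 3 * P" using hP PB by (simp add: h_def)
    also have "\<dots> < int p * P" using p P0 by (intro mult_strict_right_mono) auto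
    finally show ?thesis .
  qed
  hence "int p ^ (j - i) < int p ^ Suc i" by (simp add: Q_def i)
  hence "j - i < Suc i" using p1 by (simp only: power_strict_increasing_iff)
  hence ji: "j - i \<le> i" by simp
  define R where "R = int p ^ (i - (j - i))"
  have PQR: "P = Q * R" using ji by (simp add: i(2) Q_def R_def flip: power_add)
  have R0: "R > 0" "Q > 0" using p1 by (auto simp: R_def Q_def)
  have "(4 * R + 2) * Q * h = 4 * (P * h) + 2 * Q * h" by (simp add: PQR algebra_simps)
  also have "\<dots> = (2 * B)\<^sup>2 + 8 + 2 * Q * h" by (simp add: Ph power2_eq_square)
  also have "\<dots> = Q\<^sup>2 + h\<^sup>2 + 8" by (simp add: h_def power2_eq_square algebra_simps)
  finally have "R \<le> 2" using vieta_descent[of Q h R] R0 h0 by simp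
  \<comment> \<open>A nontrivial power of p would exceed 2. So R = 1 and P = Q, which makes p^k =
    P^4 a square.\<close>
  moreover have "R \<ge> int p" if "i - (j - i) > 0"
    using that p1 unfolding R_def by (intro self_le_power) auto
  ultimately have "i - (j - i) = 0" using p by fastforce
  hence "P = Q" using PQR by (simp add: R_def)
  hence "int p ^ k = (P\<^sup>2)\<^sup>2" using m mPQ CP by (simp add: power2_eq_square)
  thus False using nonsq by blast
qed

section \<open>Arithmetic of the individual cycle types\<close>

lemma prime_power_int_dvdE:
  fixes x :: int
  assumes "prime p" "x dvd int p ^ n" "x > 0"
  obtains j where "j \<le> n" "x = int p ^ j"
proof -
  have "nat x dvd p ^ n" using assms
    by (metis int_dvd_int_iff int_nat_eq of_nat_power order_less_imp_le)
  then obtain j where "j \<le> n" "nat x = p ^ j" using divides_primepow_nat assms(1) by blast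
  thus ?thesis using that[of j] assms(3) by (metis int_nat_eq of_nat_power order_less_imp_le)
qed

lemma prime_power_gap:
  assumes "p \<ge> 5" "int p ^ i < int p ^ j"
  shows "5 * int p ^ i \<le> int p ^ j"
proof -
  have "i < j" using assms power_less_imp_less_exp[of "int p" i j] by simp
  hence "int p ^ Suc i \<le> int p ^ j" using assms by (intro power_increasing) auto
  moreover have "5 * int p ^ i \<le> int p * int p ^ i" using assms by (intro mult_right_mono) auto
  ultimately show ?thesis by simp
qed

lemma coprime_prime_power_int:
  fixes x :: int
  assumes "prime p" "\<not> int p dvd x"
  shows "coprime x (int p ^ n)"
  using assms by (metis coprime_commute coprime_power_left_iff prime_imp_coprime prime_nat_int_transfer)

text \<open>T and E are the sum and the sum of pairwise products of the three moved values, each of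
  multiplicity M; D is the fixed value, of multiplicity N. Eliminating T and E leaves N ((q - 1) D^2
  - 2 q D) = q^2 (M - 1), with M a power of p. If M > 1, then N = q - 1 - 3 M is prime to p and
  divides M - 1, but 5 M <= q makes N too large.\<close>

lemma three_cycle_arith:
  fixes p n :: nat and q M N T E D :: int
  assumes p: "prime p" "p \<ge> 5" and q: "q = int p ^ n" "q > 5" and M: "M > 0" "N > 0"
    and m0: "3 * M + N = q - 1" and m1: "M * T + N * D = q"
    and m2: "M * (T\<^sup>2 - 2 * E) + N * D\<^sup>2 = q\<^sup>2" and m11: "M * E + N * D\<^sup>2 = 0"
  shows "M = 1 \<and> D = 0"
proof -
  have eq1: "M * (T\<^sup>2 - 3 * E) = q\<^sup>2" using m2 m11 by (simp add: algebra_simps)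
  have "(q - N * D)\<^sup>2 = (M * T)\<^sup>2" using m1 by (simp flip: m1)
  also have "\<dots> = M * (M * (T\<^sup>2 - 3 * E)) + 3 * M * (M * E)" by (simp add: power2_eq_square algebra_simps)
  also have "M * E = - (N * D\<^sup>2)" using m11 by simp
  finally have "(q - N * D)\<^sup>2 = M * q\<^sup>2 - 3 * M * N * D\<^sup>2" unfolding eq1 by simp
  hence "N * ((N + 3 * M) * D\<^sup>2 - 2 * q * D) = q\<^sup>2 * (M - 1)"
    by (simp add: power2_eq_square algebra_simps)
  moreover have "N + 3 * M = q - 1" using m0 by simp
  ultimately have key: "N * ((q - 1) * D\<^sup>2 - 2 * q * D) = q\<^sup>2 * (M - 1)" by simp
  have M1: "M = 1"
  proof (rule ccontr)
    assume "M \<noteq> 1"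
    have "M dvd int p ^ (2 * n)" using eq1 q by (metis dvd_triv_left power_mult mult.commute)
    then obtain j where j: "M = int p ^ j" using prime_power_int_dvdE p M by metis
    have "M < q" using m0 M by simp
    hence M5: "5 * M \<le> q" using prime_power_gap p q j by simp
    have pM: "int p dvd M" using j \<open>M \<noteq> 1\<close> by (cases j) auto
    have pq: "int p dvd q" using q by (cases n) auto
    have "\<not> int p dvd N"
    proof
      assume "int p dvd N"
      hence "int p dvd q - (3 * M + N)" using pM pq by simp
      hence "int p dvd 1" using m0 by simp
      thus False using p by simp
    qed
    hence "coprime N (q\<^sup>2)" using coprime_prime_power_int[OF p(1), of N "n * 2"] by (simp add: q power_mult)
    moreover have "N dvd q\<^sup>2 * (M - 1)" using key by (metis dvd_triv_left)
    ultimately have "N dvd M - 1" by (simp add: coprime_dvd_mult_right_iff)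
    hence "N \<le> M - 1" using \<open>M \<noteq> 1\<close> M by (intro zdvd_imp_le) auto
    thus False using M5 m0 q by simp
  qed
  hence "(q - 1) * D\<^sup>2 - 2 * q * D = 0" using key M by simp
  hence "D * ((q - 1) * D - 2 * q) = 0" by (simp add: power2_eq_square algebra_simps)
  moreover have "(q - 1) * D \<noteq> 2 * q"
  proof
    assume "(q - 1) * D = 2 * q"
    hence "(q - 1) * (D - 2) = 2" by (simp add: algebra_simps)
    hence "q - 1 dvd 2" by (metis dvd_triv_left)
    thus False using q by (auto dest: zdvd_imp_le)
  qed
  ultimately show ?thesis using M1 by simp
qed

text \<open>a and b are the sums of the two pairs, with multiplicities M and N per value. Since h is
  prime to p, so is one of M and N, say N. The variance identity M N (a - b)^2 = q^2 (h - 1) then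
  shows that q divides M (a - b) = q - h b, hence b, and the second moment allows only b = 0 or N =
  1.\<close>

lemma two_pairs_arith:
  fixes p n :: nat and q h M N a b :: int
  assumes p: "prime p" "p \<ge> 5" and q: "q = int p ^ n" "q > 5" and M: "M > 0" "N > 0"
    and h: "M + N = h" "2 * h = q - 1" and m1: "M * a + N * b = q"
    and m2: "M * a\<^sup>2 + N * b\<^sup>2 = q\<^sup>2"
  shows "b = 0 \<and> a = q \<and> M = 1 \<or> a = 0 \<and> b = q \<and> N = 1"
proof -
  have pq: "int p dvd q" using q by (cases n) auto
  have cop_h: "coprime h q"
  proof -
    have "\<not> int p dvd h"
    proof
      assume "int p dvd h"
      hence "int p dvd q - 2 * h" using pq by simp
      hence "int p dvd 1" using h by simp
      thus False using p by simp
    qed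
    thus ?thesis using coprime_prime_power_int p q by simp
  qed
  have *: "b = 0 \<and> a = q \<and> M = 1 \<or> a = 0 \<and> b = q \<and> N = 1"
    if MN: "M > 0" "N > 0" and h': "M + N = h" and m1: "M * a + N * b = q"
      and m2: "M * a\<^sup>2 + N * b\<^sup>2 = q\<^sup>2" and pN: "\<not> int p dvd N" for M N a b
  proof -
    have "M * N * (a - b)\<^sup>2 = (M + N) * (M * a\<^sup>2 + N * b\<^sup>2) - (M * a + N * b)\<^sup>2"
      by (simp add: power2_eq_square algebra_simps)
    also have "\<dots> = q\<^sup>2 * (h - 1)" unfolding h' m1 m2 by (simp add: algebra_simps)
    finally have eq: "M * N * (a - b)\<^sup>2 = q\<^sup>2 * (h - 1)" .
    have "(M * (a - b))\<^sup>2 * N = M * (M * N * (a - b)\<^sup>2)" by (simp add: power2_eq_square)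
    also have "\<dots> = q\<^sup>2 * (M * (h - 1))" unfolding eq by simp
    finally have "q\<^sup>2 dvd (M * (a - b))\<^sup>2 * N" by simp
    moreover have "coprime (q\<^sup>2) N" using coprime_prime_power_int[OF p(1) pN, of "n * 2"]
      by (simp add: q power_mult coprime_commute)
    ultimately have "q\<^sup>2 dvd (M * (a - b))\<^sup>2" by (simp add: coprime_dvd_mult_left_iff)
    hence "q dvd M * (a - b)" by simp
    moreover have "M * (a - b) = q - h * b" using m1 h' by (auto simp: algebra_simps)
    ultimately have "q dvd q - (q - h * b)" by (metis dvd_diff dvd_refl)
    hence "q dvd h * b" by simp
    hence "q dvd b" using cop_h by (metis coprime_commute coprime_dvd_mult_right_iff)
    then obtain t where t: "b = q * t" by (elim dvdE)
    have "0 \<le> M * a\<^sup>2" using MN by simp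
    moreover have "N * b\<^sup>2 = N * t\<^sup>2 * q\<^sup>2" by (simp add: t power_mult_distrib)
    ultimately have "N * t\<^sup>2 * q\<^sup>2 \<le> 1 * q\<^sup>2" using m2 by linarith
    hence Nt: "N * t\<^sup>2 \<le> 1" using q(2) by (subst (asm) mult_le_cancel_right) auto
    show ?thesis
    proof (cases "t = 0")
      case True
      hence b: "b = 0" by (simp add: t)
      have "q * a = q\<^sup>2" using m1 m2 b by (simp add: power2_eq_square mult.assoc[symmetric])
      hence "a = q" using q(2) by (simp add: power2_eq_square)
      moreover from this have "M * q = q" using m1 b by simp
      ultimately show ?thesis using b q(2) by simp
    next
      case False
      hence t1: "t\<^sup>2 \<ge> 1" by (simp add: int_one_le_iff_zero_less)
      have "N * 1 \<le> N * t\<^sup>2" using t1 MN by (intro mult_left_mono) auto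
      hence N1: "N = 1" using Nt MN by linarith
      hence "t\<^sup>2 = 1" using Nt t1 by simp
      hence "M * a\<^sup>2 = 0" using m2 by (simp add: N1 t power_mult_distrib)
      hence "a = 0" using MN by simp
      thus ?thesis using m1 N1 by simp
    qed
  qed
  show ?thesis
  proof (cases "int p dvd N")
    case False
    show ?thesis by (rule *) (use M h m1 m2 False in auto)
  next
    case True
    have "\<not> int p dvd M"
    proof
      assume "int p dvd M"
      hence "int p dvd q - 2 * (M + N)" using pq True by simp
      hence "int p dvd 1" using h by simp
      thus False using p by simp
    qed
    hence "a = 0 \<and> b = q \<and> N = 1 \<or> b = 0 \<and> a = q \<and> M = 1"
      by (intro *[of N M b a]) (use M h m1 m2 in auto)
    thus ?thesis by blast
  qed
qed

text \<open>The case left by \<open>two_pairs_arith\<close>: a pair A, A' of multiplicity 1 with sum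
  q, and a pair B, -B of multiplicity N. The third moment makes q divide B^2, so A A' is at least q
  (q - 3) / 2, while A + A' = q bounds it by q^2 / 4. Only q = 6 remains, which p >= 5
  forbids.\<close>

lemma two_pairs_real_arith:
  fixes p n :: nat and q N V nA \<beta> :: int and A A' B :: real
  assumes p: "prime p" "p \<ge> 5" and q: "q = int p ^ n" "q > 5"
    and N: "2 * N = q - 3" and A: "A + A' = of_int q" "A * A' = of_int nA" and B: "B\<^sup>2 = of_int \<beta>" "B \<noteq> 0"
    and eq: "nA = N * \<beta>" and V: "q ^ 3 - 3 * q * nA = q\<^sup>2 * V"
  shows False
proof -
  have pq: "int p dvd q" using q by (cases n) auto
  have np3: "\<not> int p dvd 3" using p by (auto dest: zdvd_imp_le)
  have "\<not> int p dvd N"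
  proof
    assume "int p dvd N"
    hence "int p dvd q - 2 * N" using pq by simp
    thus False using N np3 by simp
  qed
  hence copN: "coprime N q" using coprime_prime_power_int p q by simp
  have cop3: "coprime 3 q" using coprime_prime_power_int p q np3 by simp
  have "q * (q\<^sup>2 - 3 * nA) = q * (q * V)" using V by (simp add: power2_eq_square power3_eq_cube algebra_simps)
  moreover have "q \<noteq> 0" using q(2) by simp
  ultimately have "q\<^sup>2 - 3 * nA = q * V" by (metis mult_left_cancel)
  hence "3 * nA = q * (q - V)" by (simp add: power2_eq_square algebra_simps)
  hence "q dvd 3 * (N * \<beta>)" using eq by simp
  hence "q dvd \<beta>" using copN cop3 by (metis coprime_commute coprime_dvd_mult_right_iff)
  moreover have "real_of_int \<beta> > 0" using B by (metis zero_less_power2)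
  hence b0: "\<beta> > 0" by simp
  ultimately have qb: "q \<le> \<beta>" by (intro zdvd_imp_le)
  have "4 * (A * A') \<le> (A + A')\<^sup>2" using zero_le_power2[of "A - A'"] by (simp add: power2_eq_square algebra_simps)
  hence "real_of_int (4 * nA) \<le> real_of_int (q\<^sup>2)" using A by simp
  hence "4 * nA \<le> q\<^sup>2" by (simp only: of_int_le_iff)
  moreover have "N * q \<le> nA" unfolding eq using qb N q by (intro mult_left_mono) auto
  ultimately have "4 * (N * q) \<le> q * q" by (simp add: power2_eq_square)
  moreover have "2 * (q - 3) * q = 4 * (N * q)" unfolding N[symmetric] by simp
  ultimately have "2 * (q - 3) * q \<le> q * q" by linarith
  hence "2 * (q - 3) \<le> q" using q(2) by (subst (asm) mult_le_cancel_right) auto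
  hence "q = 6" using q by simp
  hence "int p dvd 6" using pq by simp
  hence "p dvd 2 * 3" by (metis int_dvd_int_iff of_nat_numeral numeral_times_numeral semiring_norm(12,13,14) of_nat_mult)
  hence "p dvd 2 \<or> p dvd 3" using p prime_dvd_mult_iff by blast
  thus False using p by (auto dest: dvd_imp_le)
qed

text \<open>In units of q / M, a is the sum of the swapped values, and B and C are the fixed ones.
  \<open>Nt\<close> and \<open>m\<close> stand for Np kappa + Np (- kappa) and Nm kappa - 1. As M
  divides B C, \<open>count\<close> reduces to h times an integer being at most 4 M in absolute
  value, while h is larger than that.\<close>

lemma swap_nonzero_arith:
  fixes p n k :: nat and q M N L a B C :: int
  assumes p: "prime p" "p \<ge> 5" and q: "q = int p ^ n" and Mk: "M = int p ^ k" and M: "M > 1" "5 * M \<le> q"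
    and m0: "2 * M + N + L = q - 1" and m1: "M * a + N * B + L * C = M"
    and m2: "M * a\<^sup>2 + 2 * (N * B\<^sup>2 + L * C\<^sup>2) = M\<^sup>2"
    and NL: "N \<ge> 2" "L \<ge> 2" and BC: "B \<noteq> 0" "C \<noteq> 0"
    and Nt: "Nt \<ge> 0" and m: "m = 0 \<or> m = -1"
    and count: "M\<^sup>2 * (Nt + 2 * m) + 4 * B * C * q = M * ((a - 2 * B) * (a - 2 * C)) * (Nt - 2 * m)"
  shows False
proof -
  define e f G where "e = B + C" and "f = B * C" and "G = (a - 2 * B) * (a - 2 * C)"
  have MG: "M * G = M\<^sup>2 - 2 * e * M + 2 * (q - 1) * f"
  proof -
    have "2 * (N * B\<^sup>2 + L * C\<^sup>2) - 2 * e * (N * B + L * C) + 2 * f * (N + L) = 0"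
      by (simp add: e_def f_def power2_eq_square algebra_simps)
    moreover have "2 * (N * B\<^sup>2 + L * C\<^sup>2) = M\<^sup>2 - M * a\<^sup>2" using m2 by simp
    moreover have "N * B + L * C = M - M * a" using m1 by simp
    moreover have "N + L = q - 1 - 2 * M" using m0 by simp
    ultimately have "M\<^sup>2 - M * a\<^sup>2 - 2 * e * (M - M * a) + 2 * f * (q - 1 - 2 * M) = 0" by metis
    thus ?thesis by (simp add: G_def e_def f_def power2_eq_square algebra_simps)
  qed
  have pM: "int p dvd M" using Mk M by (cases k) auto
  have pq: "int p dvd q" using q M by (cases n) auto
  have "M dvd f"
  proof -
    have "2 * (q - 1) * f = M * (G - M + 2 * e)" using MG by (simp add: power2_eq_square algebra_simps)
    hence "M dvd (2 * (q - 1)) * f" by simp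
    moreover have "coprime M (2 * (q - 1))"
    proof -
      have "\<not> int p dvd 2 * (q - 1)"
      proof
        assume "int p dvd 2 * (q - 1)"
        hence "int p dvd 2 * q - 2 * (q - 1)" using pq by (metis dvd_diff dvd_mult)
        hence "int p dvd 2" by simp
        thus False using p by (auto dest: zdvd_imp_le)
      qed
      thus ?thesis by (metis Mk coprime_commute coprime_prime_power_int p(1))
    qed
    ultimately show ?thesis by (simp add: coprime_dvd_mult_right_iff)
  qed
  then obtain f2 where f2: "f = M * f2" by (elim dvdE)
  have "M * G = M * (M - 2 * e + 2 * (q - 1) * f2)" using MG f2 by (simp add: power2_eq_square algebra_simps)
  hence G: "G = M - 2 * e + 2 * (q - 1) * f2" using M by simp
  have "M\<^sup>2 * (Nt + 2 * m) + 4 * f * q = M * G * (Nt - 2 * m)"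
    using count by (simp add: f_def G_def mult.assoc)
  hence "M * (M * (Nt + 2 * m) + 4 * f2 * q) = M * (G * (Nt - 2 * m))"
    unfolding f2 by (simp add: power2_eq_square algebra_simps)
  hence key: "M * (Nt + 2 * m) + 4 * f2 * q = G * (Nt - 2 * m)" using M by simp
  \<comment> \<open>Chosen so that G = M - 2 h. Since f2 is not 0 and q >= 5 M, the term (q - 1) f2
    dominates.\<close>
  define h where "h = e - (q - 1) * f2"
  have key': "2 * f2 * q = - h * (Nt - 2 * m) - 2 * M * m"
    using key unfolding G h_def by (simp add: algebra_simps)
  \<comment> \<open>The multiplicities N, L >= 2 enter here; the resulting bound keeps |e| at most 3
    M / 4 and |f2| at most M / 8.\<close>
  have BCle: "4 * B\<^sup>2 + 4 * C\<^sup>2 \<le> M\<^sup>2"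
  proof -
    have "2 * B\<^sup>2 \<le> N * B\<^sup>2" "2 * C\<^sup>2 \<le> L * C\<^sup>2" using NL by (simp_all add: mult_right_mono)
    moreover have "0 \<le> M * a\<^sup>2" using M by simp
    moreover have "2 * (N * B\<^sup>2) + 2 * (L * C\<^sup>2) + M * a\<^sup>2 = M\<^sup>2" using m2 by (simp add: algebra_simps)
    ultimately show ?thesis by linarith
  qed
  have e_le: "4 * \<bar>e\<bar> \<le> 3 * M"
  proof (rule power2_le_imp_le)
    have "e\<^sup>2 + (B - C)\<^sup>2 = 2 * B\<^sup>2 + 2 * C\<^sup>2" by (simp add: e_def power2_eq_square algebra_simps)
    hence "e\<^sup>2 \<le> 2 * B\<^sup>2 + 2 * C\<^sup>2" using zero_le_power2[of "B - C"] by linarith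
    hence "16 * e\<^sup>2 \<le> 9 * M\<^sup>2" using BCle zero_le_power2[of M] by linarith
    thus "(4 * \<bar>e\<bar>)\<^sup>2 \<le> (3 * M)\<^sup>2" by (simp add: power_mult_distrib)
  qed (use M in auto)
  have f2_le: "8 * \<bar>f2\<bar> \<le> M"
  proof -
    have "2 * f \<le> B\<^sup>2 + C\<^sup>2" using zero_le_power2[of "B - C"] by (simp add: f_def power2_eq_square algebra_simps)
    moreover have "- 2 * f \<le> B\<^sup>2 + C\<^sup>2" using zero_le_power2[of "B + C"] by (simp add: f_def power2_eq_square algebra_simps)
    ultimately have "8 * \<bar>f\<bar> \<le> M\<^sup>2" using BCle by linarith
    hence "M * (8 * \<bar>f2\<bar>) \<le> M * M" using M by (simp add: f2 abs_mult power2_eq_square)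
    thus ?thesis using M by (subst (asm) mult_le_cancel_left) auto
  qed
  have f20: "f2 \<noteq> 0" using BC f2 by (auto simp: f_def)
  have h_ge: "4 * \<bar>h\<bar> \<ge> 17 * M - 4"
  proof -
    have "5 * M - 1 \<le> (q - 1) * 1" using M by simp
    also have "\<dots> \<le> (q - 1) * \<bar>f2\<bar>" using f20 M by (intro mult_left_mono) auto
    also have "\<dots> = \<bar>(q - 1) * f2\<bar>" using M by (simp add: abs_mult)
    finally have *: "5 * M - 1 \<le> \<bar>(q - 1) * f2\<bar>" .
    define y where "y = (q - 1) * f2"
    have "5 * M - 1 \<le> \<bar>y\<bar>" "h = e - y" using * by (simp_all add: y_def h_def)
    thus ?thesis using e_le by linarith
  qed
  have M5: "M \<ge> 5" using pM M p by (auto dest!: zdvd_imp_le)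
  have e_bd: "4 * e \<le> 3 * M" "- (4 * e) \<le> 3 * M" using e_le by linarith+
  have f2_bd: "8 * f2 \<le> M" "- (8 * f2) \<le> M" using f2_le by linarith+
  have small: "x = 0" if "h * x = y" "y \<le> 4 * M" "- (4 * M) \<le> y" for x y
  proof (rule ccontr)
    assume "x \<noteq> 0"
    hence "\<bar>h\<bar> * 1 \<le> \<bar>h\<bar> * \<bar>x\<bar>" by (intro mult_left_mono) auto
    also have "\<dots> = \<bar>y\<bar>" using that by (simp flip: abs_mult)
    finally have "\<bar>h\<bar> \<le> \<bar>y\<bar>" by simp
    thus False using that h_ge M5 by linarith
  qed
  from m show False
  proof
    \<comment> \<open>The integer factor is 0, which leaves M = e + f2, against the bounds 3 M / 4
      and M / 8.\<close>
    assume m: "m = -1"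
    have "h * Nt = 2 * M - 2 * e - 2 * f2" using key' unfolding m h_def by (simp add: algebra_simps)
    moreover have "2 * M - 2 * e - 2 * f2 \<le> 4 * M" "- (4 * M) \<le> 2 * M - 2 * e - 2 * f2"
      using e_bd f2_bd M5 by linarith+
    ultimately have "Nt = 0" "h * Nt = 2 * M - 2 * e - 2 * f2" using small by blast+
    hence "M - e - f2 = 0" by simp
    thus False using e_bd f2_bd M5 by linarith
  next
    assume m: "m = 0"
    have eq: "h * (Nt - 2) = - 2 * e - 2 * f2" using key' unfolding m h_def by (simp add: algebra_simps)
    moreover have "- 2 * e - 2 * f2 \<le> 4 * M" "- (4 * M) \<le> - 2 * e - 2 * f2"
      using e_bd f2_bd M5 by linarith+
    ultimately have "Nt - 2 = 0" using small by blast
    hence ef: "f2 = - e" using eq by simp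
    \<comment> \<open>B + M divides M^2, so it is a power of p, and it lies between M / 2 and 3 M /
      2. The gap between powers of p leaves only B + M = M.\<close>
    have prod: "(B + M) * (C + M) = M\<^sup>2" using f2 unfolding ef f_def e_def by (simp add: power2_eq_square algebra_simps)
    have B_le: "2 * \<bar>B\<bar> \<le> M"
    proof (rule power2_le_imp_le)
      have "4 * B\<^sup>2 \<le> M\<^sup>2" using BCle zero_le_power2[of C] by linarith
      thus "(2 * \<bar>B\<bar>)\<^sup>2 \<le> M\<^sup>2" by (simp add: power_mult_distrib)
    qed (use M in auto)
    hence BM: "M \<le> 2 * B + 2 * M" "2 * B + 2 * M \<le> 3 * M" by linarith+
    hence "B + M > 0" using M by linarith
    have "B + M dvd int p ^ (k * 2)" using prod Mk by (metis dvd_triv_left power_mult)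
    then obtain j where j: "B + M = int p ^ j" using prime_power_int_dvdE[OF p(1)] \<open>B + M > 0\<close> by metis
    have "\<not> int p ^ j < int p ^ k"
    proof
      assume "int p ^ j < int p ^ k"
      from prime_power_gap[OF p(2) this] show False using BM M j unfolding Mk[symmetric] by linarith
    qed
    moreover have "\<not> int p ^ k < int p ^ j"
    proof
      assume "int p ^ k < int p ^ j"
      from prime_power_gap[OF p(2) this] show False using BM M j unfolding Mk[symmetric] by linarith
    qed
    ultimately have "B = 0" using j Mk by linarith
    thus False using BC by simp
  qed
qed

text \<open>With the other fixed value equal to 0, the moments collapse to M = a^2 + 2 C (1 - a). If
  m = U = 0, the vanishing third correlation gives a = 2 C and then M = a, against a^2 <= M. If m =
  -1, \<open>count\<close> makes C a positive divisor of M, which excludes a >= 0; then V > 0 yields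
  C > -a, as \<open>no_level_solution\<close> demands.\<close>

lemma swap_zero_arith:
  fixes p n k :: nat and q M L a C :: int
  assumes p: "prime p" "p \<ge> 5" and Mk: "M = int p ^ k" and M: "M > 1" and q: "q > 0"
    and nonsq: "\<And>r :: int. M \<noteq> r\<^sup>2"
    and m1: "M * a + L * C = M"
    and m2: "M * a\<^sup>2 + 2 * (L * C\<^sup>2) = M\<^sup>2"
    and L: "L > 0" and C: "C \<noteq> 0"
    and Nt: "Nt \<ge> 0" "even Nt" and m: "m = 0 \<and> U = 0 \<or> m = -1"
    and count: "M\<^sup>2 * (Nt + 2 * m) = M * (a * (a - 2 * C)) * (Nt - 2 * m)"
    and U: "2 * M ^ 3 * U = q * (- a * (L * C\<^sup>2) + 2 * L * C ^ 3)"
    and V: "2 * M * a ^ 3 + 3 * a * (L * C\<^sup>2) + 2 * L * C ^ 3 > 0"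
  shows False
proof -
  have LC: "L * C = M * (1 - a)" using m1 by (simp add: algebra_simps)
  have "M * (a\<^sup>2 + 2 * C * (1 - a)) = M * a\<^sup>2 + 2 * C * (L * C)" unfolding LC by (simp add: algebra_simps)
  also have "\<dots> = M * M" using m2 by (simp add: power2_eq_square algebra_simps)
  finally have "M * (a\<^sup>2 + 2 * C * (1 - a)) = M * M" .
  hence Meq: "M = a\<^sup>2 + 2 * C * (1 - a)" using M by simp
  have a2: "a\<^sup>2 \<le> M"
  proof -
    have "0 \<le> L * C\<^sup>2" using L by simp
    hence "M * a\<^sup>2 \<le> M * M" using m2 by (simp add: power2_eq_square)
    thus ?thesis using M by (subst (asm) mult_le_cancel_left) auto
  qed
  have oddM: "odd M" using Mk p by (simp add: prime_odd_nat)
  show False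
  proof (cases "m = 0 \<and> U = 0")
    case True
    hence "q * (- a * (L * C\<^sup>2) + 2 * L * C ^ 3) = 0" using U by simp
    moreover have "q * (- a * (L * C\<^sup>2) + 2 * L * C ^ 3) = q * (L * C\<^sup>2 * (2 * C - a))"
      by (simp add: power2_eq_square power3_eq_cube algebra_simps)
    ultimately have "q * (L * C\<^sup>2 * (2 * C - a)) = 0" by metis
    moreover have "L * C\<^sup>2 \<noteq> 0" "q \<noteq> 0" using L C q by auto
    ultimately have "2 * C - a = 0" by (metis mult_eq_0_iff)
    hence "a = 2 * C" by simp
    hence "M = a" using Meq by (simp add: power2_eq_square algebra_simps)
    hence "M * M \<le> M * 1" using a2 by (simp add: power2_eq_square)
    thus False using M by (subst (asm) mult_le_cancel_left) auto
  next
    case False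
    hence m: "m = -1" using m by blast
    have "a * (a - 2 * C) = M - 2 * C" using Meq by (simp add: power2_eq_square algebra_simps)
    hence "M * (M * (Nt - 2)) = M * ((M - 2 * C) * (Nt + 2))"
      using count unfolding m by (simp add: power2_eq_square mult.assoc)
    hence "M * (Nt - 2) = (M - 2 * C) * (Nt + 2)" using M by simp
    \<comment> \<open>Evenness of \<open>Nt\<close> turns the relation into C (w + 1) = M without a
      factor 2.\<close>
    moreover obtain w where w: "Nt = 2 * w" using Nt by (elim evenE)
    ultimately have Cw: "C * (w + 1) = M" by (simp add: algebra_simps)
    have C0: "C > 0" using Cw M Nt w by (smt (verit) zero_less_mult_iff)
    have CM: "C dvd int p ^ k" using Cw Mk by (metis dvd_triv_left)
    have "a < 0"
    proof (rule ccontr)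
      assume "\<not> a < 0"
      then consider "a = 0" | "a = 1" | "a \<ge> 2" by linarith
      thus False
      proof cases
        case 1 thus False using Meq oddM by simp
      next
        case 2 thus False using Meq M by simp
      next
        case 3
        hence "C * (1 - a) < 0" using C0 by (simp add: mult_less_0_iff)
        thus False using Meq a2 by simp
      qed
    qed
    define b where "b = - a"
    have b: "b > 0" "a = - b" using \<open>a < 0\<close> by (simp_all add: b_def)
    have Mb: "M = b\<^sup>2 + 2 * C * (1 + b)" using Meq by (simp add: b)
    have "C > b"
    proof (rule ccontr)
      assume "\<not> C > b"
      have "2 * M * a ^ 3 + 3 * a * (L * C\<^sup>2) + 2 * L * C ^ 3
          = M * (- 2 * b ^ 3 - 3 * b * (1 + b) * C + 2 * (1 + b) * C * C)"
      proof -
        have "L * C\<^sup>2 = M * (1 + b) * C" using LC by (simp add: b power2_eq_square)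
        moreover have "L * C ^ 3 = M * (1 + b) * C * C" using LC by (simp add: b power3_eq_cube)
        ultimately have *: "L * C\<^sup>2 = M * (1 + b) * C" "L * C ^ 3 = M * (1 + b) * C * C" by simp_all
        have "2 * M * a ^ 3 + 3 * a * (L * C\<^sup>2) + 2 * (L * C ^ 3)
          = M * (- 2 * b ^ 3 - 3 * b * (1 + b) * C + 2 * (1 + b) * C * C)"
          unfolding * b(2) by (simp add: power3_eq_cube algebra_simps)
        thus ?thesis by (simp add: mult.assoc)
      qed
      hence "0 < M * (- 2 * b ^ 3 - 3 * b * (1 + b) * C + 2 * (1 + b) * C * C)" using V by simp
      hence "0 < - 2 * b ^ 3 - 3 * b * (1 + b) * C + 2 * (1 + b) * C * C" using M by (simp add: zero_less_mult_iff)
      moreover have "((1 + b) * C) * C \<le> ((1 + b) * C) * b" using \<open>\<not> C > b\<close> C0 b by (intro mult_left_mono) auto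
      moreover have "0 < ((1 + b) * C) * b" using C0 b by simp
      moreover have "0 < b ^ 3" using b by simp
      ultimately show False by (simp add: algebra_simps)
    qed
    show False by (rule no_level_solution[OF p b(1) \<open>C > b\<close> CM]) (use nonsq Mk Mb in auto)
  qed
qed

section \<open>Moments and correlations of Weil sums\<close>

locale weil_sums =
  fixes s :: nat and K :: "'a::{field,finite} itself"
  assumes s_pos: "s > 0" and cop: "coprime s (CARD('a) - 1)"
begin

section \<open>The power map as a permutation\<close>

abbreviation "W \<equiv> (walsh_value s :: 'a \<Rightarrow> complex)"

lemma p_prime: "prime CHAR('a)"
  by (rule prime_CHAR_finite)

lemma root_ex: "\<exists>e>0. \<forall>x::'a. (x ^ s) ^ e = x \<and> (x ^ e) ^ s = x"
proof -
  have q1: "CARD('a) > 1" by (rule card_gt_1)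
  obtain e b where eb: "s * e = (CARD('a) - 1) * b + 1"
  \<comment> \<open>For q = 2 the modulus q - 1 is 1, which \<open>coprime_bezout_strong\<close>
    excludes.\<close>
  proof (cases "CARD('a) - 1 = 1")
    case True
    thus ?thesis using that[of 1 "s - 1"] s_pos by simp
  next
    case False
    thus ?thesis using that coprime_bezout_strong[OF cop] by blast
  qed
  have "x ^ (s * e) = x" for x :: 'a
  proof (cases "x = 0")
    case True
    thus ?thesis using eb by (metis add_is_0 one_neq_zero power_0_left)
  next
    case False
    thus ?thesis using power_card_minus_1[OF False] by (simp add: eb power_add power_mult)
  qed
  moreover have "e > 0" using eb by (cases e) auto
  ultimately show ?thesis by (intro exI[of _ e]) (auto simp flip: power_mult simp: mult.commute[of e])
qed

lemma power_s_eq_iff: "x ^ s = y ^ s \<longleftrightarrow> x = (y :: 'a)"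
  using root_ex by metis

lemma bij_power_s: "bij (\<lambda>x::'a. x ^ s)"
  unfolding bij_def by (metis injI power_s_eq_iff root_ex surjI)

lemma sum_power_s: "(\<Sum>x\<in>UNIV. f (x ^ s)) = (\<Sum>x\<in>(UNIV::'a set). f x)"
  using sum.reindex_bij_betw[OF bij_power_s, of f] .

lemma odd_s: "CHAR('a) \<noteq> 2 \<Longrightarrow> odd s"
proof
  assume "CHAR('a) \<noteq> 2" "even s"
  hence "odd CHAR('a)" using p_prime prime_odd_nat prime_ge_2_nat[OF p_prime] by force
  hence "odd CARD('a)" by (simp add: CARD_eq)
  hence "even (CARD('a) - 1)" by simp
  thus False using cop \<open>even s\<close> by (metis coprime_common_divisor_nat odd_one dvd_refl even_numeral numeral_eq_one_iff semiring_norm(83))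
qed

lemma neg_power_s: "(- x) ^ s = - (x ^ s :: 'a)"
proof (cases "CHAR('a) = 2")
  case True
  have "- x = x" for x :: 'a
  proof -
    have "(of_nat 2 :: 'a) = 0" using True of_nat_CHAR[where ?'a='a] by simp
    hence "x + x = 0" by (metis mult_2 mult_zero_left of_nat_numeral)
    thus ?thesis by (simp add: eq_neg_iff_add_eq_0 neg_eq_iff_add_eq_0)
  qed
  thus ?thesis by metis
qed (use odd_s in simp)

text \<open>For nonzero c the coefficient can be scaled away, so T c is a dilate of W; kept as a
  parameter, it turns products of two values of W into counts of solutions with right-hand side
  c.\<close>

definition T :: "'a \<Rightarrow> 'a \<Rightarrow> complex" where
  "T c u = (\<Sum>x\<in>UNIV. add_char (c * x ^ s - u * x))"

lemma W_eq_T: "W u = T 1 u"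
  by (simp add: walsh_value_def T_def)

lemma T_scale: "r \<noteq> 0 \<Longrightarrow> T (c * r ^ s) (u * r) = T c u"
  unfolding T_def
  by (rule sum.reindex_bij_witness[of _ "\<lambda>x. x / r" "\<lambda>x. r * x"]) (auto simp: power_mult_distrib power_divide mult.assoc)

section \<open>First and second correlations\<close>

lemma sum_char: "(\<Sum>x\<in>UNIV. add_char (u * x)) = (if u = (0::'a) then of_nat CARD('a) else 0)"
  by (rule sum_add_char)

lemma sum_char': "(\<Sum>x\<in>UNIV. add_char (x * u)) = (if u = (0::'a) then of_nat CARD('a) else 0)"
  using sum_char[of u] by (simp add: mult.commute)

lemma T_0_right: "c \<noteq> 0 \<Longrightarrow> T c 0 = 0"
  using sum_power_s[of "\<lambda>x. add_char (c * x)"] by (simp add: T_def sum_char)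

lemma W_0: "W 0 = 0"
  by (simp add: W_eq_T T_0_right)

lemma cnj_W: "cnj (W u) = W u"
proof -
  have "cnj (W u) = (\<Sum>x\<in>UNIV. add_char (- (x ^ s - u * x)))" by (simp add: walsh_value_def cnj_add_char)
  also have "\<dots> = (\<Sum>x\<in>UNIV. add_char (x ^ s - u * x))"
    by (rule sum.reindex_bij_witness[of _ uminus uminus]) (auto simp: neg_power_s)
  finally show ?thesis by (simp add: walsh_value_def)
qed

lemma sum_T: "(\<Sum>u\<in>UNIV. T c u) = of_nat CARD('a)"
proof -
  have "(\<Sum>u\<in>UNIV. T c u) = (\<Sum>x\<in>UNIV. \<Sum>u\<in>UNIV. add_char (c * x ^ s) * add_char (u * (- x)))"
    unfolding T_def by (subst sum.swap) (simp flip: add_char_add)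
  also have "\<dots> = (\<Sum>x\<in>(UNIV::'a set). if x = 0 then of_nat CARD('a) else 0)"
    unfolding sum_distrib_left[symmetric] sum_char' by (intro sum.cong) (use s_pos in \<open>auto simp: power_0_left\<close>)
  finally show ?thesis by simp
qed

lemma sum_W: "(\<Sum>u\<in>UNIV. W u) = of_nat CARD('a)"
  by (simp add: W_eq_T sum_T)

text \<open>Summing over u forces x = -e y. Dilates (b = 0), translates (e = 1) and reflections (e =
  -1) are special cases, so all quadratic relations below come from this identity.\<close>

lemma sum_T_T:
  "(\<Sum>u\<in>UNIV. T c u * T d (e * u + b)) = of_nat CARD('a) * (\<Sum>y\<in>UNIV. add_char ((d - c * e ^ s) * y ^ s - b * y))"
proof -
  have "(\<Sum>u\<in>UNIV. T c u * T d (e * u + b))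
    = (\<Sum>u\<in>UNIV. \<Sum>y\<in>UNIV. \<Sum>x\<in>UNIV. add_char (c * x ^ s + d * y ^ s - b * y) * add_char (u * (- (x + e * y))))"
    unfolding T_def sum_product by (subst (2) sum.swap) (simp add: algebra_simps flip: add_char_add)
  also have "\<dots> = (\<Sum>y\<in>UNIV. \<Sum>x\<in>UNIV. \<Sum>u\<in>UNIV. add_char (c * x ^ s + d * y ^ s - b * y) * add_char (u * (- (x + e * y))))"
    by (subst sum.swap, subst (2) sum.swap) simp
  also have "\<dots> = (\<Sum>y\<in>UNIV. \<Sum>x\<in>UNIV. if x = - (e * y) then of_nat CARD('a) * add_char (c * x ^ s + d * y ^ s - b * y) else 0)"
    unfolding sum_distrib_left[symmetric] sum_char'
    by (intro sum.cong refl) (simp add: eq_neg_iff_add_eq_0 del: minus_add_distrib)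
  also have "\<dots> = (\<Sum>y\<in>UNIV. of_nat CARD('a) * add_char (c * (- (e * y)) ^ s + d * y ^ s - b * y))" by simp
  also have "\<dots> = of_nat CARD('a) * (\<Sum>y\<in>UNIV. add_char ((d - c * e ^ s) * y ^ s - b * y))"
    by (simp add: neg_power_s power_mult_distrib algebra_simps sum_distrib_left)
  finally show ?thesis .
qed

lemma sum_T_T_dilate:
  "(\<Sum>u\<in>UNIV. T c u * T d (e * u)) = (if d = c * e ^ s then of_nat CARD('a) ^ 2 else 0)"
  using sum_T_T[of c d e 0] sum_power_s[of "\<lambda>x. add_char ((d - c * e ^ s) * x)"]
  by (simp add: sum_char power2_eq_square)

lemma sum_W_W: "(\<Sum>u\<in>UNIV. W u * W (e * u)) = (if e = 1 then of_nat CARD('a) ^ 2 else 0)"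
  using sum_T_T_dilate[of 1 1 e] power_s_eq_iff[of e 1] by (auto simp: W_eq_T)

lemma sum_W_translate: "b \<noteq> 0 \<Longrightarrow> (\<Sum>u\<in>UNIV. W u * W (u + b)) = 0"
  using sum_T_T[of 1 1 1 b] sum_char[of "-b"] by (simp add: W_eq_T)

lemma two_neq_0: "CHAR('a) \<noteq> 2 \<Longrightarrow> (2 :: 'a) \<noteq> 0"
  using of_nat_eq_0_iff_char_dvd[of 2, where ?'a='a] p_prime
  by (metis of_nat_numeral primes_dvd_imp_eq two_is_prime_nat)

text \<open>For e = -1 the coefficient of y^s is 1 - (-1)^s = 2 rather than 0, so the correlation
  survives; dilation by an s-th root of 1/2 absorbs the factor and returns W itself.\<close>

lemma sum_W_reflect:
  assumes "r ^ s = 1 / 2" "CHAR('a) \<noteq> 2"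
  shows "(\<Sum>u\<in>UNIV. W u * W (b - u)) = of_nat CARD('a) * W (b * r)"
proof -
  have r2: "2 * r ^ s = 1" unfolding assms(1) using two_neq_0[OF assms(2)] by simp
  hence r0: "r \<noteq> 0" using s_pos by (auto simp: power_0_left)
  have "(\<Sum>u\<in>UNIV. W u * W (b - u)) = of_nat CARD('a) * T 2 b"
    using sum_T_T[of 1 1 "-1" b] by (simp add: W_eq_T neg_power_s T_def)
  also have "T 2 b = W (b * r)" using T_scale[OF r0, of 2 b] r2 by (simp add: W_eq_T)
  finally show ?thesis .
qed

lemma sum_T_T_T:
  "(\<Sum>u\<in>UNIV. T a (e * u) * T b (f * u) * T c u)
    = of_nat CARD('a) * (\<Sum>x\<in>UNIV. \<Sum>y\<in>UNIV. add_char (a * x ^ s + b * y ^ s - c * (e * x + f * y) ^ s))"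
proof -
  have "(\<Sum>u\<in>UNIV. T a (e * u) * T b (f * u) * T c u)
    = (\<Sum>u\<in>UNIV. (\<Sum>x\<in>UNIV. \<Sum>y\<in>UNIV. add_char (a * x ^ s - e * u * x) * add_char (b * y ^ s - f * u * y)) * T c u)"
    by (simp only: T_def[of a] T_def[of b] sum_product)
  also have "\<dots> = (\<Sum>u\<in>UNIV. \<Sum>x\<in>UNIV. \<Sum>y\<in>UNIV.
      add_char (a * x ^ s + b * y ^ s) * (add_char (u * (- (e * x + f * y))) * T c u))"
    unfolding sum_distrib_right
    by (intro sum.cong refl, simp only: mult.assoc[symmetric] add_char_add[symmetric]) (simp add: algebra_simps)
  also have "\<dots> = (\<Sum>x\<in>UNIV. \<Sum>y\<in>UNIV. \<Sum>u\<in>UNIV.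
      add_char (a * x ^ s + b * y ^ s) * (add_char (u * (- (e * x + f * y))) * T c u))"
    by (subst sum.swap, rule sum.cong[OF refl], subst sum.swap) simp
  also have "\<dots> = (\<Sum>x\<in>UNIV. \<Sum>y\<in>UNIV.
      add_char (a * x ^ s + b * y ^ s) * (of_nat CARD('a) * add_char (c * (- (e * x + f * y)) ^ s)))"
  proof -
    have "(\<Sum>u\<in>UNIV. add_char (u * w) * T c u) = of_nat CARD('a) * add_char (c * w ^ s)" for w
    proof -
      have "(\<Sum>u\<in>UNIV. add_char (u * w) * T c u) = (\<Sum>u\<in>UNIV. \<Sum>z\<in>UNIV. add_char (c * z ^ s) * add_char (u * (w - z)))"
        by (simp add: T_def sum_distrib_left algebra_simps flip: add_char_add)
      also have "\<dots> = (\<Sum>z\<in>UNIV. \<Sum>u\<in>UNIV. add_char (c * z ^ s) * add_char (u * (w - z)))" by (rule sum.swap)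
      also have "\<dots> = (\<Sum>z\<in>UNIV. if z = w then of_nat CARD('a) * add_char (c * z ^ s) else 0)"
        unfolding sum_distrib_left[symmetric] sum_char' by (intro sum.cong) auto
      finally show ?thesis by simp
    qed
    thus ?thesis by (simp flip: sum_distrib_left)
  qed
  also have "\<dots> = of_nat CARD('a) * (\<Sum>x\<in>UNIV. \<Sum>y\<in>UNIV. add_char (a * x ^ s + b * y ^ s - c * (e * x + f * y) ^ s))"
  proof -
    have "add_char A * (z * add_char (c * (- B) ^ s)) = z * add_char (A - c * B ^ s)" for A B z
    proof -
      have "add_char A * (z * add_char (c * (- B) ^ s)) = z * (add_char A * add_char (c * (- B) ^ s))" by simp
      thus ?thesis by (simp add: neg_power_s flip: add_char_add)
    qed
    thus ?thesis by (simp only: sum_distrib_left)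
  qed
  finally show ?thesis .
qed

text \<open>These are affine slices of the homogeneous equations x^s + y^s = c (x + y)^s and x^s -
  y^s = c (x + y)^s that third correlations of W produce.\<close>

definition Np :: "'a \<Rightarrow> nat" where "Np c = card {x. x ^ s + (1 - x) ^ s = c}"
definition Nm :: "'a \<Rightarrow> nat" where "Nm c = card {x. x ^ s - (1 - x) ^ s = c}"

lemma sum_char_power_s: "(\<Sum>w\<in>UNIV. add_char (w ^ s * A)) = (if A = (0::'a) then of_nat CARD('a) else 0)"
  using sum_power_s[of "\<lambda>w. add_char (w * A)"] by (simp add: sum_char')

text \<open>Homogeneity: substituting x = wt turns the sum over w into the indicator of A t = 0.\<close>
lemma sum_homogeneous:
  fixes A :: "'a \<Rightarrow> 'a" and F :: "'a \<Rightarrow> 'a \<Rightarrow> 'a"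
  assumes "\<And>w t. w \<noteq> 0 \<Longrightarrow> F w (w * t) = w ^ s * A t"
  shows "(\<Sum>w\<in>UNIV. \<Sum>x\<in>UNIV. add_char (F w x))
    = of_nat CARD('a) * of_nat (card {t. A t = 0}) - of_nat CARD('a) + (\<Sum>x\<in>UNIV. add_char (F 0 x))"
proof -
  have "(\<Sum>x\<in>UNIV. add_char (F w x)) = (\<Sum>t\<in>UNIV. add_char (w ^ s * A t))" if "w \<noteq> 0" for w
  proof -
    have "F w x = w ^ s * A (x / w)" for x using assms[OF that, of "x / w"] that by simp
    thus ?thesis
      by (intro sum.reindex_bij_witness[of _ "\<lambda>t. w * t" "\<lambda>x. x / w"]) (use that in auto)
  qed
  hence "(\<Sum>w\<in>UNIV-{0}. \<Sum>x\<in>UNIV. add_char (F w x)) = (\<Sum>w\<in>UNIV-{0}. \<Sum>t\<in>UNIV. add_char (w ^ s * A t))"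
    by simp
  also have "\<dots> = (\<Sum>w\<in>UNIV. \<Sum>t\<in>UNIV. add_char (w ^ s * A t)) - of_nat CARD('a)"
    by (subst (2) sum.remove[of _ 0]) (use s_pos in \<open>auto simp: power_0_left\<close>)
  also have "(\<Sum>w\<in>UNIV. \<Sum>t\<in>UNIV. add_char (w ^ s * A t)) = (\<Sum>t\<in>UNIV. if A t = 0 then of_nat CARD('a) else 0)"
    by (subst sum.swap) (simp add: sum_char_power_s)
  also have "\<dots> = of_nat CARD('a) * of_nat (card {t. A t = 0})"
    by (simp add: sum.If_cases)
  finally show ?thesis by (subst sum.remove[of _ 0]) auto
qed

lemma sum_shift: "(\<Sum>w\<in>UNIV. h (w - x)) = (\<Sum>y\<in>UNIV. h (y :: 'a))"
  by (rule sum.reindex_bij_witness[of _ "\<lambda>y. y + x" "\<lambda>w. w - x"]) auto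

lemma sum_reflect: "(\<Sum>w\<in>UNIV. h (x - w)) = (\<Sum>y\<in>UNIV. h (y :: 'a))"
  by (rule sum.reindex_bij_witness[of _ "\<lambda>y. x - y" "\<lambda>w. x - w"]) auto

text \<open>Substituting w = x + y makes the phase homogeneous in w and x. The slice w = 0
  contributes q, which cancels the -q of \<open>sum_homogeneous\<close>.\<close>

lemma sum_WWT: "(\<Sum>u\<in>UNIV. W u * W u * T c u) = of_nat CARD('a) ^ 2 * of_nat (Np c)"
proof -
  have "(\<Sum>u\<in>UNIV. W u * W u * T c u) = of_nat CARD('a) * (\<Sum>x\<in>UNIV. \<Sum>y\<in>UNIV. add_char (x ^ s + y ^ s - c * (x + y) ^ s))"
    using sum_T_T_T[of 1 1 1 1 c] by (simp add: W_eq_T)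
  also have "(\<Sum>x\<in>UNIV. \<Sum>y\<in>UNIV. add_char (x ^ s + y ^ s - c * (x + y) ^ s))
     = (\<Sum>x\<in>UNIV. \<Sum>w\<in>UNIV. add_char (x ^ s + (w - x) ^ s - c * w ^ s))"
    using sum_shift[of "\<lambda>y. add_char (x ^ s + y ^ s - c * (x + y) ^ s)" x for x] by simp
  also have "\<dots> = (\<Sum>w\<in>UNIV. \<Sum>x\<in>UNIV. add_char (x ^ s + (w - x) ^ s - c * w ^ s))" by (rule sum.swap)
  also have "\<dots> = of_nat CARD('a) * of_nat (card {t. t ^ s + (1 - t) ^ s - c = 0}) - of_nat CARD('a)
      + (\<Sum>x\<in>UNIV. add_char (x ^ s + (0 - x) ^ s - c * 0 ^ s))"
    by (rule sum_homogeneous) (simp add: algebra_simps flip: power_mult_distrib)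
  also have "\<dots> = of_nat CARD('a) * of_nat (Np c)" using s_pos by (simp add: neg_power_s power_0_left Np_def)
  finally show ?thesis by (simp add: power2_eq_square)
qed

lemma sum_WmWmT: "(\<Sum>u\<in>UNIV. W (- u) * W (- u) * T c u) = of_nat CARD('a) ^ 2 * of_nat (Np (- c))"
proof -
  have "(\<Sum>u\<in>UNIV. W (- u) * W (- u) * T c u) = (\<Sum>u\<in>UNIV. W u * W u * T (- c) u)"
  proof (rule sum.reindex_bij_witness[of _ uminus uminus])
    show "W (- u) * W (- u) * T (- c) (- u) = W (- u) * W (- u) * T c u" for u
      using T_scale[of "-1" c u] by (simp add: neg_power_s)
  qed auto
  thus ?thesis by (simp add: sum_WWT)
qed

text \<open>Here w = x - y, and the slice w = 0 is a sum of character values at 2 x^s, which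
  vanishes in odd characteristic; this leaves the -1.\<close>

lemma sum_WWmT:
  assumes "CHAR('a) \<noteq> 2"
  shows "(\<Sum>u\<in>UNIV. W u * W (- u) * T c u) = of_nat CARD('a) ^ 2 * (of_nat (Nm c) - 1)"
proof -
  have "(\<Sum>u\<in>UNIV. W u * W (- u) * T c u) = of_nat CARD('a) * (\<Sum>x\<in>UNIV. \<Sum>y\<in>UNIV. add_char (x ^ s + y ^ s - c * (x - y) ^ s))"
    using sum_T_T_T[of 1 1 1 "-1" c] by (simp add: W_eq_T)
  also have "(\<Sum>x\<in>UNIV. \<Sum>y\<in>UNIV. add_char (x ^ s + y ^ s - c * (x - y) ^ s))
     = (\<Sum>x\<in>UNIV. \<Sum>w\<in>UNIV. add_char (x ^ s + (x - w) ^ s - c * w ^ s))"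
    using sum_reflect[of "\<lambda>y. add_char (x ^ s + y ^ s - c * (x - y) ^ s)" x for x] by simp
  also have "\<dots> = (\<Sum>w\<in>UNIV. \<Sum>x\<in>UNIV. add_char (x ^ s + (x - w) ^ s - c * w ^ s))" by (rule sum.swap)
  also have "\<dots> = of_nat CARD('a) * of_nat (card {t. t ^ s + (t - 1) ^ s - c = 0}) - of_nat CARD('a)
      + (\<Sum>x\<in>UNIV. add_char (x ^ s + (x - 0) ^ s - c * 0 ^ s))"
    by (rule sum_homogeneous) (simp add: algebra_simps flip: power_mult_distrib)
  also have "(\<Sum>x\<in>UNIV. add_char (x ^ s + (x - 0) ^ s - c * 0 ^ s)) = 0"
    using s_pos sum_char_power_s[of 2] two_neq_0[OF assms] by (simp add: power_0_left mult_2_right)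
  also have "{t. t ^ s + (t - 1) ^ s - c = 0} = {t. t ^ s - (1 - t) ^ s = c}"
    using neg_power_s[of "1 - _"] by auto
  finally show ?thesis by (simp add: power2_eq_square Nm_def algebra_simps)
qed

lemma sum_WT: "(\<Sum>u\<in>UNIV. W u * T c u) = (if c = 1 then of_nat CARD('a) ^ 2 else 0)"
  using sum_T_T_dilate[of 1 c 1] by (simp add: W_eq_T)

lemma sum_WmT: "(\<Sum>u\<in>UNIV. W (- u) * T c u) = (if c = - 1 then of_nat CARD('a) ^ 2 else 0)"
proof -
  have "1 = - c \<longleftrightarrow> c = - 1" by (metis minus_minus)
  thus ?thesis using sum_T_T_dilate[of c 1 "- 1"] by (simp add: W_eq_T neg_power_s mult.commute)
qed

end

section \<open>The Galois action on the spectrum\<close>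

text \<open>The automorphism given by g multiplies the argument of the character by g. Replacing x
  by a x, with a^s = 1 / g, restores the coefficient 1 of x^s and moves the change into u.\<close>

locale weil_conj = weil_sums s K for s and K :: "'a::{field,finite} itself" +
  fixes g :: nat and a :: 'a
  assumes g: "residue_primroot CHAR('a) g" and a: "of_nat g * a ^ s = 1"
begin

text \<open>The automorphism raising the root of unity to the power g sends W u to W (c u).\<close>
definition c :: 'a where "c = of_nat g * a"

lemma W_c_power: "W (c ^ i * u) = (\<Sum>x\<in>UNIV. add_char (x ^ s - u * x) ^ (g ^ i))"
proof -
  have a0: "a ^ i \<noteq> 0" using a s_pos by (auto simp: power_0_left)
  have eq: "of_nat (g ^ i) * (a ^ i) ^ s = (1 :: 'a)"
    using a by (metis (no_types, lifting) mult.commute of_nat_power power_mult power_mult_distrib power_one)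
  have "(\<Sum>x\<in>UNIV. add_char (x ^ s - u * x) ^ (g ^ i)) = T (of_nat (g ^ i)) (of_nat (g ^ i) * u)"
    unfolding T_def by (simp only: add_char_of_nat_mult[symmetric] right_diff_distrib mult.assoc)
  also have "\<dots> = T 1 (of_nat (g ^ i) * u * a ^ i)"
    using T_scale[OF a0, of "of_nat (g ^ i)" "of_nat (g ^ i) * u"] by (simp only: eq)
  also have "\<dots> = W (c ^ i * u)" by (simp add: W_eq_T c_def power_mult_distrib mult_ac)
  finally show ?thesis by simp
qed

text \<open>The values of F lie in the ring of cyclotomic integers, with the automorphism acting as u \<mapsto> c u.\<close>
definition gal :: "('a \<Rightarrow> complex) \<Rightarrow> bool" where
  "gal F \<longleftrightarrow> (\<forall>u. \<exists>P. \<forall>i. F (c ^ i * u) = int_poly_at P (char_root TYPE('a) ^ (g ^ i)))"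

lemma galD: "gal F \<Longrightarrow> \<exists>P. \<forall>i. F (c ^ i * u) = int_poly_at P (char_root TYPE('a) ^ (g ^ i))"
  by (simp add: gal_def)

lemma gal_W: "gal W"
  unfolding gal_def
proof
  fix u
  show "\<exists>P. \<forall>i. W (c ^ i * u) = int_poly_at P (char_root TYPE('a) ^ (g ^ i))"
    by (intro exI[of _ "\<Sum>x\<in>UNIV. Polynomial.monom 1 (trace_residue (x ^ s - u * x))"] allI)
      (simp add: W_c_power int_poly_at_sum int_poly_at_monom add_char_eq mult.commute[of "g ^ _"] flip: power_mult)
qed

lemma gal_of_int: "gal (\<lambda>_. of_int n)"
  unfolding gal_def by (intro allI exI[of _ "[:n:]"]) (simp add: int_poly_at_pCons)

lemma gal_add: "gal F \<Longrightarrow> gal G \<Longrightarrow> gal (\<lambda>u. F u + G u)"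
  unfolding gal_def by (metis int_poly_at_add)

lemma gal_diff: "gal F \<Longrightarrow> gal G \<Longrightarrow> gal (\<lambda>u. F u - G u)"
  unfolding gal_def by (metis int_poly_at_diff)

lemma gal_mult: "gal F \<Longrightarrow> gal G \<Longrightarrow> gal (\<lambda>u. F u * G u)"
  unfolding gal_def by (metis int_poly_at_mult)

lemma gal_shift:
  assumes "gal F"
  shows "gal (\<lambda>u. F (c * u))"
  unfolding gal_def
proof
  fix u
  from galD[OF assms, of u] obtain P where P': "\<forall>i. F (c ^ i * u) = int_poly_at P (char_root TYPE('a) ^ (g ^ i))" ..
  note P = P'[rule_format]
  show "\<exists>P. \<forall>i. F (c * (c ^ i * u)) = int_poly_at P (char_root TYPE('a) ^ (g ^ i))"
  proof (intro exI[of _ "pcompose P (Polynomial.monom 1 g)"] allI)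
    fix i
    have "F (c * (c ^ i * u)) = int_poly_at P (char_root TYPE('a) ^ (g ^ Suc i))" using P[of "Suc i"] by (simp add: mult.assoc)
    also have "char_root TYPE('a) ^ (g ^ Suc i) = (char_root TYPE('a) ^ (g ^ i)) ^ g" by (simp add: mult.commute flip: power_mult)
    finally show "F (c * (c ^ i * u)) = int_poly_at (pcompose P (Polynomial.monom 1 g)) (char_root TYPE('a) ^ (g ^ i))"
      by (simp add: int_poly_at_pcompose int_poly_at_monom)
  qed
qed

lemma g_coprime: "\<not> CHAR('a) dvd g"
proof
  assume "CHAR('a) dvd g"
  moreover have "coprime CHAR('a) g" using g by (simp add: residue_primroot_def)
  ultimately have "is_unit CHAR('a)" by (metis coprime_absorb_left)
  thus False using p_prime not_prime_unit by blast
qed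

text \<open>Equal values have equal conjugates: the difference of the two polynomials vanishes at
  the root of unity, hence also at its g-th power. So the dilation of arguments acts on
  values.\<close>

lemma gal_transfer:
  assumes "gal F" "gal G" "F u = G v"
  shows "F (c * u) = G (c * v)"
proof -
  from galD[OF assms(1), of u] obtain P where P': "\<forall>i. F (c ^ i * u) = int_poly_at P (char_root TYPE('a) ^ (g ^ i))" ..
  note P = P'[rule_format]
  from galD[OF assms(2), of v] obtain Q where Q': "\<forall>i. G (c ^ i * v) = int_poly_at Q (char_root TYPE('a) ^ (g ^ i))" ..
  note Q = Q'[rule_format]
  have "int_poly_at (P - Q) (char_root TYPE('a)) = 0" using P[of 0] Q[of 0] assms(3) by (simp add: int_poly_at_diff)
  hence "int_poly_at (P - Q) (char_root TYPE('a) ^ g) = 0"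
    by (rule root_of_unity_conjugate[OF p_prime char_root(1) char_root(2) g_coprime])
  thus ?thesis using P[of 1] Q[of 1] by (simp add: int_poly_at_diff)
qed

text \<open>Invariance under the generator makes all conjugates equal, as the powers of g exhaust
  the nonzero residues mod p.\<close>

lemma gal_fixed_Ints:
  assumes "gal F" "F (c * u) = F u"
  shows "F u \<in> \<int>"
proof -
  from galD[OF assms(1), of u] obtain P where P': "\<forall>i. F (c ^ i * u) = int_poly_at P (char_root TYPE('a) ^ (g ^ i))" ..
  note P = P'[rule_format]
  have const: "F (c ^ i * u) = F u" for i
  proof (induction i)
    case (Suc i)
    have "F (c * (c ^ i * u)) = F (c * u)" by (rule gal_transfer[OF assms(1) assms(1) Suc])
    thus ?case using assms(2) by (simp add: mult.assoc)
  qed simp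
  have p1: "CHAR('a) > 1" using p_prime prime_gt_1_nat by blast
  show ?thesis
  proof (rule int_poly_at_const_imp_Ints[OF p_prime char_root(1) char_root(2)])
    fix k assume k: "0 < k" "k < CHAR('a)"
    hence "k \<in> totatives CHAR('a)" using p_prime by (simp add: totatives_prime)
    then obtain i where "k = g ^ i mod CHAR('a)"
      using residue_primroot_is_generator[OF p1 g] by (auto simp: bij_betw_def)
    hence "char_root TYPE('a) ^ k = char_root TYPE('a) ^ (g ^ i)" by (intro char_root_power_cong) (simp add: cong_def)
    thus "int_poly_at P (char_root TYPE('a) ^ k) = F u" using P[of i] const[of i] by simp
  qed
qed

section \<open>The dilation factor and the action on values\<close>

lemma g_power_prime: "(of_nat g :: 'a) ^ (CHAR('a) - 1) = 1"
proof -
  have p0: "CHAR('a) > 0" using p_prime prime_gt_0_nat by blast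
  have "(of_nat g :: 'a) = of_nat (g mod CHAR('a))" by (simp only: of_nat_eq_iff_cong_CHAR cong_def mod_mod_trivial)
  hence "(of_nat g :: 'a) ^ CHAR('a) = of_nat g" using prime_field_iff[of "of_nat g :: 'a"] p0 by (metis mod_less_divisor)
  hence "of_nat g * (of_nat g :: 'a) ^ (CHAR('a) - 1) = of_nat g * 1" using p0 by (simp flip: power_Suc)
  moreover have "(of_nat g :: 'a) \<noteq> 0" using g_coprime by (simp add: of_nat_eq_0_iff_char_dvd)
  ultimately show ?thesis by (metis mult_left_cancel)
qed

lemma c_power_s: "c ^ s = of_nat g ^ (s - 1)"
proof -
  have "c ^ s = of_nat g ^ s * a ^ s" by (simp add: c_def power_mult_distrib)
  also have "(of_nat g :: 'a) ^ s = of_nat g ^ (s - 1) * of_nat g" using s_pos by (simp flip: power_Suc2)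
  finally show ?thesis using a by (simp add: mult.assoc)
qed

lemma c_nonzero: "c \<noteq> 0"
  using a s_pos by (auto simp: c_def power_0_left)

lemma c_power_prime: "c ^ (CHAR('a) - 1) = 1"
proof -
  have "(c ^ (CHAR('a) - 1)) ^ s = (c ^ s) ^ (CHAR('a) - 1)" by (simp add: mult.commute flip: power_mult)
  also have "\<dots> = 1" unfolding c_power_s using g_power_prime by (metis power_mult mult.commute power_one)
  also have "1 = (1::'a) ^ s" by simp
  finally show ?thesis by (simp only: power_s_eq_iff)
qed

text \<open>For the implication from left to right, p - 2 further applications of the automorphism
  undo the first, because c^(p-1) = 1.\<close>

lemma W_c_eq_iff: "W (c * u) = W (c * v) \<longleftrightarrow> W u = W v"
proof
  assume *: "W (c * u) = W (c * v)"
  have "W (c ^ i * (c * u)) = W (c ^ i * (c * v))" for i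
  proof (induction i)
    case (Suc i)
    have "W (c * (c ^ i * (c * u))) = W (c * (c ^ i * (c * v)))" by (rule gal_transfer[OF gal_W gal_W Suc])
    thus ?case by (simp add: mult.assoc)
  qed (use * in simp)
  from this[of "CHAR('a) - 2"] have "W (c ^ Suc (CHAR('a) - 2) * u) = W (c ^ Suc (CHAR('a) - 2) * v)"
    by (simp add: mult_ac)
  moreover have "Suc (CHAR('a) - 2) = CHAR('a) - 1" using p_prime prime_ge_2_nat[of "CHAR('a)"] by simp
  ultimately show "W u = W v" using c_power_prime by simp
qed (rule gal_transfer[OF gal_W gal_W])

lemma c_power_s_dvd: "(CHAR('a) - 1) dvd (s - 1) \<Longrightarrow> c = 1"
proof -
  assume "(CHAR('a) - 1) dvd (s - 1)"
  then obtain m where m: "s - 1 = (CHAR('a) - 1) * m" by (elim dvdE)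
  have "c ^ s = 1 ^ s" unfolding c_power_s m by (simp only: power_mult g_power_prime power_one)
  thus ?thesis by (simp only: power_s_eq_iff)
qed

text \<open>For p = 2 and p = 3 the number p - 1 divides s - 1, in the latter case because s is odd,
  and then c = 1.\<close>

lemma CHAR_ge_5: "c \<noteq> 1 \<Longrightarrow> CHAR('a) \<ge> 5"
proof (rule ccontr)
  assume c: "c \<noteq> 1" and "\<not> CHAR('a) \<ge> 5"
  hence "CHAR('a) \<in> {2, 3, 4}" using prime_ge_2_nat[OF p_prime] by auto
  moreover have "CHAR('a) \<noteq> 4"
  proof
    assume "CHAR('a) = 4"
    hence "prime (2 * 2 :: nat)" using p_prime by simp
    thus False using prime_product by fastforce
  qed
  moreover have "CHAR('a) \<noteq> 2" using c c_power_s_dvd by auto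
  moreover have "CHAR('a) \<noteq> 3"
  proof
    assume *: "CHAR('a) = 3"
    hence "odd s" using odd_s by simp
    thus False using c c_power_s_dvd s_pos by (simp add: *)
  qed
  ultimately show False by simp
qed

lemma CARD_5:
  assumes "c \<noteq> 1" "CARD('a) = 5"
  shows "s mod 4 = 3"
proof -
  have "CHAR('a) dvd 5" using CARD_eq[where ?'a='a] assms(2) field_degree_pos[where ?'a='a] by (metis dvd_power)
  moreover have "prime (5 :: nat)" by simp
  ultimately have p5: "CHAR('a) = 5" using p_prime by (metis primes_dvd_imp_eq)
  hence "odd s" using odd_s by simp
  hence "s mod 4 = 1 \<or> s mod 4 = 3" by presburger
  moreover have "s mod 4 \<noteq> 1"
  proof
    assume "s mod 4 = 1"
    hence "4 dvd s - 1" by presburger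
    thus False using c_power_s_dvd assms(1) p5 by simp
  qed
  ultimately show ?thesis by simp
qed

text \<open>By \<open>W_c_eq_iff\<close> the result does not depend on the chosen preimage.\<close>

definition rot :: "complex \<Rightarrow> complex" where
  "rot v = W (c * (SOME u. u \<noteq> 0 \<and> W u = v))"

lemma rot_W: "u \<noteq> 0 \<Longrightarrow> rot (W u) = W (c * u)"
  unfolding rot_def by (metis (mono_tags, lifting) W_c_eq_iff someI_ex)

section \<open>Multiplicities and moments over the spectrum\<close>

definition value_count :: "complex \<Rightarrow> nat" where
  "value_count v = card {u. u \<noteq> 0 \<and> W u = v}"

lemma spec_iff: "v \<in> walsh_spectrum s TYPE('a) \<longleftrightarrow> (\<exists>u. u \<noteq> 0 \<and> W u = v)"
  by (auto simp: walsh_spectrum_def)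

lemma rot_spec: "v \<in> walsh_spectrum s TYPE('a) \<Longrightarrow> rot v \<in> walsh_spectrum s TYPE('a)"
  using c_nonzero by (metis spec_iff rot_W mult_eq_0_iff)

lemma rot_inj: "v \<in> walsh_spectrum s TYPE('a) \<Longrightarrow> w \<in> walsh_spectrum s TYPE('a) \<Longrightarrow> rot v = rot w \<Longrightarrow> v = w"
  by (auto simp: spec_iff rot_W W_c_eq_iff)

lemma value_count_pos: "v \<in> walsh_spectrum s TYPE('a) \<Longrightarrow> value_count v > 0"
  by (auto simp: value_count_def spec_iff card_gt_0_iff)

lemma value_count_rot:
  assumes "v \<in> walsh_spectrum s TYPE('a)"
  shows "value_count (rot v) = value_count v"
proof -
  obtain u where u: "u \<noteq> 0" "W u = v" using assms by (auto simp: spec_iff)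
  have "bij_betw (\<lambda>w. c * w) {w. w \<noteq> 0 \<and> W w = v} {w. w \<noteq> 0 \<and> W w = rot v}"
  proof (rule bij_betw_byWitness[where f' = "\<lambda>w. w / c"])
    show "(\<lambda>w. c * w) ` {w. w \<noteq> 0 \<and> W w = v} \<subseteq> {w. w \<noteq> 0 \<and> W w = rot v}"
      using c_nonzero rot_W by auto
    show "(\<lambda>w. w / c) ` {w. w \<noteq> 0 \<and> W w = rot v} \<subseteq> {w. w \<noteq> 0 \<and> W w = v}"
    proof safe
      fix w assume w: "w \<noteq> 0" "W w = rot v"
      have "W (c * (w / c)) = W (c * u)" using w u rot_W c_nonzero by force
      thus "W (w / c) = v" unfolding W_c_eq_iff using u by simp
    qed (use c_nonzero in auto)
  qed (use c_nonzero in auto)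
  thus ?thesis unfolding value_count_def by (simp add: bij_betw_same_card)
qed

lemma sum_spec: "(\<Sum>u\<in>UNIV-{0}. F (W u)) = (\<Sum>v\<in>walsh_spectrum s TYPE('a). of_nat (value_count v) * (F v :: complex))"
proof -
  have "(\<Sum>u\<in>UNIV-{0}. F (W u)) = (\<Sum>v\<in>walsh_spectrum s TYPE('a). \<Sum>u\<in>{u\<in>UNIV-{0}. W u = v}. F (W u))"
    unfolding walsh_spectrum_def by (rule sum.image_gen) simp
  also have "\<dots> = (\<Sum>v\<in>walsh_spectrum s TYPE('a). \<Sum>u\<in>{u. u \<noteq> 0 \<and> W u = v}. F v)"
    by (intro sum.cong) auto
  finally show ?thesis by (simp add: value_count_def)
qed

text \<open>Since W 0 = 0, the condition on F lets the sum run over all u, as in the correlation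
  identities.\<close>

lemma sum_spec':
  assumes "F 0 0 = 0"
  shows "(\<Sum>u\<in>UNIV. F (W u) (W (c * u))) = (\<Sum>v\<in>walsh_spectrum s TYPE('a). of_nat (value_count v) * (F v (rot v) :: complex))"
proof -
  have "(\<Sum>u\<in>UNIV. F (W u) (W (c * u))) = (\<Sum>u\<in>UNIV-{0}. F (W u) (W (c * u)))"
    by (subst sum.remove[of _ 0]) (use assms in \<open>auto simp: W_0\<close>)
  also have "\<dots> = (\<Sum>u\<in>UNIV-{0}. F (W u) (rot (W u)))" by (intro sum.cong) (auto simp: rot_W)
  finally show ?thesis using sum_spec[of "\<lambda>v. F v (rot v)"] by simp
qed

lemma spec_moment_0: "(\<Sum>v\<in>walsh_spectrum s TYPE('a). complex_of_nat (value_count v)) = of_nat CARD('a) - 1"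
proof -
  have "of_nat (CARD('a) - 1) = (\<Sum>v\<in>walsh_spectrum s TYPE('a). complex_of_nat (value_count v))" using sum_spec[of "\<lambda>_. 1"] by simp
  thus ?thesis using card_gt_1[where ?'a='a] by (simp add: of_nat_diff)
qed

lemma spec_moment_1: "(\<Sum>v\<in>walsh_spectrum s TYPE('a). of_nat (value_count v) * v) = of_nat CARD('a)"
  using sum_spec'[of "\<lambda>x _. x"] sum_W by simp

lemma spec_moment_2: "(\<Sum>v\<in>walsh_spectrum s TYPE('a). of_nat (value_count v) * (v * v)) = of_nat CARD('a) ^ 2"
  using sum_spec'[of "\<lambda>x _. x * x"] sum_W_W[of 1] by simp

lemma spec_moment_11: "c \<noteq> 1 \<Longrightarrow> (\<Sum>v\<in>walsh_spectrum s TYPE('a). of_nat (value_count v) * (v * rot v)) = 0"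
  using sum_spec'[of "\<lambda>x y. x * y"] sum_W_W[of c] by simp

lemma spec_moment_3: "(\<Sum>v\<in>walsh_spectrum s TYPE('a). of_nat (value_count v) * (v * v * v)) = of_nat CARD('a) ^ 2 * of_nat (Np 1)"
  using sum_spec'[of "\<lambda>x _. x * x * x"] sum_WWT[of 1] by (simp add: W_eq_T)

lemma rot_fixed_Ints: "v \<in> walsh_spectrum s TYPE('a) \<Longrightarrow> rot v = v \<Longrightarrow> v \<in> \<int>"
  using gal_fixed_Ints[OF gal_W] by (auto simp: spec_iff rot_W)

text \<open>Otherwise the orthogonality of dilates would make the sum of the squares of W, which is
  q^2, equal to 0.\<close>

lemma c_power_eq_1:
  assumes "\<And>u. W (c ^ m * u) = W u"
  shows "c ^ m = 1"
proof (rule ccontr)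
  assume "c ^ m \<noteq> 1"
  hence "(\<Sum>u\<in>UNIV. W u * W (c ^ m * u)) = 0" by (simp add: sum_W_W)
  moreover have "(\<Sum>u\<in>UNIV. W u * W (c ^ m * u)) = of_nat CARD('a) ^ 2" using sum_W_W[of 1] by (simp add: assms)
  ultimately show False using card_gt_1[where ?'a='a] by simp
qed

end

section \<open>Exclusion of the nontrivial cycle types\<close>

text \<open>The labelling starts at a moved point and follows its orbit.\<close>

lemma permutation_of_four:
  assumes S: "card S = 4" and r: "\<And>x. x \<in> S \<Longrightarrow> r x \<in> S" and inj: "inj_on r S"
    and x: "x \<in> S" "r x \<noteq> x"
  obtains v1 v2 v3 v4 where "S = {v1, v2, v3, v4}" "distinct [v1, v2, v3, v4]" "r v1 = v2"
    "r v2 = v1 \<and> r v3 = v3 \<and> r v4 = v4 \<or> r v2 = v1 \<and> r v3 = v4 \<and> r v4 = v3 \<or>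
     r v2 = v3 \<and> r v3 = v1 \<and> r v4 = v4 \<or> r v2 = v3 \<and> r v3 = v4 \<and> r v4 = v1"
proof -
  have fin: "finite S" using S card.infinite by fastforce
  have eq: "r y = r y' \<longleftrightarrow> y = y'" if "y \<in> S" "y' \<in> S" for y y' using inj that by (auto dest: inj_onD)
  define v1 v2 where "v1 = x" and "v2 = r x"
  have v12: "v1 \<in> S" "v2 \<in> S" "v1 \<noteq> v2" "r v1 = v2" using x r by (auto simp: v1_def v2_def)
  have "card (S - {v1, v2}) = 2" using S v12 by (subst card_Diff_subset) auto
  show ?thesis
  proof (cases "r v2 = v1")
    case True
    obtain v3 v4 where v34: "S - {v1, v2} = {v3, v4}" "v3 \<noteq> v4"
      using \<open>card (S - {v1, v2}) = 2\<close> by (auto simp: card_2_iff)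
    have S: "S = {v1, v2, v3, v4}" "v3 \<noteq> v1" "v3 \<noteq> v2" "v4 \<noteq> v1" "v4 \<noteq> v2" using v34 v12 by auto
    have "r v3 \<in> S" "r v4 \<in> S" using r S by auto
    moreover have "r v3 \<noteq> v1" "r v3 \<noteq> v2" "r v4 \<noteq> v1" "r v4 \<noteq> v2" "r v3 \<noteq> r v4"
      using eq[of v3 v1] eq[of v3 v2] eq[of v4 v1] eq[of v4 v2] eq[of v3 v4] S v12 v34(2) True by auto
    ultimately have "r v3 = v3 \<and> r v4 = v4 \<or> r v3 = v4 \<and> r v4 = v3" using S(1) by auto
    thus ?thesis using that[of v1 v2 v3 v4] S v34(2) v12 True by auto
  next
    case False
    define v3 where "v3 = r v2"
    have v3: "v3 \<in> S" "v3 \<noteq> v1" "v3 \<noteq> v2" using r v12 False eq[of v1 v2] by (auto simp: v3_def)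
    have "card (S - {v1, v2, v3}) = 1" using S v12 v3 by (subst card_Diff_subset) auto
    then obtain v4 where "S - {v1, v2, v3} = {v4}" by (auto simp: card_1_singleton_iff)
    hence S: "S = {v1, v2, v3, v4}" "v4 \<noteq> v1" "v4 \<noteq> v2" "v4 \<noteq> v3" using v12 v3 by auto
    have "r v3 \<in> S" "r v4 \<in> S" using r S by auto
    moreover have "r v3 \<noteq> v2" "r v3 \<noteq> v3" "r v4 \<noteq> v2" "r v4 \<noteq> v3" "r v3 \<noteq> r v4"
      using eq[of v3 v1] eq[of v3 v2] eq[of v4 v1] eq[of v4 v2] eq[of v3 v4] S v12 v3 v3_def by auto
    ultimately have "r v3 = v1 \<and> r v4 = v4 \<or> r v3 = v4 \<and> r v4 = v1" using S(1) by auto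
    thus ?thesis using that[of v1 v2 v3 v4] S v12 v3 v3_def by auto
  qed
qed

context weil_conj
begin

section \<open>The cycle types other than a transposition\<close>

lemma CARD_int: "int CARD('a) = int CHAR('a) ^ field_degree TYPE('a)"
  using CARD_eq[where ?'a='a] by simp

lemma CARD_gt_5:
  assumes "c \<noteq> 1" "CARD('a) \<noteq> 5"
  shows "CARD('a) > 5"
proof -
  have "CHAR('a) \<le> CARD('a)" unfolding CARD_eq
    using CHAR_ge_5[OF assms(1)] field_degree_pos[where ?'a='a] by (intro self_le_power) auto
  thus ?thesis using CHAR_ge_5[OF assms(1)] assms(2) by simp
qed

lemma rot_W': "u \<noteq> 0 \<Longrightarrow> W (c * u) = rot (W u)"
  by (simp add: rot_W)

lemma W_spec: "u \<noteq> 0 \<Longrightarrow> W u \<in> walsh_spectrum s TYPE('a)"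
  by (auto simp: spec_iff)

lemma real_spec: "v \<in> walsh_spectrum s TYPE('a) \<Longrightarrow> v \<in> \<real>"
  using cnj_W by (auto simp: spec_iff Reals_cnj_iff)

text \<open>All four values share a multiplicity m, and their sum is an integer t. Hence m t = q and
  4 m = q - 1, so m divides 1 and q = 5.\<close>

lemma not_four_cycle:
  assumes c: "c \<noteq> 1" "CARD('a) \<noteq> 5" and S: "walsh_spectrum s TYPE('a) = {v1, v2, v3, v4}" "distinct [v1, v2, v3, v4]"
    and r: "rot v1 = v2" "rot v2 = v3" "rot v3 = v4" "rot v4 = v1"
  shows False
proof -
  define m where "m = value_count v1"
  have m: "value_count v1 = m" "value_count v2 = m" "value_count v3 = m" "value_count v4 = m"
    using value_count_rot[of v1] value_count_rot[of v2] value_count_rot[of v3] S r by (simp_all add: m_def)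
  obtain u where u: "u \<noteq> 0" "W u = v1" using S(1) spec_iff[of v1] by auto
  have Wc: "W (c * u) = v2" "W (c * (c * u)) = v3" "W (c * (c * (c * u))) = v4" "W (c * (c * (c * (c * u)))) = v1"
    using u c_nonzero r by (simp_all add: rot_W')
  let ?F = "\<lambda>u. W u + (W (c * u) + (W (c * (c * u)) + W (c * (c * (c * u)))))"
  have "gal ?F" by (intro gal_add gal_shift gal_W)
  moreover have "?F (c * u) = ?F u" by (simp add: u Wc)
  ultimately have "?F u \<in> \<int>" by (rule gal_fixed_Ints)
  then obtain t where t: "v1 + (v2 + (v3 + v4)) = of_int t" by (auto simp: u Wc elim: Ints_cases)
  have "complex_of_int (4 * int m) = of_int (int CARD('a) - 1)"
    using spec_moment_0 S by (simp add: m)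
  hence m4: "4 * int m = int CARD('a) - 1" by (simp only: of_int_eq_iff)
  have "of_nat m * (v1 + (v2 + (v3 + v4))) = of_nat CARD('a)"
    using spec_moment_1 S by (simp add: m algebra_simps)
  hence "complex_of_int (int m * t) = of_int (int CARD('a))" unfolding t by simp
  hence "int m * t = int CARD('a)" by (simp only: of_int_eq_iff)
  hence "int m dvd int CARD('a) - 4 * int m" by (metis dvd_diff dvd_triv_left dvd_triv_right)
  hence "int m dvd 1" using m4 by simp
  hence "m = 1" by simp
  thus False using m4 c(2) by simp
qed

text \<open>The moments only reduce this to M = 1 and v4 = 0: then W is supported on u, c u, c^2 u
  with c^3 = 1. The difference c u - u occurs just once among these points, so the correlation of W
  with this translate is v1 v2, which is not 0, against orthogonality.\<close>

lemma not_three_cycle: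
  assumes c: "c \<noteq> 1" "CARD('a) \<noteq> 5" and S: "walsh_spectrum s TYPE('a) = {v1, v2, v3, v4}" "distinct [v1, v2, v3, v4]"
    and r: "rot v1 = v2" "rot v2 = v3" "rot v3 = v1" "rot v4 = v4"
  shows False
proof -
  define M N where "M = value_count v1" and "N = value_count v4"
  have m: "value_count v1 = M" "value_count v2 = M" "value_count v3 = M" "value_count v4 = N"
    using value_count_rot[of v1] value_count_rot[of v2] S r by (simp_all add: M_def N_def)
  have MN: "M > 0" "N > 0" using value_count_pos[of v1] value_count_pos[of v4] S(1) m by auto
  obtain u where u: "u \<noteq> 0" "W u = v1" using S(1) spec_iff[of v1] by auto
  have Wc: "W (c * u) = v2" "W (c * (c * u)) = v3" "W (c * (c * (c * u))) = v1"
    using u c_nonzero r by (simp_all add: rot_W')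
  have "W u + (W (c * u) + W (c * (c * u))) \<in> \<int>"
  proof (rule gal_fixed_Ints[of "\<lambda>u. W u + (W (c * u) + W (c * (c * u)))"])
    show "gal (\<lambda>u. W u + (W (c * u) + W (c * (c * u))))" by (intro gal_add gal_shift gal_W)
  qed (simp add: u Wc)
  then obtain T where T: "v1 + (v2 + v3) = of_int T" by (auto simp: u Wc elim: Ints_cases)
  have "W u * W (c * u) + (W (c * u) * W (c * (c * u)) + W (c * (c * u)) * W (c * (c * (c * u)))) \<in> \<int>"
  proof (rule gal_fixed_Ints[of "\<lambda>u. W u * W (c * u) + (W (c * u) * W (c * (c * u)) + W (c * (c * u)) * W (c * (c * (c * u))))"])
    show "gal (\<lambda>u. W u * W (c * u) + (W (c * u) * W (c * (c * u)) + W (c * (c * u)) * W (c * (c * (c * u)))))"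
      by (intro gal_add gal_mult gal_shift gal_W)
  qed (use u Wc c_nonzero in \<open>simp add: rot_W' r\<close>)
  then obtain E where E: "v1 * v2 + (v2 * v3 + v3 * v1) = of_int E" by (auto simp: u Wc elim: Ints_cases)
  obtain D where D: "v4 = of_int D" using rot_fixed_Ints[of v4] S r by (auto elim: Ints_cases)
  have m0: "3 * int M + int N = int CARD('a) - 1"
  proof -
    have "complex_of_int (3 * int M + int N) = of_int (int CARD('a) - 1)" using spec_moment_0 S by (simp add: m)
    thus ?thesis by (simp only: of_int_eq_iff)
  qed
  have m1: "int M * T + int N * D = int CARD('a)"
  proof -
    have "of_nat M * (v1 + (v2 + v3)) + of_nat N * v4 = of_nat CARD('a)"
      using spec_moment_1 S by (simp add: m algebra_simps)
    hence "complex_of_int (int M * T + int N * D) = of_int (int CARD('a))" unfolding T D by simp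
    thus ?thesis by (simp only: of_int_eq_iff)
  qed
  have m2: "int M * (T\<^sup>2 - 2 * E) + int N * D\<^sup>2 = int CARD('a) ^ 2"
  proof -
    have "of_nat M * ((v1 + (v2 + v3))\<^sup>2 - 2 * (v1 * v2 + (v2 * v3 + v3 * v1))) + of_nat N * (v4 * v4) = of_nat CARD('a) ^ 2"
      using spec_moment_2 S by (simp add: m algebra_simps power2_eq_square)
    hence "complex_of_int (int M * (T\<^sup>2 - 2 * E) + int N * D\<^sup>2) = of_int (int CARD('a) ^ 2)"
      unfolding T D E by (simp add: power2_eq_square)
    thus ?thesis by (simp only: of_int_eq_iff)
  qed
  have m11: "int M * E + int N * D\<^sup>2 = 0"
  proof -
    have "of_nat M * (v1 * v2 + (v2 * v3 + v3 * v1)) + of_nat N * (v4 * v4) = 0"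
      using spec_moment_11[OF c(1)] S r by (simp add: m algebra_simps)
    hence "complex_of_int (int M * E + int N * D\<^sup>2) = of_int 0"
      unfolding D E by (simp add: power2_eq_square)
    thus ?thesis by (simp only: of_int_eq_iff)
  qed
  have "int M = 1 \<and> D = 0"
    by (rule three_cycle_arith[OF p_prime CHAR_ge_5[OF c(1)] CARD_int _ _ _ m0 m1 m2 m11])
      (use CARD_gt_5[OF c] MN in auto)
  hence M1: "M = 1" and v40: "v4 = 0" using D by auto
  have uniq: "w = w'" if "w \<noteq> 0" "w' \<noteq> 0" "W w = v" "W w' = v" "v \<in> {v1, v2, v3}" for w w' v
  proof -
    have "card {u. u \<noteq> 0 \<and> W u = v} = 1" using that m M1 by (auto simp: value_count_def)
    then obtain y where "{u. u \<noteq> 0 \<and> W u = v} = {y}" by (auto simp: card_1_singleton_iff)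
    hence "w \<in> {y}" "w' \<in> {y}" using that by auto
    thus ?thesis by simp
  qed
  have supp: "w = u \<or> w = c * u \<or> w = c * (c * u)" if "W w \<noteq> 0" for w
  proof -
    have w: "w \<noteq> 0" using that W_0 by metis
    hence "W w \<in> {v1, v2, v3}" using W_spec[OF w] S(1) v40 that by auto
    thus ?thesis using uniq[of w u v1] uniq[of w "c * u" v2] uniq[of w "c * (c * u)" v3] w u Wc c_nonzero by auto
  qed
  have c3: "c ^ 3 = 1"
  proof (rule c_power_eq_1)
    fix w :: 'a
    show "W (c ^ 3 * w) = W w"
    proof (cases "w = 0")
      case False
      have "W (c ^ 3 * w) = rot (rot (rot (W w)))"
        using False c_nonzero by (simp add: power3_eq_cube mult.assoc rot_W)
      moreover have "W w \<in> {v1, v2, v3, v4}" using W_spec[OF False] S by simp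
      ultimately show ?thesis using r by auto
    qed simp
  qed
  have c3': "c * (c * c) = 1" using c3 by (simp add: power3_eq_cube mult.assoc)
  have c2: "c * c \<noteq> 1" using c3' c(1) by auto
  define b where "b = c * u - u"
  have b0: "b \<noteq> 0" using c(1) u by (auto simp: b_def)
  have "W w * W (w + b) = 0" if "w \<noteq> u" for w
  proof (rule ccontr)
    assume A: "W w * W (w + b) \<noteq> 0"
    hence "w = u \<or> w = c * u \<or> w = c * (c * u)"
      and B: "w + b = u \<or> w + b = c * u \<or> w + b = c * (c * u)" using supp by auto
    with that consider "w = c * u" | "w = c * (c * u)" by blast
    thus False
    proof cases
      case 1
      from B have "(c + c - 1) * u = 1 * u \<or> (c + c - 1) * u = c * u \<or> (c + c - 1) * u = (c * c) * u"
        unfolding 1 b_def by (simp add: algebra_simps)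
      hence "c + c - 1 = 1 \<or> c + c - 1 = c \<or> c + c - 1 = c * c" using u by (metis mult_right_cancel)
      thus False
      proof (elim disjE)
        assume "c + c - 1 = 1"
        hence "2 * (c - 1) = 0" by (simp add: algebra_simps)
        moreover have "CHAR('a) \<noteq> 2" using CHAR_ge_5[OF c(1)] by simp
        ultimately show False using two_neq_0 c(1) by simp
      next
        assume "c + c - 1 = c * c"
        hence "(c - 1) * (c - 1) = 0" by (simp add: algebra_simps)
        thus False using c(1) by simp
      qed (use c(1) in simp)
    next
      case 2
      from B have "(c * c + c - 1) * u = 1 * u \<or> (c * c + c - 1) * u = c * u \<or> (c * c + c - 1) * u = (c * c) * u"
        unfolding 2 b_def by (simp add: algebra_simps)
      hence "c * c + c - 1 = 1 \<or> c * c + c - 1 = c \<or> c * c + c - 1 = c * c" using u by (metis mult_right_cancel)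
      thus False
      proof (elim disjE)
        assume "c * c + c - 1 = 1"
        hence "(c - 1) * (c + 2) = 0" by (simp add: algebra_simps)
        hence "c = - 2" using c(1) by (simp add: add_eq_0_iff2)
        \<comment> \<open>c = -2 gives c^3 = -8, which is 1 only in characteristic 3.\<close>
        hence "(9 :: 'a) = 0" using c3' by simp
        hence "CHAR('a) dvd 9" using of_nat_eq_0_iff_char_dvd[of 9, where ?'a='a] by simp
        hence "CHAR('a) dvd 3 * 3" by simp
        hence "CHAR('a) dvd 3" using p_prime prime_dvd_mult_iff by blast
        thus False using CHAR_ge_5[OF c(1)] by (auto dest: dvd_imp_le)
      qed (use c2 c(1) in \<open>auto simp: algebra_simps\<close>)
    qed
  qed
  hence "(\<Sum>w\<in>UNIV-{u}. W w * W (w + b)) = 0" by (intro sum.neutral) auto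
  hence "(\<Sum>w\<in>UNIV. W w * W (w + b)) = W u * W (u + b)"
    by (subst sum.remove[of _ u]) auto
  hence "v1 * v2 = 0" using sum_W_translate[OF b0] u Wc by (simp add: b_def)
  thus False using S(2) v40 by auto
qed

lemma c_neg_1:
  assumes c: "c \<noteq> 1" and S: "\<And>v. v \<in> walsh_spectrum s TYPE('a) \<Longrightarrow> rot (rot v) = v"
  shows "c = - 1"
proof -
  have "c ^ 2 = 1"
  proof (rule c_power_eq_1)
    fix w :: 'a
    show "W (c ^ 2 * w) = W w"
    proof (cases "w = 0")
      case False
      have "W (c ^ 2 * w) = rot (rot (W w))"
        using False c_nonzero by (simp add: power2_eq_square mult.assoc rot_W)
      thus ?thesis using S W_spec[OF False] by simp
    qed simp
  qed
  thus ?thesis using c by (simp add: power2_eq_1_iff)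
qed

lemma pair_Ints:
  assumes "v \<in> walsh_spectrum s TYPE('a)" "rot v = w" "rot w = v"
  shows "v + w \<in> \<int>" "v * w \<in> \<int>" "(v - w)\<^sup>2 \<in> \<int>"
proof -
  obtain u where u: "u \<noteq> 0" "W u = v" using assms(1) by (auto simp: spec_iff)
  have Wc: "W (c * u) = w" "W (c * (c * u)) = v" using u c_nonzero assms by (simp_all add: rot_W')
  have "W u + W (c * u) \<in> \<int>"
    by (rule gal_fixed_Ints[of "\<lambda>u. W u + W (c * u)"]) (intro gal_add gal_shift gal_W, simp add: u Wc)
  thus *: "v + w \<in> \<int>" by (simp add: u Wc)
  have "W u * W (c * u) \<in> \<int>"
    by (rule gal_fixed_Ints[of "\<lambda>u. W u * W (c * u)"]) (intro gal_mult gal_shift gal_W, simp add: u Wc)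
  thus **: "v * w \<in> \<int>" by (simp add: u Wc)
  have "(v - w)\<^sup>2 = (v + w) * (v + w) - 4 * (v * w)" by (simp add: power2_eq_square algebra_simps)
  thus "(v - w)\<^sup>2 \<in> \<int>" using * ** by simp
qed

text \<open>This is what \<open>two_pairs_arith\<close> leaves open. In the third moment the cubes
  of v3 and v4 = -v3 cancel, so v1^3 + v2^3 alone is a multiple of q^2.\<close>

lemma not_two_pairs_aux:
  assumes c: "c \<noteq> 1" "CARD('a) \<noteq> 5" and S: "walsh_spectrum s TYPE('a) = {v1, v2, v3, v4}" "distinct [v1, v2, v3, v4]"
    and r: "rot v1 = v2" "rot v2 = v1" "rot v3 = v4" "rot v4 = v3"
    and v: "v3 + v4 = 0" "v1 + v2 = of_nat CARD('a)" "value_count v1 = 1"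
  shows False
proof -
  define N where "N = value_count v3"
  have m: "value_count v1 = 1" "value_count v2 = 1" "value_count v3 = N" "value_count v4 = N"
    using value_count_rot[of v1] value_count_rot[of v3] S r v(3) by (simp_all add: N_def)
  have v4: "v4 = - v3" using v(1) by (simp add: eq_neg_iff_add_eq_0 add.commute)
  obtain A A' B where real: "v1 = complex_of_real A" "v2 = complex_of_real A'" "v3 = complex_of_real B"
    using real_spec[of v1] real_spec[of v2] real_spec[of v3] S(1) by (auto elim!: Reals_cases)
  obtain nA where nA: "v1 * v2 = of_int nA" using pair_Ints(2)[of v1 v2] S(1) r by (auto elim: Ints_cases)
  obtain \<beta>' where \<beta>': "v3 * v4 = of_int \<beta>'" using pair_Ints(2)[of v3 v4] S(1) r by (auto elim: Ints_cases)
  define \<beta> where "\<beta> = - \<beta>'"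
  have \<beta>: "v3\<^sup>2 = of_int \<beta>" using \<beta>' v4 by (simp add: \<beta>_def power2_eq_square) (metis minus_minus)
  have N: "2 * int N = int CARD('a) - 3"
  proof -
    have "complex_of_int (2 * int N) = of_int (int CARD('a) - 3)" using spec_moment_0 S by (simp add: m algebra_simps)
    thus ?thesis by (simp only: of_int_eq_iff)
  qed
  have eq: "nA = int N * \<beta>"
  proof -
    have "2 * (v1 * v2) + 2 * (of_nat N * (v3 * v4)) = 0"
      using spec_moment_11[OF c(1)] S r by (simp add: m algebra_simps)
    hence "2 * (v1 * v2) = 2 * (of_nat N * v3\<^sup>2)"
      unfolding v4 by (simp add: power2_eq_square)
    hence "v1 * v2 = of_nat N * v3\<^sup>2" by simp
    hence "complex_of_int nA = of_int (int N * \<beta>)" unfolding nA \<beta> by simp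
    thus ?thesis by (simp only: of_int_eq_iff)
  qed
  have V: "int CARD('a) ^ 3 - 3 * int CARD('a) * nA = int CARD('a) ^ 2 * int (Np 1)"
  proof -
    have "(v1 + v2) ^ 3 - 3 * (v1 + v2) * (v1 * v2) = v1 * v1 * v1 + v2 * v2 * v2"
      by (simp add: power3_eq_cube algebra_simps)
    also have "\<dots> = of_nat CARD('a) ^ 2 * of_nat (Np 1)"
    proof -
      have "v1 * v1 * v1 + v2 * v2 * v2 + of_nat N * (v3 * v3 * v3 + v4 * v4 * v4) = of_nat CARD('a) ^ 2 * of_nat (Np 1)"
        using spec_moment_3 S by (simp add: m algebra_simps)
      moreover have "v3 * v3 * v3 + v4 * v4 * v4 = 0" by (simp add: v4)
      ultimately show ?thesis by simp
    qed
    finally have "complex_of_int (int CARD('a) ^ 3 - 3 * int CARD('a) * nA) = of_int (int CARD('a) ^ 2 * int (Np 1))"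
      unfolding v nA by simp
    thus ?thesis by (simp only: of_int_eq_iff)
  qed
  show False
  proof (rule two_pairs_real_arith[OF p_prime CHAR_ge_5[OF c(1)] CARD_int _ N _ _ _ _ eq V])
    show "A + A' = of_int (int CARD('a))" using v(2) unfolding real by (metis of_int_of_nat_eq of_real_add of_real_eq_iff of_real_of_nat_eq)
    show "A * A' = of_int nA" using nA unfolding real by (metis of_real_mult of_real_eq_iff of_real_of_int_eq)
    show "B\<^sup>2 = of_int \<beta>" using \<beta> unfolding real by (metis of_real_power of_real_eq_iff of_real_of_int_eq)
    show "B \<noteq> 0" using S(2) v4 real by auto
  qed (use CARD_gt_5[OF c] in auto)
qed

lemma not_two_pairs:
  assumes c: "c \<noteq> 1" "CARD('a) \<noteq> 5" and S: "walsh_spectrum s TYPE('a) = {v1, v2, v3, v4}" "distinct [v1, v2, v3, v4]"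
    and r: "rot v1 = v2" "rot v2 = v1" "rot v3 = v4" "rot v4 = v3"
  shows False
proof -
  define M N where "M = value_count v1" and "N = value_count v3"
  have m: "value_count v1 = M" "value_count v2 = M" "value_count v3 = N" "value_count v4 = N"
    using value_count_rot[of v1] value_count_rot[of v3] S r by (simp_all add: M_def N_def)
  have MN: "M > 0" "N > 0" using value_count_pos[of v1] value_count_pos[of v3] S(1) m by auto
  obtain A where A: "v1 + v2 = of_int A" using pair_Ints(1)[of v1 v2] S(1) r by (auto elim: Ints_cases)
  obtain B where B: "v3 + v4 = of_int B" using pair_Ints(1)[of v3 v4] S(1) r by (auto elim: Ints_cases)
  have m0: "2 * (int M + int N) = int CARD('a) - 1"
  proof -
    have "complex_of_int (2 * (int M + int N)) = of_int (int CARD('a) - 1)" using spec_moment_0 S by (simp add: m)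
    thus ?thesis by (simp only: of_int_eq_iff)
  qed
  have m1: "int M * A + int N * B = int CARD('a)"
  proof -
    have "of_nat M * (v1 + v2) + of_nat N * (v3 + v4) = of_nat CARD('a)"
      using spec_moment_1 S by (simp add: m algebra_simps)
    hence "complex_of_int (int M * A + int N * B) = of_int (int CARD('a))" unfolding A B by simp
    thus ?thesis by (simp only: of_int_eq_iff)
  qed
  \<comment> \<open>Adding the second moment and the correlation with W (c u) completes the squares
    of the pair sums, so only the integers A and B remain.\<close>
  have m2: "int M * A\<^sup>2 + int N * B\<^sup>2 = int CARD('a) ^ 2"
  proof -
    have e1: "of_nat M * (v1 * v1 + v2 * v2) + of_nat N * (v3 * v3 + v4 * v4) = of_nat CARD('a) ^ 2"
      using spec_moment_2 S by (simp add: m algebra_simps)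
    have e2: "of_nat M * (2 * v1 * v2) + of_nat N * (2 * v3 * v4) = 0"
      using spec_moment_11[OF c(1)] S r by (simp add: m algebra_simps)
    have "of_nat M * (v1 + v2)\<^sup>2 + of_nat N * (v3 + v4)\<^sup>2
       = (of_nat M * (v1 * v1 + v2 * v2) + of_nat N * (v3 * v3 + v4 * v4)) + (of_nat M * (2 * v1 * v2) + of_nat N * (2 * v3 * v4))"
      by (simp add: power2_eq_square algebra_simps)
    also have "\<dots> = of_nat CARD('a) ^ 2" unfolding e1 e2 by simp
    finally have "complex_of_int (int M * A\<^sup>2 + int N * B\<^sup>2) = of_int (int CARD('a) ^ 2)" unfolding A B by simp
    thus ?thesis by (simp only: of_int_eq_iff)
  qed
  have "B = 0 \<and> A = int CARD('a) \<and> int M = 1 \<or> A = 0 \<and> B = int CARD('a) \<and> int N = 1"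
    by (rule two_pairs_arith[OF p_prime CHAR_ge_5[OF c(1)] CARD_int _ _ _ refl m0 m1 m2])
      (use CARD_gt_5[OF c] MN in auto)
  thus False
  proof (elim disjE conjE)
    assume "B = 0" "A = int CARD('a)" "int M = 1"
    thus False by (intro not_two_pairs_aux[OF c S r]) (use A B m in auto)
  next
    assume *: "A = 0" "B = int CARD('a)" "int N = 1"
    have S': "walsh_spectrum s TYPE('a) = {v3, v4, v1, v2}" "distinct [v3, v4, v1, v2]" using S by auto
    show False by (rule not_two_pairs_aux[OF c S' r(3,4,1,2)]) (use * A B m in auto)
  qed
qed

end

section \<open>A single transposition\<close>

lemma even_card_involution:
  assumes "finite S" "\<And>x. x \<in> S \<Longrightarrow> f x \<in> S" "\<And>x. x \<in> S \<Longrightarrow> f (f x) = x" "\<And>x. x \<in> S \<Longrightarrow> f x \<noteq> x"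
  shows "even (card S)"
  using assms
proof (induction "card S" arbitrary: S rule: less_induct)
  case (less S)
  show ?case
  proof (cases "S = {}")
    case False
    then obtain x where x: "x \<in> S" by blast
    have fx: "f x \<in> S" "f x \<noteq> x" "f (f x) = x" using less.prems x by auto
    have "card S = card (S - {x, f x}) + 2"
      using x fx less.prems(1) card_mono[of S "{x, f x}"] by (subst card_Diff_subset) auto
    moreover have "even (card (S - {x, f x}))"
    proof (rule less.hyps)
      show "card (S - {x, f x}) < card S" using x less.prems(1) by (intro psubset_card_mono) auto
      show "f y \<in> S - {x, f x}" if "y \<in> S - {x, f x}" for y
        using that less.prems fx x by (metis DiffD1 DiffD2 DiffI insertCI insertE singletonD)
    qed (use less.prems in auto)
    ultimately show ?thesis by simp
  qed simp
qed

context weil_sums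
begin

text \<open>Of the four products two are translates, which are orthogonal, and two are reflections,
  which return W at opposite arguments. So the autocorrelation of the odd part is an even
  part.\<close>

lemma sum_odd_part_translate:
  assumes "r ^ s = 1 / 2" "CHAR('a) \<noteq> 2" "b \<noteq> 0"
  shows "(\<Sum>u\<in>UNIV. (W u - W (- u)) * (W (u + b) - W (- (u + b)))) = - of_nat CARD('a) * (W (b * r) + W (- (b * r)))"
proof -
  have flip: "(\<Sum>u\<in>UNIV. h (- u)) = (\<Sum>u\<in>UNIV. h (u :: 'a))" for h :: "'a \<Rightarrow> complex"
    by (rule sum.reindex_bij_witness[of _ uminus uminus]) auto
  have expand: "(W u - W (- u)) * (W (u + b) - W (- (u + b)))
     = W u * W (u + b) - W u * W (- b - u) - W (- u) * W (b - - u) + W (- u) * W (- u + - b)" for u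
  proof -
    have "- b - u = - (u + b)" "b - - u = u + b" "- u + - b = - (u + b)" by simp_all
    thus ?thesis by (simp only: left_diff_distrib right_diff_distrib) (simp only: algebra_simps)
  qed
  have "(\<Sum>u\<in>UNIV. (W u - W (- u)) * (W (u + b) - W (- (u + b))))
     = (\<Sum>u\<in>UNIV. W u * W (u + b)) - (\<Sum>u\<in>UNIV. W u * W (- b - u))
       - (\<Sum>u\<in>UNIV. W (- u) * W (b - - u)) + (\<Sum>u\<in>UNIV. W (- u) * W (- u + - b))"
    by (simp only: expand sum.distrib sum_subtractf)
  also have "(\<Sum>u\<in>UNIV. W (- u) * W (b - - u)) = (\<Sum>u\<in>UNIV. W u * W (b - u))"
    by (rule flip[of "\<lambda>u. W u * W (b - u)"])
  also have "(\<Sum>u\<in>UNIV. W (- u) * W (- u + - b)) = (\<Sum>u\<in>UNIV. W u * W (u + - b))"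
    by (rule flip[of "\<lambda>u. W u * W (u + - b)"])
  finally show ?thesis
    using sum_W_translate[of b] sum_W_translate[of "- b"] assms(3)
    by (simp only: sum_W_reflect[OF assms(1,2)] neg_equal_0_iff_equal) (simp add: algebra_simps)
qed

lemma Nm_pos:
  assumes "CHAR('a) \<noteq> 2" "\<kappa> \<in> {0, 1, - 1}"
  shows "Nm \<kappa> > 0"
proof -
  have "(1 / 2 :: 'a) = 1 - 1 / 2" using two_neq_0[OF assms(1)] by (simp add: field_simps)
  hence "(1 / 2) ^ s - (1 - 1 / 2) ^ s = (0 :: 'a)" by (metis diff_self)
  moreover have "1 ^ s - (1 - 1) ^ s = (1 :: 'a)" "0 ^ s - (1 - 0) ^ s = (- 1 :: 'a)"
    using s_pos by (simp_all add: power_0_left)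
  ultimately have "\<exists>x. x ^ s - (1 - x) ^ s = \<kappa>" using assms(2) by blast
  thus ?thesis unfolding Nm_def by (auto simp: card_gt_0_iff)
qed

lemma sum_Nm: "(\<Sum>\<kappa>\<in>UNIV. Nm \<kappa>) = CARD('a)"
proof -
  have "(\<Sum>\<kappa>\<in>(UNIV :: 'a set). sum (\<lambda>_. 1 :: nat) {x. x \<in> UNIV \<and> x ^ s - (1 - x) ^ s = \<kappa>}) = (\<Sum>x\<in>(UNIV::'a set). 1)"
    by (rule sum.group) auto
  thus ?thesis by (simp add: Nm_def)
qed

text \<open>The counts sum to q over q parameters, so if none is 0, all are 1. By
  \<open>Nm_pos\<close>, a missing parameter is not 0, 1 or -1.\<close>

lemma Nm_cases:
  assumes "CHAR('a) \<noteq> 2" "CARD('a) > 3"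
  obtains \<kappa> where "\<kappa> \<notin> {0, 1, - 1}" "Nm \<kappa> = 0" | \<kappa> where "\<kappa> \<notin> {0, 1, - 1}" "Nm \<kappa> = 1" "Nm 1 = 1"
proof (cases "\<exists>\<kappa>. Nm \<kappa> = 0")
  case True
  then obtain \<kappa> where "Nm \<kappa> = 0" by blast
  thus ?thesis using that(1)[of \<kappa>] Nm_pos[OF assms(1), of \<kappa>] by (metis less_irrefl)
next
  case False
  have one: "Nm \<kappa> = 1" for \<kappa>
  proof (rule ccontr)
    assume "Nm \<kappa> \<noteq> 1"
    hence "Nm \<kappa> > 1" using False by (metis less_one linorder_neqE_nat)
    hence "(\<Sum>\<kappa>\<in>(UNIV::'a set). 1) < (\<Sum>\<kappa>\<in>UNIV. Nm \<kappa>)"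
      using False by (intro sum_strict_mono_ex1) (auto simp: Suc_le_eq)
    thus False by (simp add: sum_Nm)
  qed
  have "card {0, 1, - 1 :: 'a} \<le> 3" by (simp add: card_insert_if)
  hence "{0, 1, - 1 :: 'a} \<noteq> UNIV" using assms(2) by (metis not_le)
  then obtain \<kappa> :: 'a where "\<kappa> \<notin> {0, 1, - 1}" by blast
  thus ?thesis using that(2)[of \<kappa>] one by blast
qed

end

context weil_conj
begin

text \<open>The involution x -> 1 - x fixes only 1/2, where the parameter is 2^(1 - s). As g^(s - 1)
  = c^s = -1 and 2 is a power of g, this is 1 or -1, and both are excluded.\<close>

lemma Np_even:
  assumes c: "c \<noteq> 1" "c = - 1" and \<kappa>: "\<kappa> \<noteq> 1" "\<kappa> \<noteq> - 1"
  shows "even (Np \<kappa>)"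
proof -
  have p2: "CHAR('a) \<noteq> 2" and p5: "CHAR('a) > 2" using CHAR_ge_5[OF c(1)] by simp_all
  have p1: "CHAR('a) > 1" using p5 by simp
  have "2 \<in> totatives CHAR('a)" using p_prime p5 by (simp add: totatives_prime)
  hence "2 \<in> (\<lambda>i. g ^ i mod CHAR('a)) ` {..<totient CHAR('a)}"
    using residue_primroot_is_generator[OF p1 g] by (simp add: bij_betw_def)
  then obtain i where i: "2 = g ^ i mod CHAR('a)" by (elim imageE)
  have "(of_nat (g ^ i) :: 'a) = of_nat (g ^ i mod CHAR('a))"
    by (simp only: of_nat_eq_iff_cong_CHAR cong_def mod_mod_trivial)
  hence gi: "of_nat g ^ i = (2 :: 'a)" using i by simp
  have gs: "of_nat g ^ (s - 1) = (- 1 :: 'a)"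
    using c_power_s neg_power_s[of 1] c(2) by simp
  have "(2 :: 'a) ^ (s - 1) = (of_nat g ^ (s - 1)) ^ i" by (simp add: mult.commute flip: gi power_mult)
  also have "\<dots> = 1 \<or> \<dots> = - 1" unfolding gs by (cases "even i") auto
  finally have "(2 :: 'a) ^ (s - 1) = 1 \<or> (2 :: 'a) ^ (s - 1) = - 1" .
  moreover have "(2 :: 'a) ^ s = 2 * 2 ^ (s - 1)" using s_pos by (simp flip: power_Suc)
  ultimately have two: "(2 :: 'a) ^ s = 2 \<or> (2 :: 'a) ^ s = - 2" by auto
  have "even (card {x. x ^ s + (1 - x) ^ s = \<kappa>})"
  proof (rule even_card_involution[where f = "\<lambda>x. 1 - x"])
    fix x assume "x \<in> {x. x ^ s + (1 - x) ^ s = \<kappa>}"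
    hence x: "x ^ s + (1 - x) ^ s = \<kappa>" by simp
    show "1 - x \<noteq> x"
    proof
      assume *: "1 - x = x"
      hence "2 * x = 1" by (simp add: algebra_simps)
      hence "2 ^ s * x ^ s = 1" by (metis power_mult_distrib power_one)
      hence "2 * x ^ s = 1 \<or> - (2 * x ^ s) = 1" using two by auto
      moreover have "\<kappa> = 2 * x ^ s" using x * by simp
      ultimately show False using \<kappa> by (metis minus_minus)
    qed
  qed (auto simp: add.commute)
  thus ?thesis by (simp add: Np_def)
qed

lemma not_swap:
  assumes c: "c \<noteq> 1" "CARD('a) \<noteq> 5" and S: "walsh_spectrum s TYPE('a) = {v1, v2, v3, v4}" "distinct [v1, v2, v3, v4]"
    and r: "rot v1 = v2" "rot v2 = v1" "rot v3 = v3" "rot v4 = v4"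
  shows False
proof -
  define M N L where "M = value_count v1" and "N = value_count v3" and "L = value_count v4"
  have m: "value_count v1 = M" "value_count v2 = M" "value_count v3 = N" "value_count v4 = L"
    using value_count_rot[of v1] S r by (simp_all add: M_def N_def L_def)
  define q where "q = int CARD('a)"
  have q5: "q > 5" using CARD_gt_5[OF c] by (simp add: q_def)
  note p5 = CHAR_ge_5[OF c(1)]
  have p2: "CHAR('a) \<noteq> 2" using p5 by simp
  have pq: "int CHAR('a) dvd q" using CARD_int field_degree_pos[where ?'a='a] by (simp add: q_def)
  have oddq: "odd q"
  proof -
    have "odd CHAR('a)" using p_prime p5 by (simp add: prime_odd_nat)
    thus ?thesis by (simp add: q_def CARD_eq)
  qed
  have cm1: "c = - 1" by (rule c_neg_1[OF c(1)]) (use S r in auto)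
  have Wneg: "W (- u) = rot (W u)" if "u \<noteq> 0" for u using rot_W'[OF that] cm1 by simp
  have Wcases: "W u \<in> {v1, v2, v3, v4}" if "u \<noteq> 0" for u using W_spec[OF that] S by simp
  obtain B' where B': "v3 = of_int B'" using rot_fixed_Ints[of v3] S(1) r by (auto elim: Ints_cases)
  obtain C' where C': "v4 = of_int C'" using rot_fixed_Ints[of v4] S(1) r by (auto elim: Ints_cases)
  obtain a' where a': "v1 + v2 = of_int a'" using pair_Ints(1)[of v1 v2] S(1) r by (auto elim: Ints_cases)
  obtain d where d: "(v1 - v2)\<^sup>2 = of_int d" using pair_Ints(3)[of v1 v2] S(1) r by (auto elim: Ints_cases)

  have R0: "2 * int M + int N + int L = q - 1"
  proof -
    have "complex_of_int (2 * int M + int N + int L) = of_int (q - 1)" using spec_moment_0 S by (simp add: m q_def add.assoc)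
    thus ?thesis by (simp only: of_int_eq_iff)
  qed
  have R1: "int M * a' + int N * B' + int L * C' = q"
  proof -
    have "of_nat M * (v1 + v2) + of_nat N * v3 + of_nat L * v4 = of_nat CARD('a)"
      using spec_moment_1 S by (simp add: m algebra_simps)
    hence "complex_of_int (int M * a' + int N * B' + int L * C') = of_int q" unfolding a' B' C' by (simp add: q_def)
    thus ?thesis by (simp only: of_int_eq_iff)
  qed
  have e1: "of_nat M * (v1 * v1 + v2 * v2) + (of_nat N * (v3 * v3) + of_nat L * (v4 * v4)) = of_nat CARD('a) ^ 2"
    using spec_moment_2 S by (simp add: m algebra_simps)
  have e2: "of_nat M * (2 * v1 * v2) + (of_nat N * (v3 * v3) + of_nat L * (v4 * v4)) = 0"
    using spec_moment_11[OF c(1)] S r by (simp add: m algebra_simps)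
  \<comment> \<open>The difference of \<open>e1\<close> and \<open>e2\<close> isolates (v1 - v2)^2;
    their sum gives \<open>R2\<close> below.\<close>
  have Md: "int M * d = q\<^sup>2"
  proof -
    have "of_nat M * (v1 - v2)\<^sup>2 = (of_nat M * (v1 * v1 + v2 * v2) + (of_nat N * (v3 * v3) + of_nat L * (v4 * v4)))
       - (of_nat M * (2 * v1 * v2) + (of_nat N * (v3 * v3) + of_nat L * (v4 * v4)))"
      by (simp add: power2_eq_square algebra_simps)
    also have "\<dots> = of_nat CARD('a) ^ 2" unfolding e1 e2 by simp
    finally have "complex_of_int (int M * d) = of_int (q\<^sup>2)" unfolding d by (simp add: q_def)
    thus ?thesis by (simp only: of_int_eq_iff)
  qed
  have R2: "int M * a'\<^sup>2 + 2 * (int N * B'\<^sup>2 + int L * C'\<^sup>2) = q\<^sup>2"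
  proof -
    have "of_nat M * (v1 + v2)\<^sup>2 + 2 * (of_nat N * v3\<^sup>2 + of_nat L * v4\<^sup>2)
       = (of_nat M * (v1 * v1 + v2 * v2) + (of_nat N * (v3 * v3) + of_nat L * (v4 * v4)))
       + (of_nat M * (2 * v1 * v2) + (of_nat N * (v3 * v3) + of_nat L * (v4 * v4)))"
      by (simp add: power2_eq_square algebra_simps)
    also have "\<dots> = of_nat CARD('a) ^ 2" unfolding e1 e2 by simp
    finally have "complex_of_int (int M * a'\<^sup>2 + 2 * (int N * B'\<^sup>2 + int L * C'\<^sup>2)) = of_int (q\<^sup>2)"
      unfolding a' B' C' by (simp add: q_def)
    thus ?thesis by (simp only: of_int_eq_iff)
  qed

  have M0: "int M > 0" using value_count_pos[of v1] S(1) m by simp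
  have NL0: "int N > 0" "int L > 0" using value_count_pos[of v3] value_count_pos[of v4] S(1) m by auto
  have Mdvd: "int M dvd int CHAR('a) ^ (field_degree TYPE('a) * 2)"
    using Md CARD_int by (metis dvd_triv_left power_mult q_def)
  obtain k where k: "int M = int CHAR('a) ^ k" using prime_power_int_dvdE[OF p_prime Mdvd M0] by metis
  have M5: "5 * int M \<le> q" unfolding k q_def CARD_int
    by (rule prime_power_gap[OF p5]) (use R0 M0 NL0 in \<open>simp flip: k CARD_int add: q_def\<close>)
  obtain u1 where u1: "u1 \<noteq> 0" "W u1 = v1" using S(1) spec_iff[of v1] by auto
  \<comment> \<open>If M = t^2, then t (v1 - v2) is the integer q or -q, but the automorphism swaps
    v1 and v2 and changes its sign.\<close>
  have nonsq: "int M \<noteq> t\<^sup>2" for t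
  proof
    assume t: "int M = t\<^sup>2"
    have "(of_int t * (v1 - v2))\<^sup>2 = complex_of_int (int M * d)" unfolding t by (simp add: power_mult_distrib d)
    also have "\<dots> = (of_int q)\<^sup>2" unfolding Md by simp
    finally have "of_int t * (v1 - v2) = of_int q \<or> of_int t * (v1 - v2) = of_int (- q)"
      by (simp add: power2_eq_iff)
    then obtain q' where q': "of_int t * (v1 - v2) = of_int q'" "q' = q \<or> q' = - q" by blast
    have "of_int t * (W (c * u1) - W (c * (c * u1))) = complex_of_int q'"
    proof (rule gal_transfer[of "\<lambda>u. of_int t * (W u - W (c * u))" "\<lambda>_. of_int q'"])
      show "gal (\<lambda>u. of_int t * (W u - W (c * u)))" by (intro gal_mult gal_diff gal_of_int gal_shift gal_W)
      show "gal (\<lambda>_. of_int q')" by (rule gal_of_int)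
    qed (use u1 q' r in \<open>simp add: rot_W'\<close>)
    hence "of_int t * (v2 - v1) = complex_of_int q'" using u1 r c_nonzero by (simp add: rot_W')
    hence "complex_of_int (q' + q') = of_int 0" using q'(1) by (simp add: algebra_simps)
    hence "q' + q' = 0" by (simp only: of_int_eq_iff)
    thus False using q'(2) q5 by auto
  qed
  have M1: "int M > 1" using nonsq[of 1] M0 by simp
  \<comment> \<open>A fixed value is taken at u and at -u, which differ in odd
    characteristic.\<close>
  have ge2: "value_count v \<ge> 2" if v: "v \<in> {v3, v4}" for v
  proof -
    obtain u where u: "u \<noteq> 0" "W u = v" using S(1) spec_iff[of v] v by auto
    have "u \<noteq> - u"
    proof
      assume "u = - u"
      hence "2 * u = 0" by (simp add: eq_neg_iff_add_eq_0)
      thus False using two_neq_0[OF p2] u by simp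
    qed
    hence "2 = card {u, - u}" by simp
    also have "\<dots> \<le> value_count v" unfolding value_count_def using u v r Wneg by (intro card_mono) auto
    finally show ?thesis .
  qed
  have NL: "int N \<ge> 2" "int L \<ge> 2" using ge2[of v3] ge2[of v4] m by auto

  obtain rr :: 'a where rr: "rr ^ s = 1 / 2" using root_ex by metis
  have rr0: "rr \<noteq> 0" using rr two_neq_0[OF p2] s_pos by (auto simp: power_0_left)
  define \<sigma> :: "'a \<Rightarrow> int" where "\<sigma> u = (if u = 0 then 0 else if W u = v1 then 1 else if W u = v2 then -1 else 0)" for u
  have odd: "W u - W (- u) = of_int (\<sigma> u) * (v1 - v2)" for u
    using Wcases[of u] Wneg[of u] r S(2) by (cases "u = 0") (auto simp: \<sigma>_def)
  \<comment> \<open>The autocorrelation of the odd part of W is (v1 - v2)^2 times an integer and, by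
    the reflection formula, also -q times a value of the even part; this makes all values
    divisible by q / M after symmetrization.\<close>
  have ev_dvd: "\<exists>j. of_nat M * (W w + W (- w)) = complex_of_int (q * j)" if w: "w \<noteq> 0" for w
  proof -
    define b where "b = w / rr"
    have b: "b \<noteq> 0" "b * rr = w" using w rr0 by (auto simp: b_def)
    define J where "J = (\<Sum>u\<in>UNIV. \<sigma> u * \<sigma> (u + b))"
    have "of_int d * of_int J = (\<Sum>u\<in>UNIV. (W u - W (- u)) * (W (u + b) - W (- (u + b))))"
      unfolding odd d[symmetric] J_def by (simp add: sum_distrib_left power2_eq_square mult_ac)
    also have "\<dots> = - of_int q * (W w + W (- w))"
      using sum_odd_part_translate[OF rr p2 b(1)] by (simp add: b(2) q_def)
    finally have eq: "of_int d * of_int J = - of_int q * (W w + W (- w))" .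
    define X where "X = of_nat M * (W w + W (- w))"
    have "complex_of_int (int M * d * J) = of_nat M * (of_int d * of_int J)" by simp
    also have "\<dots> = - (of_int q * X)" unfolding eq X_def by simp
    finally have "of_int q * X = - complex_of_int (q\<^sup>2 * J)" unfolding Md by (metis minus_minus)
    hence "of_int q * X = of_int q * complex_of_int (q * (- J))" by (simp add: power2_eq_square mult.assoc)
    hence "X = complex_of_int (q * (- J))" using q5 by (subst (asm) mult_left_cancel) auto
    thus ?thesis unfolding X_def by blast
  qed
  obtain a where a: "int M * a' = q * a"
  proof -
    obtain j where "of_nat M * (W u1 + W (- u1)) = complex_of_int (q * j)" using ev_dvd[OF u1(1)] by blast
    hence "complex_of_int (int M * a') = of_int (q * j)" using u1 Wneg r a' by simp
    hence "int M * a' = q * j" by (simp only: of_int_eq_iff)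
    thus ?thesis by (rule that)
  qed
  \<comment> \<open>The even part doubles a fixed value; the factor 2 drops out because q is
    odd.\<close>
  have fixed_dvd: "\<exists>x. int M * y = q * x" if "v \<in> {v3, v4}" "v = of_int y" for v y
  proof -
    have "v \<in> walsh_spectrum s TYPE('a)" using S(1) that(1) by blast
    then obtain u where u: "u \<noteq> 0" "W u = v" unfolding spec_iff by blast
    obtain j where "of_nat M * (W u + W (- u)) = complex_of_int (q * j)" using ev_dvd[OF u(1)] by blast
    moreover have "W (- u) = v" using Wneg[OF u(1)] u that r by auto
    ultimately have "complex_of_int (int M * (2 * y)) = of_int (q * j)" using u that by simp
    hence "int M * (2 * y) = q * j" by (simp only: of_int_eq_iff)
    hence "2 * (int M * y) = q * j" by simp
    hence "q dvd 2 * (int M * y)" by simp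
    moreover have "coprime q 2" using oddq by simp
    ultimately have "q dvd int M * y" by (simp add: coprime_dvd_mult_right_iff)
    thus ?thesis by (auto elim: dvdE)
  qed
  obtain B where B: "int M * B' = q * B" using fixed_dvd[of v3 B'] B' by auto
  obtain C where C: "int M * C' = q * C" using fixed_dvd[of v4 C'] C' by auto
  have q0: "q \<noteq> 0" using q5 by simp

  \<comment> \<open>In units of q / M the right-hand sides of the first two moments become M and
    M^2, free of q.\<close>
  have m1: "int M * a + int N * B + int L * C = int M"
  proof -
    have "q * (int M * a + int N * B + int L * C) = int M * (q * a) + int N * (q * B) + int L * (q * C)"
      by (simp add: algebra_simps)
    also have "\<dots> = int M * (int M * a' + int N * B' + int L * C')"
      unfolding a[symmetric] B[symmetric] C[symmetric] by (simp add: algebra_simps)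
    finally show ?thesis unfolding R1 using q0 by simp
  qed
  have m2: "int M * a\<^sup>2 + 2 * (int N * B\<^sup>2 + int L * C\<^sup>2) = (int M)\<^sup>2"
  proof -
    have "q\<^sup>2 * (int M * a\<^sup>2 + 2 * (int N * B\<^sup>2 + int L * C\<^sup>2))
      = int M * (q * a)\<^sup>2 + 2 * (int N * (q * B)\<^sup>2 + int L * (q * C)\<^sup>2)" by (simp add: power_mult_distrib algebra_simps)
    also have "\<dots> = (int M)\<^sup>2 * (int M * a'\<^sup>2 + 2 * (int N * B'\<^sup>2 + int L * C'\<^sup>2))"
      unfolding a[symmetric] B[symmetric] C[symmetric] by (simp add: power_mult_distrib algebra_simps)
    finally show ?thesis unfolding R2 using q0 by simp
  qed
  define V U where "V = int (Np 1)" and "U = int (Nm 1) - 1"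
  have U: "2 * int M ^ 3 * U = q * (- a * (int N * B\<^sup>2 + int L * C\<^sup>2) + 2 * int N * B ^ 3 + 2 * int L * C ^ 3)"
  proof -
    have "(\<Sum>u\<in>UNIV. W u * W (c * u) * W u) = of_nat CARD('a) ^ 2 * (of_nat (Nm 1) - 1)"
      using sum_WWmT[OF p2, of 1] cm1 by (simp add: W_eq_T)
    hence h1: "of_nat M * (v1 * v2 * (v1 + v2)) + (of_nat N * (v3 * v3 * v3) + of_nat L * (v4 * v4 * v4))
       = of_nat CARD('a) ^ 2 * (of_nat (Nm 1) - 1)"
      using sum_spec'[of "\<lambda>x y. x * y * x"] S r by (simp add: m algebra_simps)
    \<comment> \<open>The equation is arranged so that \<open>e2\<close> eliminates the product v1
      v2; only v1 + v2, v3 and v4 remain.\<close>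
    have "of_nat CARD('a) ^ 2 * (of_nat (Nm 1) - 1) * 2
       = (of_nat M * (2 * v1 * v2) + (of_nat N * (v3 * v3) + of_nat L * (v4 * v4))) * (v1 + v2)
       - (v1 + v2) * (of_nat N * (v3 * v3) + of_nat L * (v4 * v4)) + 2 * (of_nat N * (v3 * v3 * v3) + of_nat L * (v4 * v4 * v4))"
      unfolding h1[symmetric] by (simp add: algebra_simps)
    hence "complex_of_int (2 * q\<^sup>2 * U) = of_int (- a' * (int N * B'\<^sup>2 + int L * C'\<^sup>2) + 2 * int N * B' ^ 3 + 2 * int L * C' ^ 3)"
      unfolding e2 unfolding a' B' C' by (simp add: q_def U_def power2_eq_square power3_eq_cube algebra_simps)
    hence h2: "2 * q\<^sup>2 * U = - a' * (int N * B'\<^sup>2 + int L * C'\<^sup>2) + 2 * int N * B' ^ 3 + 2 * int L * C' ^ 3"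
      by (simp only: of_int_eq_iff)
    have "int M ^ 3 * (2 * q\<^sup>2 * U) = - (int M * a') * (int N * (int M * B')\<^sup>2 + int L * (int M * C')\<^sup>2)
       + 2 * int N * (int M * B') ^ 3 + 2 * int L * (int M * C') ^ 3"
      unfolding h2 by (simp add: power_mult_distrib power2_eq_square power3_eq_cube algebra_simps)
    also have "\<dots> = q\<^sup>2 * (q * (- a * (int N * B\<^sup>2 + int L * C\<^sup>2) + 2 * int N * B ^ 3 + 2 * int L * C ^ 3))"
      unfolding a B C by (simp add: power_mult_distrib power2_eq_square power3_eq_cube algebra_simps)
    finally have "q\<^sup>2 * (2 * int M ^ 3 * U) = q\<^sup>2 * (q * (- a * (int N * B\<^sup>2 + int L * C\<^sup>2) + 2 * int N * B ^ 3 + 2 * int L * C ^ 3))"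
      by (simp add: mult_ac)
    thus ?thesis using q0 by (subst (asm) mult_left_cancel) auto
  qed
  have V: "2 * int M * a ^ 3 + 3 * a * (int N * B\<^sup>2 + int L * C\<^sup>2) + 2 * int N * B ^ 3 + 2 * int L * C ^ 3 > 0"
  proof -
    have "1 ^ s + (1 - 1) ^ s = (1 :: 'a)" using s_pos by (simp add: power_0_left)
    hence "\<exists>x :: 'a. x ^ s + (1 - x) ^ s = 1" by blast
    hence V0: "V > 0" unfolding V_def Np_def by (auto simp: card_gt_0_iff)
    have h1: "of_nat M * (v1 * v1 * v1 + v2 * v2 * v2) + (of_nat N * (v3 * v3 * v3) + of_nat L * (v4 * v4 * v4))
       = of_nat CARD('a) ^ 2 * of_nat (Np 1)"
      using spec_moment_3 S by (simp add: m algebra_simps)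
    have "of_nat CARD('a) ^ 2 * of_nat (Np 1) * 2
       = 2 * of_nat M * ((v1 + v2) * (v1 + v2) * (v1 + v2))
       - 3 * (of_nat M * (2 * v1 * v2) + (of_nat N * (v3 * v3) + of_nat L * (v4 * v4))) * (v1 + v2)
       + 3 * (v1 + v2) * (of_nat N * (v3 * v3) + of_nat L * (v4 * v4)) + 2 * (of_nat N * (v3 * v3 * v3) + of_nat L * (v4 * v4 * v4))"
      unfolding h1[symmetric] by (simp add: algebra_simps)
    hence "complex_of_int (2 * q\<^sup>2 * V) = of_int (2 * int M * a' ^ 3 + 3 * a' * (int N * B'\<^sup>2 + int L * C'\<^sup>2) + 2 * int N * B' ^ 3 + 2 * int L * C' ^ 3)"
      unfolding e2 unfolding a' B' C' by (simp add: q_def V_def power2_eq_square power3_eq_cube algebra_simps)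
    hence h2: "2 * q\<^sup>2 * V = 2 * int M * a' ^ 3 + 3 * a' * (int N * B'\<^sup>2 + int L * C'\<^sup>2) + 2 * int N * B' ^ 3 + 2 * int L * C' ^ 3"
      by (simp only: of_int_eq_iff)
    have "int M ^ 3 * (2 * q\<^sup>2 * V) = 2 * int M * (int M * a') ^ 3 + 3 * (int M * a') * (int N * (int M * B')\<^sup>2 + int L * (int M * C')\<^sup>2)
       + 2 * int N * (int M * B') ^ 3 + 2 * int L * (int M * C') ^ 3"
      unfolding h2 by (simp add: power_mult_distrib power2_eq_square power3_eq_cube algebra_simps)
    also have "\<dots> = q ^ 3 * (2 * int M * a ^ 3 + 3 * a * (int N * B\<^sup>2 + int L * C\<^sup>2) + 2 * int N * B ^ 3 + 2 * int L * C ^ 3)"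
      unfolding a B C by (simp add: power_mult_distrib power2_eq_square power3_eq_cube algebra_simps)
    finally have *: "int M ^ 3 * (2 * q\<^sup>2 * V) = q ^ 3 * (2 * int M * a ^ 3 + 3 * a * (int N * B\<^sup>2 + int L * C\<^sup>2) + 2 * int N * B ^ 3 + 2 * int L * C ^ 3)" .
    have "0 < int M ^ 3 * (2 * q\<^sup>2 * V)" using V0 q5 M0 by simp
    hence "0 < q ^ 3 * (2 * int M * a ^ 3 + 3 * a * (int N * B\<^sup>2 + int L * C\<^sup>2) + 2 * int N * B ^ 3 + 2 * int L * C ^ 3)" unfolding * .
    moreover have "0 < q ^ 3" using q5 by simp
    ultimately show ?thesis by (simp only: zero_less_mult_pos)
  qed

  \<comment> \<open>Off 0, (Ev - 2 v3) (Ev - 2 v4) is a multiple of Od^2; correlating this with T \<kappa> gives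
    a linear relation between the numbers of solutions Np and Nm.\<close>
  have count: "(int M)\<^sup>2 * (Nt + 2 * m) + 4 * B * C * q = int M * ((a - 2 * B) * (a - 2 * C)) * (Nt - 2 * m)"
    if \<kappa>: "\<kappa> \<notin> {0, 1, - 1}" and Nt: "Nt = int (Np \<kappa>) + int (Np (- \<kappa>))" and mm: "m = int (Nm \<kappa>) - 1" for \<kappa> Nt m
  proof -
    define Ev Od where "Ev u = W u + W (- u)" and "Od u = W u - W (- u)" for u
    have "of_int d * ((Ev u - 2 * v3) * (Ev u - 2 * v4)) * T \<kappa> u
        = (v1 + v2 - 2 * v3) * (v1 + v2 - 2 * v4) * (Od u)\<^sup>2 * T \<kappa> u" for u
    \<comment> \<open>At u = 0 the relation between even and odd part need not hold, since W 0 = 0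
      belongs to no case; there the factor T vanishes.\<close>
    proof (cases "u = 0")
      case False
      have "(v2 - v1)\<^sup>2 = (v1 - v2)\<^sup>2" by (simp add: power2_commute)
      thus ?thesis using Wcases[OF False] Wneg[OF False] r
        by (auto simp: Ev_def Od_def d[symmetric] add.commute)
    qed (use \<kappa> in \<open>simp add: T_0_right\<close>)
    hence "(\<Sum>u\<in>UNIV. of_int d * ((Ev u - 2 * v3) * (Ev u - 2 * v4)) * T \<kappa> u)
        = (\<Sum>u\<in>UNIV. (v1 + v2 - 2 * v3) * (v1 + v2 - 2 * v4) * (Od u)\<^sup>2 * T \<kappa> u)" by (rule sum.cong[OF refl])
    also have "(\<Sum>u\<in>UNIV. of_int d * ((Ev u - 2 * v3) * (Ev u - 2 * v4)) * T \<kappa> u)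
       = of_int d * ((\<Sum>u\<in>UNIV. W u * W u * T \<kappa> u) + 2 * (\<Sum>u\<in>UNIV. W u * W (- u) * T \<kappa> u) + (\<Sum>u\<in>UNIV. W (- u) * W (- u) * T \<kappa> u)
          - 2 * (v3 + v4) * ((\<Sum>u\<in>UNIV. W u * T \<kappa> u) + (\<Sum>u\<in>UNIV. W (- u) * T \<kappa> u)) + 4 * v3 * v4 * (\<Sum>u\<in>UNIV. T \<kappa> u))"
      unfolding sum_distrib_left sum.distrib[symmetric] sum_subtractf[symmetric]
      by (intro sum.cong refl) (simp add: Ev_def algebra_simps)
    also have "(\<Sum>u\<in>UNIV. (v1 + v2 - 2 * v3) * (v1 + v2 - 2 * v4) * (Od u)\<^sup>2 * T \<kappa> u)
       = (v1 + v2 - 2 * v3) * (v1 + v2 - 2 * v4) * ((\<Sum>u\<in>UNIV. W u * W u * T \<kappa> u) - 2 * (\<Sum>u\<in>UNIV. W u * W (- u) * T \<kappa> u) + (\<Sum>u\<in>UNIV. W (- u) * W (- u) * T \<kappa> u))"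
      unfolding sum_distrib_left sum.distrib[symmetric] sum_subtractf[symmetric]
      by (intro sum.cong refl) (simp add: Od_def power2_eq_square algebra_simps)
    \<comment> \<open>Excluding kappa = 1 and kappa = -1 makes the terms from \<open>sum_WT\<close>
      and \<open>sum_WmT\<close> vanish.\<close>
    finally have "complex_of_int (d * (q\<^sup>2 * (Nt + 2 * m) + 4 * B' * C' * q))
       = of_int ((a' - 2 * B') * (a' - 2 * C') * (q\<^sup>2 * (Nt - 2 * m)))"
      using \<kappa> unfolding sum_WWT sum_WWmT[OF p2] sum_WmWmT sum_WT sum_WmT sum_T Nt mm a' B' C'
      by (simp add: q_def algebra_simps)
    hence h3: "d * (q\<^sup>2 * (Nt + 2 * m) + 4 * B' * C' * q) = (a' - 2 * B') * (a' - 2 * C') * (q\<^sup>2 * (Nt - 2 * m))"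
      by (simp only: of_int_eq_iff)
    have "(int M * d) * ((int M)\<^sup>2 * (q\<^sup>2 * (Nt + 2 * m)) + 4 * (int M * B') * (int M * C') * q)
       = int M ^ 3 * (d * (q\<^sup>2 * (Nt + 2 * m) + 4 * B' * C' * q))"
      by (simp add: power2_eq_square power3_eq_cube algebra_simps)
    also have "\<dots> = int M * (int M * a' - 2 * (int M * B')) * (int M * a' - 2 * (int M * C')) * (q\<^sup>2 * (Nt - 2 * m))"
      unfolding h3 by (simp add: power2_eq_square power3_eq_cube algebra_simps)
    finally have h4: "(int M * d) * ((int M)\<^sup>2 * (q\<^sup>2 * (Nt + 2 * m)) + 4 * (int M * B') * (int M * C') * q)
       = int M * (int M * a' - 2 * (int M * B')) * (int M * a' - 2 * (int M * C')) * (q\<^sup>2 * (Nt - 2 * m))" .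
    have "(q\<^sup>2 * q\<^sup>2) * ((int M)\<^sup>2 * (Nt + 2 * m) + 4 * B * C * q)
       = q\<^sup>2 * ((int M)\<^sup>2 * (q\<^sup>2 * (Nt + 2 * m)) + 4 * (q * B) * (q * C) * q)"
      by (simp add: power2_eq_square algebra_simps)
    also have "\<dots> = int M * (q * a - 2 * (q * B)) * (q * a - 2 * (q * C)) * (q\<^sup>2 * (Nt - 2 * m))"
      using h4 unfolding Md a B C .
    also have "\<dots> = (q\<^sup>2 * q\<^sup>2) * (int M * ((a - 2 * B) * (a - 2 * C)) * (Nt - 2 * m))"
      by (simp add: power2_eq_square algebra_simps)
    finally have "(q\<^sup>2 * q\<^sup>2) * ((int M)\<^sup>2 * (Nt + 2 * m) + 4 * B * C * q)
       = (q\<^sup>2 * q\<^sup>2) * (int M * ((a - 2 * B) * (a - 2 * C)) * (Nt - 2 * m))" .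
    thus ?thesis using q0 by (subst (asm) mult_left_cancel) auto
  qed

  have "CARD('a) > 3" using q5 by (simp add: q_def)
  then obtain \<kappa> where \<kappa>: "\<kappa> \<notin> {0, 1, - 1}" "Nm \<kappa> = 0 \<or> Nm \<kappa> = 1 \<and> Nm 1 = 1"
    using Nm_cases[OF p2] by metis
  define Nt mm where "Nt = int (Np \<kappa>) + int (Np (- \<kappa>))" and "mm = int (Nm \<kappa>) - 1"
  note cnt = count[OF \<kappa>(1) Nt_def mm_def]
  have Nt: "Nt \<ge> 0" "even Nt"
  proof -
    have "- \<kappa> \<noteq> 1" "- \<kappa> \<noteq> - 1" using \<kappa>(1) by (auto simp: minus_equation_iff[of \<kappa>])
    thus "even Nt" using Np_even[OF c(1) cm1, of \<kappa>] Np_even[OF c(1) cm1, of "- \<kappa>"] \<kappa>(1) by (simp add: Nt_def)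
  qed (simp add: Nt_def)
  \<comment> \<open>Either the parameter has no solution, or Nm 1 = 1 makes the third correlation U
    vanish; \<open>swap_zero_arith\<close> needs this alternative.\<close>
  have mm: "mm = 0 \<and> U = 0 \<or> mm = - 1" using \<kappa>(2) by (auto simp: mm_def U_def)
  have BC: "B \<noteq> C"
  proof
    assume "B = C"
    hence "int M * B' = int M * C'" using B C by simp
    hence "v3 = v4" using M0 B' C' by simp
    thus False using S(2) by simp
  qed
  show False
  proof (cases "B = 0 \<or> C = 0")
    case False
    show False
      by (rule swap_nonzero_arith[OF p_prime p5 _ k M1 M5 R0 m1 m2 NL _ _ Nt(1) _ cnt])
        (use False mm CARD_int in \<open>auto simp: q_def\<close>)
  next
    case True
    thus False
    proof
      assume B0: "B = 0"
      show False
      proof (rule swap_zero_arith[OF p_prime p5 k M1 _ nonsq, of q a "int L" C Nt mm U])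
        show "(int M)\<^sup>2 * (Nt + 2 * mm) = int M * (a * (a - 2 * C)) * (Nt - 2 * mm)" using cnt by (simp add: B0)
      qed (use q5 m1 m2 NL0 BC Nt mm U V in \<open>auto simp: B0\<close>)
    next
      assume C0: "C = 0"
      show False
      proof (rule swap_zero_arith[OF p_prime p5 k M1 _ nonsq, of q a "int N" B Nt mm U])
        show "(int M)\<^sup>2 * (Nt + 2 * mm) = int M * (a * (a - 2 * B)) * (Nt - 2 * mm)" using cnt by (simp add: C0 mult_ac)
      qed (use q5 m1 m2 NL0 BC Nt mm U V in \<open>auto simp: C0\<close>)
    qed
  qed
qed

end

section \<open>The field with five elements and the main theorem\<close>

text \<open>The square of t = z + z^4 is 2 + z^2 + z^3 = 1 - t, and t = 2 cos (2 pi / 5) > 0 selects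
  the root.\<close>

lemma fifth_root_of_unity_sums:
  fixes z :: complex
  defines "z \<equiv> cis (2 * pi / 5)"
  shows "z + z ^ 4 = (of_real (sqrt 5) - 1) / 2" "z ^ 2 + z ^ 3 = (- of_real (sqrt 5) - 1) / 2"
proof -
  have z5: "z ^ 5 = 1" by (simp add: z_def Complex.DeMoivre)
  have "cos (2 * pi / 5) > 0" by (rule cos_gt_zero) (use pi_gt_zero in linarith)+
  moreover have "z ^ 4 = cnj z"
  proof -
    have "z * z ^ 4 = 1" using z5 by (simp flip: power_Suc)
    moreover have "z * cnj z = 1" by (simp add: z_def complex_mult_cnj)
    ultimately show ?thesis by (metis mult_left_cancel mult_zero_left zero_neq_one)
  qed
  ultimately have real: "z + z ^ 4 = of_real (2 * cos (2 * pi / 5))" and pos: "2 * cos (2 * pi / 5) > 0"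
    by (simp_all add: complex_eq_iff z_def)
  define t where "t = 2 * cos (2 * pi / 5)"
  have "cos (2 * pi / 5) < 1" using cos_monotone_0_pi[of 0 "2 * pi / 5"] pi_gt_zero by simp
  hence "z \<noteq> 1" by (auto simp: z_def complex_eq_iff)
  moreover have "(z - 1) * (1 + z + z ^ 2 + z ^ 3 + z ^ 4) = z ^ 5 - 1"
    by (simp add: eval_nat_numeral algebra_simps)
  ultimately have sum0: "1 + (z + z ^ 4) + (z ^ 2 + z ^ 3) = 0" using z5 by (simp add: add_ac)
  have "(z + z ^ 4) ^ 2 = z ^ 2 + 2 * z ^ 5 + z ^ 5 * z ^ 3" by (simp add: eval_nat_numeral algebra_simps)
  hence "(z + z ^ 4) ^ 2 = 2 + (z ^ 2 + z ^ 3)" using z5 by simp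
  also have "z ^ 2 + z ^ 3 = - 1 - (z + z ^ 4)" using sum0 by (simp add: algebra_simps eq_neg_iff_add_eq_0)
  finally have "complex_of_real (t\<^sup>2) = of_real (1 - t)" unfolding real t_def[symmetric] by simp
  hence "t\<^sup>2 = 1 - t" by (simp only: of_real_eq_iff)
  hence "(2 * t + 1)\<^sup>2 = 5" by (simp add: power2_eq_square algebra_simps)
  hence "2 * t + 1 = sqrt 5" using pos by (intro real_sqrt_unique[symmetric]) (simp_all add: t_def)
  hence t: "t = (sqrt 5 - 1) / 2" by simp
  show one: "z + z ^ 4 = (of_real (sqrt 5) - 1) / 2" unfolding real t_def[symmetric] t by simp
  have "z ^ 2 + z ^ 3 = - 1 - (z + z ^ 4)" using sum0 by (simp add: algebra_simps eq_neg_iff_add_eq_0)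
  also have "\<dots> = (- of_real (sqrt 5) - 1) / 2" unfolding one by (simp add: field_simps)
  finally show "z ^ 2 + z ^ 3 = (- of_real (sqrt 5) - 1) / 2" .
qed

text \<open>On five elements x^s = x^3 and the trace is the identity, so every value is a sum of
  five explicit powers of z.\<close>

lemma walsh_spectrum_card_5:
  assumes q: "CARD('a::{field,finite}) = 5" and s: "s mod 4 = 3"
  shows "walsh_spectrum s TYPE('a) =
           {(5 + complex_of_real (sqrt 5)) / 2, (5 - complex_of_real (sqrt 5)) / 2,
            complex_of_real (sqrt 5), - complex_of_real (sqrt 5)}"
proof -
  have pn: "CHAR('a) ^ field_degree TYPE('a) = 5" using CARD_eq[where ?'a='a] q by simp
  hence "CHAR('a) dvd 5" using field_degree_pos[where ?'a='a] by (metis dvd_power)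
  moreover have "prime (5 :: nat)" by simp
  ultimately have p: "CHAR('a) = 5" using prime_CHAR_finite by (metis primes_dvd_imp_eq)
  have n: "field_degree TYPE('a) = 1"
    using pn unfolding p by (metis power_inject_exp power_one_right one_less_numeral_iff semiring_norm(77))
  define z where "z = cis (2 * pi / 5)"
  have root: "char_root TYPE('a) = z" by (simp add: char_root_def p z_def)
  have z5: "z ^ m = z ^ (m mod 5)" for m
    using char_root_power_cong[of m "m mod 5", where ?'a='a] by (simp add: p root cong_def)
  have tr: "abs_trace (1 :: 'a) = 1" by (simp add: abs_trace_def n)
  have "trace_residue (1 :: 'a) = 1"
    using trace_residue[of "1 :: 'a"] of_nat_CHAR_inj[of "trace_residue (1 :: 'a)" 1, where ?'a='a] by (simp add: tr p)
  hence "add_char (1 :: 'a) = z" by (simp add: add_char_eq root)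
  hence char: "add_char (of_nat k :: 'a) = z ^ k" for k using add_char_of_nat_mult[of k "1 :: 'a"] by simp
  have UNIV: "(UNIV :: 'a set) = of_nat ` {..<5}"
    using prime_field_iff[where ?'a='a] power_card_same[where ?'a='a] by (auto simp: p q)
  have inj: "inj_on (of_nat :: nat \<Rightarrow> 'a) {..<5}" using of_nat_CHAR_inj[where ?'a='a] by (intro inj_onI) (auto simp: p)
  have cube: "x ^ s = x ^ 3" for x :: 'a
  proof (cases "x = 0")
    case False
    have "s = 4 * (s div 4) + 3" using s by presburger
    hence "x ^ s = (x ^ 4) ^ (s div 4) * x ^ 3" by (metis power_add power_mult)
    thus ?thesis using power_card_minus_1[OF False] by (simp add: q)
  qed (use s in \<open>auto simp: power_0_left\<close>)
  have five: "(5 :: 'a) = 0" using of_nat_CHAR[where ?'a='a] by (simp add: p)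
  \<comment> \<open>5 - j replaces -j to keep the exponents natural numbers.\<close>
  have W: "walsh_value s (of_nat j :: 'a) = (\<Sum>k<5. z ^ ((k ^ 3 + (5 - j) * k) mod 5))" if "j < 5" for j
  proof -
    have "walsh_value s (of_nat j :: 'a) = (\<Sum>k<5. add_char (of_nat k ^ 3 - of_nat j * of_nat k :: 'a))"
      unfolding walsh_value_def UNIV by (subst sum.reindex[OF inj]) (simp add: cube)
    also have "\<dots> = (\<Sum>k<5. add_char (of_nat (k ^ 3 + (5 - j) * k) :: 'a))"
    proof -
      have "(of_nat j :: 'a) = - of_nat (5 - j)" using that by (simp add: of_nat_diff five)
      thus ?thesis by (simp only: of_nat_add of_nat_mult of_nat_power mult_minus_left diff_minus_eq_add)
    qed
    also have "\<dots> = (\<Sum>k<5. z ^ (k ^ 3 + (5 - j) * k))" by (simp only: char)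
    also have "\<dots> = (\<Sum>k<5. z ^ ((k ^ 3 + (5 - j) * k) mod 5))" by (intro sum.cong refl z5)
    finally show ?thesis .
  qed
  have UNIV': "UNIV - {0} = (of_nat ` {1, 2, 3, 4} :: 'a set)"
  proof -
    have "{..<5 :: nat} = insert 0 {1, 2, 3, 4}" by auto
    hence "(UNIV :: 'a set) = insert 0 (of_nat ` {1, 2, 3, 4})" unfolding UNIV by simp
    moreover have "(0 :: 'a) \<notin> of_nat ` {1, 2, 3, 4}"
    proof
      assume "(0 :: 'a) \<in> of_nat ` {1, 2, 3, 4}"
      then obtain k where k: "(0 :: 'a) = of_nat k" "k \<in> {1, 2, 3, 4}" by (elim imageE)
      hence "(of_nat k :: 'a) = of_nat 0" by simp
      hence "k = 0" using k(2) by (intro of_nat_CHAR_inj[where ?'a='a]) (auto simp: p)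
      thus False using k by simp
    qed
    ultimately show ?thesis by blast
  qed
  note z_sums = fifth_root_of_unity_sums[folded z_def]
  have less5: "{..<5 :: nat} = {0, 1, 2, 3, 4}" by auto
  have "walsh_value s (of_nat 1 :: 'a) = 3 + (z + z ^ 4)" by (subst W) (simp_all add: less5 power2_eq_square)
  moreover have "walsh_value s (of_nat 2 :: 'a) = 1 + 2 * (z + z ^ 4)" by (subst W) (simp_all add: less5 power2_eq_square)
  moreover have "walsh_value s (of_nat 3 :: 'a) = 1 + 2 * (z ^ 2 + z ^ 3)" by (subst W) (simp_all add: less5 power2_eq_square)
  moreover have "walsh_value s (of_nat 4 :: 'a) = 3 + (z ^ 2 + z ^ 3)" by (subst W) (simp_all add: less5 power2_eq_square)
  ultimately have "walsh_spectrum s TYPE('a)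
     = {3 + (z + z ^ 4), 1 + 2 * (z + z ^ 4), 1 + 2 * (z ^ 2 + z ^ 3), 3 + (z ^ 2 + z ^ 3)}"
    unfolding walsh_spectrum_def UNIV' by (simp only: image_insert image_empty)
  also have "\<dots> = {(5 + complex_of_real (sqrt 5)) / 2, complex_of_real (sqrt 5),
            - complex_of_real (sqrt 5), (5 - complex_of_real (sqrt 5)) / 2}"
    unfolding z_sums by (simp add: field_simps)
  finally show ?thesis by blast
qed

theorem theorem1p5:
  fixes s :: nat
  assumes "s > 0"
    and "coprime s (CARD('a::{field,finite}) - 1)"
    and "card (walsh_spectrum s TYPE('a)) = 4"
  shows "if CARD('a) = 5 \<and> s mod 4 = 3
         then walsh_spectrum s TYPE('a) =
                {(5 + complex_of_real (sqrt 5)) / 2, (5 - complex_of_real (sqrt 5)) / 2,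
                 complex_of_real (sqrt 5), - complex_of_real (sqrt 5)}
         else walsh_spectrum s TYPE('a) \<subseteq> \<int>"
proof (cases "CARD('a) = 5 \<and> s mod 4 = 3")
  case True
  thus ?thesis using walsh_spectrum_card_5[where ?'a='a, of s] by (simp only: if_True simp_thms)
next
  case False
  interpret weil_sums s "TYPE('a)" by unfold_locales (use assms in auto)
  have "CHAR('a) = 2 \<or> odd CHAR('a)"
    using p_prime prime_odd_nat prime_ge_2_nat[OF p_prime] by force
  moreover have "CHAR('a) \<in> {p ^ k |p k. prime p \<and> odd p \<and> k > 0}" if "odd CHAR('a)"
    using p_prime that by (intro CollectI exI[of _ "CHAR('a)"] exI[of _ 1]) simp
  ultimately have "CHAR('a) \<in> cyclic_moduli" unfolding cyclic_moduli_def by blast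
  then obtain g where g: "residue_primroot CHAR('a) g" using residue_primroot_iff_in_cyclic_moduli by blast
  have "\<not> CHAR('a) dvd g"
    using g p_prime by (metis coprime_absorb_left not_prime_unit residue_primroot_def)
  hence g0: "(of_nat g :: 'a) \<noteq> 0" by (simp add: of_nat_eq_0_iff_char_dvd)
  obtain a :: 'a where a: "a ^ s = 1 / of_nat g" using root_ex by metis
  interpret weil_conj s "TYPE('a)" g a by unfold_locales (use g a g0 in auto)
  have "walsh_spectrum s TYPE('a) \<subseteq> \<int>"
  proof (rule ccontr)
    assume "\<not> walsh_spectrum s TYPE('a) \<subseteq> \<int>"
    then obtain v where v: "v \<in> walsh_spectrum s TYPE('a)" "v \<notin> \<int>" by blast
    have rv: "rot v \<noteq> v" using rot_fixed_Ints v by blast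
    have c1: "c \<noteq> 1"
    proof
      assume "c = 1"
      hence "rot v = v" using v(1) by (auto simp: spec_iff rot_W)
      thus False using rv by simp
    qed
    \<comment> \<open>With c not 1, five elements would be the exceptional case, which this branch
      excludes.\<close>
    have q5: "CARD('a) \<noteq> 5" using CARD_5[OF c1] False by blast
    have inj: "inj_on rot (walsh_spectrum s TYPE('a))" using rot_inj by (intro inj_onI) blast
    obtain v1 v2 v3 v4 where S: "walsh_spectrum s TYPE('a) = {v1, v2, v3, v4}" "distinct [v1, v2, v3, v4]"
      and r: "rot v1 = v2"
        "rot v2 = v1 \<and> rot v3 = v3 \<and> rot v4 = v4 \<or> rot v2 = v1 \<and> rot v3 = v4 \<and> rot v4 = v3 \<or>
         rot v2 = v3 \<and> rot v3 = v1 \<and> rot v4 = v4 \<or> rot v2 = v3 \<and> rot v3 = v4 \<and> rot v4 = v1"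
      by (rule permutation_of_four[where r = rot, OF assms(3) rot_spec inj v(1) rv])
    from r(2) show False
      using not_swap[OF c1 q5 S r(1)] not_two_pairs[OF c1 q5 S r(1)]
        not_three_cycle[OF c1 q5 S r(1)] not_four_cycle[OF c1 q5 S r(1)] by blast
  qed
  thus ?thesis using False by (simp only: if_False)
qed

end
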